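(* Let $f^\pm\in C(B_1^\pm\cup T)\cap L^\infty(B_1)$ and $g\in C(T)$. Let $u,v\in C(\overline{B_1})$ be bounded, with $u$ a viscosity subsolution and $v$ a viscosity supersolution of $$\omega(x)F^\pm(D^2u)=f^\pm\ \text{in }B_1^\pm,\qquad u^+_{x_d}-u^-_{x_d}=g\ \text{on }T.$$ If $u\le v$ on $\partial B_1$, then $u\le v$ in $B_1$.
   Context: Flat setting: $x=(x',x_d)$, $B_1^\pm=B_1\cap\{\pm x_d>0\}$, $T=B_1\cap\{x_d=0\}$, $a\in(0,1)$ constant, $\omega(x)=|x_d|^a$; $F^\pm:S(d)\to\mathbb R$ satisfy $\lambda|N|\le F^\pm(M+N)-F^\pm(M)\le\Lambda|N|$ for all symmetric $M$ and $N\ge0$. Viscosity subsolution: for $\varphi$ touching $u$ from above at $x_0\in B_1$: if $x_0\in B_1^\pm$ and $\varphi\in C^2(B_\delta(x_0))$ then $\omega(x_0)F^\pm(D^2\varphi(x_0))\ge f^\pm(x_0)$; if $x_0\in T$ and $\varphi\in C^1(\overline{B_\delta^+(x_0)})\cap C^1(\overline{B_\delta^-(x_0)})$ then $\varphi^+_{x_d}(x_0)-\varphi^-_{x_d}(x_0)\ge g(x_0)$ ($\varphi^\pm=\varphi|_{B_\delta(x_0)\cap\{\pm x_d>0\}}$). Supersolution: symmetric with touching from below and reversed inequalities. *)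

theory Defs
  imports "HOL-Analysis.Analysis"
begin

text \<open>Flat setting in R^d, d = CARD('n). The distinguished coordinate e :: 'n plays
  the role of x_d.\<close>

definition Bplus :: "'n::finite \<Rightarrow> (real^'n) set" where
  "Bplus e = {x \<in> ball 0 1. x $ e > 0}"

definition Bminus :: "'n::finite \<Rightarrow> (real^'n) set" where
  "Bminus e = {x \<in> ball 0 1. x $ e < 0}"

definition Tflat :: "'n::finite \<Rightarrow> (real^'n) set" where
  "Tflat e = {x \<in> ball 0 1. x $ e = 0}"

definition weight :: "real \<Rightarrow> 'n::finite \<Rightarrow> real^'n \<Rightarrow> real" where
  "weight a e x = \<bar>x $ e\<bar> powr a"

definition symmetric_mat :: "real^'n^'n \<Rightarrow> bool" where
  "symmetric_mat M \<longleftrightarrow> transpose M = M"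

definition psd_mat :: "real^'n^'n \<Rightarrow> bool" where
  "psd_mat N \<longleftrightarrow> symmetric_mat N \<and> (\<forall>x. 0 \<le> x \<bullet> (N *v x))"

definition mat_norm :: "real^'n^'n \<Rightarrow> real" where
  "mat_norm N = onorm (\<lambda>x. N *v x)"

definition uniformly_elliptic :: "real \<Rightarrow> real \<Rightarrow> (real^'n^'n \<Rightarrow> real) \<Rightarrow> bool" where
  "uniformly_elliptic lam Lam F \<longleftrightarrow>
     (\<forall>M N. symmetric_mat M \<and> psd_mat N \<longrightarrow>
        lam * mat_norm N \<le> F (M + N) - F M \<and> F (M + N) - F M \<le> Lam * mat_norm N)"

definition C2_with_hessian :: "(real^'n \<Rightarrow> real) \<Rightarrow> (real^'n \<Rightarrow> real^'n^'n) \<Rightarrow> (real^'n) set \<Rightarrow> bool" where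
  "C2_with_hessian \<phi> H S \<longleftrightarrow>
     (\<exists>G. (\<forall>y\<in>S. (\<phi> has_derivative (\<lambda>h. G y \<bullet> h)) (at y)) \<and>
          (\<forall>y\<in>S. (G has_derivative (\<lambda>h. H y *v h)) (at y)) \<and>
          continuous_on S H)"

definition C1_upto_with_grad :: "(real^'n \<Rightarrow> real) \<Rightarrow> (real^'n \<Rightarrow> real^'n) \<Rightarrow> (real^'n) set \<Rightarrow> bool" where
  "C1_upto_with_grad \<phi> G K \<longleftrightarrow>
     (\<forall>y\<in>K. (\<phi> has_derivative (\<lambda>h. G y \<bullet> h)) (at y within K)) \<and> continuous_on K G"

definition viscosity_subsolution ::
  "real \<Rightarrow> 'n::finite \<Rightarrow> (real^'n^'n \<Rightarrow> real) \<Rightarrow> (real^'n^'n \<Rightarrow> real) \<Rightarrow>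
   (real^'n \<Rightarrow> real) \<Rightarrow> (real^'n \<Rightarrow> real) \<Rightarrow> (real^'n \<Rightarrow> real) \<Rightarrow> (real^'n \<Rightarrow> real) \<Rightarrow> bool" where
  "viscosity_subsolution a e Fp Fm fp fm g u \<longleftrightarrow>
    (\<forall>x0 \<delta> \<phi> H. x0 \<in> Bplus e \<and> 0 < \<delta> \<and> ball x0 \<delta> \<subseteq> ball 0 1 \<and>
        \<phi> x0 = u x0 \<and> (\<forall>y\<in>ball x0 \<delta>. u y \<le> \<phi> y) \<and> C2_with_hessian \<phi> H (ball x0 \<delta>)
        \<longrightarrow> weight a e x0 * Fp (H x0) \<ge> fp x0) \<and>
    (\<forall>x0 \<delta> \<phi> H. x0 \<in> Bminus e \<and> 0 < \<delta> \<and> ball x0 \<delta> \<subseteq> ball 0 1 \<and>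
        \<phi> x0 = u x0 \<and> (\<forall>y\<in>ball x0 \<delta>. u y \<le> \<phi> y) \<and> C2_with_hessian \<phi> H (ball x0 \<delta>)
        \<longrightarrow> weight a e x0 * Fm (H x0) \<ge> fm x0) \<and>
    (\<forall>x0 \<delta> \<phi> Gp Gm. x0 \<in> Tflat e \<and> 0 < \<delta> \<and> ball x0 \<delta> \<subseteq> ball 0 1 \<and>
        \<phi> x0 = u x0 \<and> (\<forall>y\<in>ball x0 \<delta>. u y \<le> \<phi> y) \<and>
        C1_upto_with_grad \<phi> Gp {y \<in> cball x0 \<delta>. y $ e \<ge> 0} \<and>
        C1_upto_with_grad \<phi> Gm {y \<in> cball x0 \<delta>. y $ e \<le> 0}
        \<longrightarrow> Gp x0 $ e - Gm x0 $ e \<ge> g x0)"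

definition viscosity_supersolution ::
  "real \<Rightarrow> 'n::finite \<Rightarrow> (real^'n^'n \<Rightarrow> real) \<Rightarrow> (real^'n^'n \<Rightarrow> real) \<Rightarrow>
   (real^'n \<Rightarrow> real) \<Rightarrow> (real^'n \<Rightarrow> real) \<Rightarrow> (real^'n \<Rightarrow> real) \<Rightarrow> (real^'n \<Rightarrow> real) \<Rightarrow> bool" where
  "viscosity_supersolution a e Fp Fm fp fm g u \<longleftrightarrow>
    (\<forall>x0 \<delta> \<phi> H. x0 \<in> Bplus e \<and> 0 < \<delta> \<and> ball x0 \<delta> \<subseteq> ball 0 1 \<and>
        \<phi> x0 = u x0 \<and> (\<forall>y\<in>ball x0 \<delta>. \<phi> y \<le> u y) \<and> C2_with_hessian \<phi> H (ball x0 \<delta>)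
        \<longrightarrow> weight a e x0 * Fp (H x0) \<le> fp x0) \<and>
    (\<forall>x0 \<delta> \<phi> H. x0 \<in> Bminus e \<and> 0 < \<delta> \<and> ball x0 \<delta> \<subseteq> ball 0 1 \<and>
        \<phi> x0 = u x0 \<and> (\<forall>y\<in>ball x0 \<delta>. \<phi> y \<le> u y) \<and> C2_with_hessian \<phi> H (ball x0 \<delta>)
        \<longrightarrow> weight a e x0 * Fm (H x0) \<le> fm x0) \<and>
    (\<forall>x0 \<delta> \<phi> Gp Gm. x0 \<in> Tflat e \<and> 0 < \<delta> \<and> ball x0 \<delta> \<subseteq> ball 0 1 \<and>
        \<phi> x0 = u x0 \<and> (\<forall>y\<in>ball x0 \<delta>. \<phi> y \<le> u y) \<and>
        C1_upto_with_grad \<phi> Gp {y \<in> cball x0 \<delta>. y $ e \<ge> 0} \<and>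
        C1_upto_with_grad \<phi> Gm {y \<in> cball x0 \<delta>. y $ e \<le> 0}
        \<longrightarrow> Gp x0 $ e - Gm x0 $ e \<le> g x0)"

end

theory Submission
  imports Defs "HOL-Complex_Analysis.Great_Picard"
begin

text \<open>
  Adding \<open>\<eta> (|x\<^sub>d| + |x\<^sub>d| powr (2 - a))\<close> makes \<open>u\<close> strict by a fixed amount, both in the equation and
  in the jump condition. If \<open>u - v\<close> had a positive maximum, one doubles variables in the tangential
  directions only, so the maximum is reached at two points of the same height, where the singular
  weight is the same.

  Off the interface, translating both functions gives an interior contact, which is excluded by
  Jensen's method. Alexandrov's theorem is replaced by a weaker statement: at some point of any set of
  positive measure and at some small scale, a function with second differences \<open>O(|h|\<^sup>2)\<close> is within
  \<open>\<sigma> r\<^sup>2\<close> of a quadratic polynomial. This follows from a parallelogram-law energy identity over dyadic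
  scales and is enough to build test functions.

  On the interface, the tangential sup-convolutions of \<open>u\<close> and \<open>-v\<close> are semiconvex along the
  interface. A bound on the normal axis at one small height spreads tangentially by semiconvexity and
  is carried down to the interface by a barrier, so \<open>u\<close> and \<open>v\<close> have matching one-sided normal slopes
  up to any \<open>\<delta>\<close>. These slopes give test functions whose jumps contradict strictness.
\<close>

section \<open>Second and third differences\<close>

text \<open>The exponent \<open>2 - a\<close> is dictated by the weight: |x_e|^(2-a) has second
  derivative (2-a)(1-a)|x_e|^(-a), which |x_e|^a turns into a constant, and zero normal slope at the
  interface, so that |x_e| alone feeds the jump. Points at different heights would see weights whose
  ratio is uncontrolled near the interface, leaving two equations that cannot be compared. At equal
  heights, with operators that see only the Hessian, a common translation leaves the penalty
  unchanged, and what remains is a plain contact of two translated functions under one weight. The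
  interface condition is tested by C^1 functions, so second-order jets say nothing there: genuine
  one-sided slopes are needed, but only up to an error, and tangential quadratic terms of any size
  are free. Third differences enter because a continuous function on which they vanish is quadratic.
  Their convergence to zero in mean suffices: for a given tolerance the contradiction asks for one
  point and one scale only.\<close>

definition diff2 :: "('a::real_vector \<Rightarrow> real) \<Rightarrow> 'a \<Rightarrow> 'a \<Rightarrow> 'a \<Rightarrow> real" where
  "diff2 P h k x = P (x + h + k) - P (x + h) - P (x + k) + P x"

definition diff3 :: "('a::real_vector \<Rightarrow> real) \<Rightarrow> 'a \<Rightarrow> 'a \<Rightarrow> 'a \<Rightarrow> real" where
  "diff3 P h k x = diff2 P h k (x + h) - diff2 P h k x"

text \<open>The pairs x, x+h+k and x+h, x+k are the ends of the two diagonals of a parallelogram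
  with centre \<open>c\<close>, so \<open>diff2\<close> is a difference of two symmetric second
  differences at \<open>c\<close>. The half-diagonals satisfy |s|^2 + |d|^2 = (|h|^2 +
  |k|^2)/2.\<close>

lemma diff2_bound:
  fixes P :: "'a::real_inner \<Rightarrow> real"
  assumes "\<And>x h. \<bar>P (x + h) + P (x - h) - 2 * P x\<bar> \<le> C * (h \<bullet> h)"
  shows "\<bar>diff2 P h k x\<bar> \<le> C * (h \<bullet> h + k \<bullet> k) / 2"
proof -
  define c s d where "c = x + (1/2) *\<^sub>R (h + k)" and "s = (1/2) *\<^sub>R (h + k)" and "d = (1/2) *\<^sub>R (h - k)"
  have half: "(1/2) *\<^sub>R y + (1/2) *\<^sub>R y = y" for y :: 'a
    by (simp flip: scaleR_add_left)
  have half': "(1/2) *\<^sub>R y + ((1/2) *\<^sub>R y + z) = y + z" for y z :: 'a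
    using half[of y] by (simp flip: add.assoc)
  have e: "c + s = x + h + k" "c - s = x" "c + d = x + h" "c - d = x + k"
    unfolding c_def s_def d_def by (simp_all add: algebra_simps half half')
  have "diff2 P h k x = (P (c + s) + P (c - s) - 2 * P c) - (P (c + d) + P (c - d) - 2 * P c)"
    unfolding diff2_def e by simp
  moreover have "s \<bullet> s + d \<bullet> d = (h \<bullet> h + k \<bullet> k) / 2"
    unfolding s_def d_def by (simp add: inner_simps inner_commute field_simps)
  then have "C * (s \<bullet> s) + C * (d \<bullet> d) = C * (h \<bullet> h + k \<bullet> k) / 2"
    by (metis distrib_left times_divide_eq_right)
  ultimately show ?thesis
    using assms[of c s] assms[of c d] by linarith
qed

text \<open>The mixed difference with doubled steps is a sum a+b+c+d over four translates, and
  4(a^2+b^2+c^2+d^2) - (a+b+c+d)^2 is the sum of the squares of all pairwise differences. Only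
  (b-a)^2 is kept: it is the square of \<open>diff3\<close>.\<close>

lemma diff2_double_le:
  "(diff2 P (2 *\<^sub>R h) (2 *\<^sub>R k) x)\<^sup>2 + (diff3 P h k x)\<^sup>2
    \<le> 4 * ((diff2 P h k x)\<^sup>2 + (diff2 P h k (x + h))\<^sup>2 + (diff2 P h k (x + k))\<^sup>2 + (diff2 P h k (x + (h + k)))\<^sup>2)"
proof -
  have *: "(a + b + c + d)\<^sup>2 + (b - a)\<^sup>2 \<le> 4 * (a\<^sup>2 + b\<^sup>2 + c\<^sup>2 + d\<^sup>2)" for a b c d :: real
  proof -
    have "0 \<le> (a - c)\<^sup>2 + (a - d)\<^sup>2 + (b - c)\<^sup>2 + (b - d)\<^sup>2 + (c - d)\<^sup>2" by simp
    then show ?thesis by (simp add: power2_eq_square algebra_simps)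
  qed
  have "diff2 P (2 *\<^sub>R h) (2 *\<^sub>R k) x
      = diff2 P h k x + diff2 P h k (x + h) + diff2 P h k (x + k) + diff2 P h k (x + (h + k))"
    unfolding diff2_def by (simp add: scaleR_2 algebra_simps)
  then show ?thesis
    unfolding diff3_def using * by metis
qed

section \<open>Continuity and integral bounds for the energy estimate\<close>

lemma continuous_on_differences:
  fixes P :: "'a::real_normed_vector \<Rightarrow> real"
  assumes "continuous_on UNIV P"
  shows "continuous_on UNIV (diff2 P h k)" "continuous_on UNIV (diff3 P h k)"
proof -
  have P: "continuous_on S (\<lambda>x. P (f x))" if "continuous_on S f" for f :: "'a \<Rightarrow> 'a" and S
    using continuous_on_compose2[OF assms that] by simp
  show "continuous_on UNIV (diff2 P h k)"
    unfolding diff2_def by (intro continuous_intros P)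
  show "continuous_on UNIV (diff3 P h k)"
    unfolding diff3_def diff2_def by (intro continuous_intros P)
qed

lemma integrable_cball_mult:
  fixes f :: "'a::euclidean_space \<Rightarrow> real"
  assumes "continuous_on UNIV f" "compact S"
  shows "integrable lborel (\<lambda>x. indicator S x * f x)"
  using borel_integrable_compact[OF assms(2) continuous_on_subset[OF assms(1)]] by simp

lemma integral_cball_translate_le:
  fixes f :: "'a::euclidean_space \<Rightarrow> real"
  assumes f: "continuous_on UNIV f" and nn: "\<And>x. 0 \<le> f x" and z: "norm z \<le> s"
  shows "(\<integral>x. indicator (cball 0 R) x * f (x + z) \<partial>lborel) \<le> (\<integral>x. indicator (cball 0 (R + s)) x * f x \<partial>lborel)"
proof -
  define g where "g y = indicator (cball 0 R) (y - z) * f y" for y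
  have geq: "g = (\<lambda>y. indicator (cball z R) y * f y)"
    unfolding g_def by (auto simp: indicator_def dist_norm norm_minus_commute)
  have gm: "g \<in> borel_measurable borel"
    unfolding geq using borel_measurable_continuous_onI[OF f] by (intro borel_measurable_times borel_measurable_indicator) auto
  have "(\<integral>x. indicator (cball 0 R) x * f (x + z) \<partial>lborel) = (\<integral>x. g (z + x) \<partial>lborel)"
    unfolding g_def by (simp add: add.commute)
  also have "\<dots> = (\<integral>x. g x \<partial>distr lborel borel ((+) z))"
    using gm by (subst integral_distr) auto
  also have "\<dots> = (\<integral>x. g x \<partial>lborel)"
    by (simp add: lborel_distr_plus)
  also have "\<dots> \<le> (\<integral>x. indicator (cball 0 (R + s)) x * f x \<partial>lborel)"
  proof (rule integral_mono)
    show "integrable lborel g"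
      unfolding geq using integrable_cball_mult[OF f] by simp
    show "integrable lborel (\<lambda>x. indicator (cball 0 (R + s)) x * f x)"
      using integrable_cball_mult[OF f] by simp
    show "g x \<le> indicator (cball 0 (R + s)) x * f x" for x
    proof (cases "x \<in> cball z R")
      case True
      then have "norm x \<le> R + s"
        using z norm_triangle_ineq[of z "x - z"] by (simp add: dist_norm norm_minus_commute)
      then show ?thesis using True by (simp add: geq)
    qed (simp add: geq nn)
  qed
  finally show ?thesis .
qed

text \<open>Doubling the step averages \<open>D\<^sub>h D\<^sub>k P\<close> over translates, so by the parallelogram law its
  normalised energy loses exactly the variance, which controls the third difference; the energies along
  dyadic scales are thus increasing and bounded. The radii grow slightly to absorb the translations.\<close>

lemma diff3_energy_tendsto_0:
  fixes P :: "'a::euclidean_space \<Rightarrow> real"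
  assumes P: "continuous_on UNIV P"
    and bd: "\<And>x h. \<bar>P (x + h) + P (x - h) - 2 * P x\<bar> \<le> C * (h \<bullet> h)"
  shows "(\<lambda>j. 16^j * (\<integral>x. indicator (cball 0 R) x * (diff3 P ((1/2)^j *\<^sub>R h) ((1/2)^j *\<^sub>R k) x)\<^sup>2 \<partial>lborel)) \<longlonglongrightarrow> 0"
proof -
  define r where "r j = (1/2::real)^j" for j :: nat
  define N where "N = norm h + norm k"
  define q where "q j = diff2 P (r j *\<^sub>R h) (r j *\<^sub>R k)" for j
  define t where "t j = diff3 P (r j *\<^sub>R h) (r j *\<^sub>R k)" for j
  \<comment> \<open>The increment \<open>r (Suc j) * N\<close> bounds all four shifts at that scale,
    and the increments sum to \<open>N\<close>.\<close>
  define Rj where "Rj j = R + N * (1 - r j)" for j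
  \<comment> \<open>Second differences at scale r have size r^2, so 16^j = r^(-4) normalises their
    squares.\<close>
  define E where "E j = 16^j * (\<integral>x. indicator (cball 0 (Rj j)) x * (q j x)\<^sup>2 \<partial>lborel)" for j
  define D where "D j = (\<integral>x. indicator (cball 0 R) x * (t j x)\<^sup>2 \<partial>lborel)" for j
  have N0: "0 \<le> N" and r0: "0 < r j" and r1: "r j \<le> 1" for j
    unfolding N_def r_def by (auto simp: power_le_one)
  have rS: "r j = 2 * r (Suc j)" for j unfolding r_def by simp
  have RS: "Rj (Suc j) = Rj j + r (Suc j) * N" for j unfolding Rj_def rS[of j] by (simp add: algebra_simps)
  have RR: "R \<le> Rj j" "Rj j \<le> R + N" for j
    unfolding Rj_def using N0 r1[of j] r0[of j] by (auto simp: algebra_simps mult_left_le)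
  have cq: "continuous_on UNIV (\<lambda>x. (q j (x + z))\<^sup>2)" and cq0: "continuous_on UNIV (\<lambda>x. (q j x)\<^sup>2)"
    and ct: "continuous_on UNIV (\<lambda>x. (t j x)\<^sup>2)" for j z
  proof -
    have "continuous_on UNIV (\<lambda>x. q j (x + z))"
      unfolding q_def by (rule continuous_on_compose2[OF continuous_on_differences(1)[OF P]]) (auto intro: continuous_intros)
    then show "continuous_on UNIV (\<lambda>x. (q j (x + z))\<^sup>2)" by (intro continuous_intros)
    show "continuous_on UNIV (\<lambda>x. (q j x)\<^sup>2)" unfolding q_def by (intro continuous_intros continuous_on_differences P)
    show "continuous_on UNIV (\<lambda>x. (t j x)\<^sup>2)" unfolding t_def by (intro continuous_intros continuous_on_differences P)
  qed
  have int: "integrable lborel (\<lambda>x. indicator (cball 0 S) x * f x)" if "continuous_on UNIV f"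
    for S and f :: "'a \<Rightarrow> real"
    using integrable_cball_mult[OF that] by simp
  have step: "E j + 16^j * D (Suc j) \<le> E (Suc j)" for j
  proof -
    define h' k' where "h' = r (Suc j) *\<^sub>R h" and "k' = r (Suc j) *\<^sub>R k"
    have zs: "norm (0::'a) \<le> r (Suc j) * N" "norm h' \<le> r (Suc j) * N" "norm k' \<le> r (Suc j) * N"
        "norm (h' + k') \<le> r (Suc j) * N"
    proof -
      have "norm h' = r (Suc j) * norm h" "norm k' = r (Suc j) * norm k"
        unfolding h'_def k'_def using r0[of "Suc j"] by auto
      moreover have "norm (h' + k') \<le> norm h' + norm k'" by (rule norm_triangle_ineq)
      moreover have "0 \<le> r (Suc j) * norm h" "0 \<le> r (Suc j) * norm k" using r0[of "Suc j"] by auto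
      moreover have "r (Suc j) * N = r (Suc j) * norm h + r (Suc j) * norm k"
        unfolding N_def by (simp add: algebra_simps)
      ultimately show "norm (0::'a) \<le> r (Suc j) * N" "norm h' \<le> r (Suc j) * N"
        "norm k' \<le> r (Suc j) * N" "norm (h' + k') \<le> r (Suc j) * N" by auto
    qed
    define I where "I z = (\<integral>x. indicator (cball 0 (Rj j)) x * (q (Suc j) (x + z))\<^sup>2 \<partial>lborel)" for z
    define J where "J = (\<integral>x. indicator (cball 0 (Rj (Suc j))) x * (q (Suc j) x)\<^sup>2 \<partial>lborel)"
    have IJ: "I z \<le> J" if "norm z \<le> r (Suc j) * N" for z
      unfolding I_def J_def RS by (rule integral_cball_translate_le[OF cq0 _ that]) simp
    have pt: "(q j x)\<^sup>2 + (t (Suc j) x)\<^sup>2 \<le> 4 * ((q (Suc j) (x + 0))\<^sup>2 + (q (Suc j) (x + h'))\<^sup>2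
        + (q (Suc j) (x + k'))\<^sup>2 + (q (Suc j) (x + (h' + k')))\<^sup>2)" for x
      using diff2_double_le[of P h' k' x] unfolding q_def t_def h'_def k'_def rS[of j] by simp
    have "(\<integral>x. indicator (cball 0 (Rj j)) x * (q j x)\<^sup>2 \<partial>lborel) + D (Suc j)
      \<le> (\<integral>x. indicator (cball 0 (Rj j)) x * (q j x)\<^sup>2 \<partial>lborel) + (\<integral>x. indicator (cball 0 (Rj j)) x * (t (Suc j) x)\<^sup>2 \<partial>lborel)"
      unfolding D_def
      by (intro add_left_mono integral_mono int ct) (use RR(1)[of j] in \<open>auto simp: indicator_def\<close>)
    also have "\<dots> = (\<integral>x. indicator (cball 0 (Rj j)) x * (q j x)\<^sup>2 + indicator (cball 0 (Rj j)) x * (t (Suc j) x)\<^sup>2 \<partial>lborel)"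
      by (intro Bochner_Integration.integral_add[symmetric] int ct cq0)
    also have "\<dots> \<le> (\<integral>x. 4 * (indicator (cball 0 (Rj j)) x * (q (Suc j) (x + 0))\<^sup>2 + indicator (cball 0 (Rj j)) x * (q (Suc j) (x + h'))\<^sup>2
        + indicator (cball 0 (Rj j)) x * (q (Suc j) (x + k'))\<^sup>2 + indicator (cball 0 (Rj j)) x * (q (Suc j) (x + (h' + k')))\<^sup>2) \<partial>lborel)"
      by (intro integral_mono Bochner_Integration.integrable_add integrable_mult_right int ct cq cq0)
        (use pt in \<open>auto simp: indicator_def\<close>)
    also have "\<dots> = 4 * (I 0 + I h' + I k' + I (h' + k'))"
      unfolding I_def
      by (simp only: integral_mult_right_zero Bochner_Integration.integral_add
          Bochner_Integration.integrable_add int cq)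
    also have "\<dots> \<le> 16 * J"
      using add_mono[OF add_mono[OF add_mono[OF IJ[OF zs(1)] IJ[OF zs(2)]] IJ[OF zs(3)]] IJ[OF zs(4)]] by simp
    finally have "16^j * ((\<integral>x. indicator (cball 0 (Rj j)) x * (q j x)\<^sup>2 \<partial>lborel) + D (Suc j)) \<le> 16^j * (16 * J)"
      by (intro mult_left_mono) auto
    then show ?thesis unfolding E_def J_def by (simp add: algebra_simps)
  qed
  have D0: "0 \<le> D j" for j unfolding D_def by (intro integral_nonneg_AE AE_I2) auto
  have incE: "incseq E"
  proof (rule incseq_SucI)
    show "E j \<le> E (Suc j)" for j using step[of j] D0[of "Suc j"] by (smt (verit) mult_nonneg_nonneg zero_le_power)
  qed
  define M where "M = C * (h \<bullet> h + k \<bullet> k) / 2"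
  have qb: "16^j * (q j x)\<^sup>2 \<le> M\<^sup>2" for j x
  proof -
    have "\<bar>q j x\<bar> \<le> C * ((r j *\<^sub>R h) \<bullet> (r j *\<^sub>R h) + (r j *\<^sub>R k) \<bullet> (r j *\<^sub>R k)) / 2"
      unfolding q_def by (rule diff2_bound[OF bd])
    also have "\<dots> = (r j)\<^sup>2 * M" unfolding M_def by (simp add: power2_eq_square algebra_simps)
    finally have "(q j x)\<^sup>2 \<le> ((r j)\<^sup>2 * M)\<^sup>2"
      by (metis abs_ge_zero power2_abs power_mono)
    then have "16^j * (q j x)\<^sup>2 \<le> 16^j * ((r j)\<^sup>2 * M)\<^sup>2" by simp
    also have "\<dots> = M\<^sup>2"
    proof -
      have "16^j * ((r j)\<^sup>2)\<^sup>2 = (1::real)"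
        unfolding r_def by (induction j) (auto simp: power2_eq_square)
      then show ?thesis by (metis mult.assoc mult.left_neutral power_mult_distrib)
    qed
    finally show ?thesis .
  qed
  have "E j \<le> (\<integral>x. indicator (cball (0::'a) (R + N)) x * M\<^sup>2 \<partial>lborel)" for j
  proof -
    have "E j = (\<integral>x. 16^j * (indicator (cball 0 (Rj j)) x * (q j x)\<^sup>2) \<partial>lborel)"
      unfolding E_def by simp
    also have "\<dots> \<le> (\<integral>x. indicator (cball (0::'a) (R + N)) x * M\<^sup>2 \<partial>lborel)"
    proof (intro integral_mono integrable_mult_right int cq0 continuous_on_const)
      fix x show "16^j * (indicator (cball 0 (Rj j)) x * (q j x)\<^sup>2) \<le> indicator (cball (0::'a) (R + N)) x * M\<^sup>2"
        using qb[of j x] RR(2)[of j] by (auto simp: indicator_def)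
    qed
    finally show ?thesis .
  qed
  with incE obtain L where L: "E \<longlonglongrightarrow> L"
    using incseq_convergent by blast
  \<comment> \<open>The gain in \<open>step\<close> is a difference of consecutive terms of a
    convergent sequence; the factor 16 adjusts 16^j to the finer scale.\<close>
  have "(\<lambda>j. 16 * (E (Suc j) - E j)) \<longlonglongrightarrow> 16 * (L - L)"
    by (intro tendsto_intros LIMSEQ_Suc L)
  then have lim: "(\<lambda>j. 16 * (E (Suc j) - E j)) \<longlonglongrightarrow> 0" by simp
  have "(\<lambda>j. 16^Suc j * D (Suc j)) \<longlonglongrightarrow> 0"
  proof (rule tendsto_sandwich[OF _ _ tendsto_const lim])
    show "\<forall>\<^sub>F j in sequentially. 0 \<le> 16^Suc j * D (Suc j)" using D0 by auto
    show "\<forall>\<^sub>F j in sequentially. 16^Suc j * D (Suc j) \<le> 16 * (E (Suc j) - E j)"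
    proof (rule always_eventually, rule)
      fix j show "16^Suc j * D (Suc j) \<le> 16 * (E (Suc j) - E j)" using step[of j] by simp
    qed
  qed
  then have "(\<lambda>j. 16^j * D j) \<longlonglongrightarrow> 0" by (rule LIMSEQ_imp_Suc)
  then show ?thesis unfolding D_def t_def r_def .
qed

section \<open>Blow-up limits are quadratic\<close>

text \<open>The deviation \<open>g\<close> from linearity along a line is additive and zero at
  integers, so its bound on [0,1] holds everywhere; since g(nt) = n g(t), a bounded additive
  function is zero.\<close>

lemma additive_continuous_scaleR:
  fixes f :: "'a::real_normed_vector \<Rightarrow> real"
  assumes add: "\<And>x y. f (x + y) = f x + f y" and cont: "continuous_on UNIV f"
  shows "f (t *\<^sub>R x) = t * f x"
proof -
  define g where "g t = f (t *\<^sub>R x) - t * f x" for t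
  have gadd: "g (s + t) = g s + g t" for s t
    unfolding g_def by (simp add: add scaleR_add_left algebra_simps)
  have gcont: "continuous_on {0..1} g"
    unfolding g_def
    by (intro continuous_intros continuous_on_compose2[OF cont]) auto
  have "bounded (g ` {0..1})"
    by (intro compact_imp_bounded compact_continuous_image gcont) simp
  then obtain M where M: "\<And>t. t \<in> {0..1} \<Longrightarrow> \<bar>g t\<bar> \<le> M"
    unfolding bounded_iff by (metis image_eqI real_norm_def)
  have g1: "g 1 = 0" "g 0 = 0" using gadd[of 0 0] unfolding g_def by auto
  have gn: "g (of_nat n * t) = of_nat n * g t" for n t
    by (induction n) (auto simp: g1 gadd distrib_right)
  have gneg: "g (- t) = - g t" for t using gadd[of t "-t"] g1 by simp
  have gint: "g (of_int n) = 0" for n :: int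
    using gn[of _ 1] gneg[of "of_nat _"] g1 by (cases n rule: int_cases2) auto
  have gb: "\<bar>g t\<bar> \<le> M" for t
    using M[of "frac t"] gadd[of "of_int \<lfloor>t\<rfloor>" "frac t"] gint[of "\<lfloor>t\<rfloor>"] frac_lt_1[of t]
    by (simp add: frac_def algebra_simps)
  have "g t = 0"
  proof (rule ccontr)
    assume "g t \<noteq> 0"
    then obtain n where "of_nat n * \<bar>g t\<bar> > M"
      using reals_Archimedean3[of "\<bar>g t\<bar>"] by auto
    then show False using gb[of "of_nat n * t"] unfolding gn by (simp add: abs_mult)
  qed
  then show ?thesis unfolding g_def by simp
qed

text \<open>\<open>diff3\<close> uses the step h twice. Polarisation, with l + h in place of the
  repeated step, recovers the third difference in three distinct directions; the third differences
  at other base points cancel the values off the vertices of the cube.\<close>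

lemma diff3_zero_imp_cube_zero:
  assumes "\<And>h k x. diff3 p h k x = 0"
  shows "p (l + h + k) - p (l + h) - p (l + k) - p (h + k) + p l + p h + p k - p 0 = 0"
proof -
  have "2 * (p (l + h + k) - p (l + h) - p (l + k) - p (h + k) + p l + p h + p k - p 0)
     = diff3 p (l + h) k 0 - diff3 p l k 0 - diff3 p h k 0
       - (diff3 p l k (h + h) - 2 * diff3 p l k h + diff3 p l k 0)
       - 2 * (diff3 p l k h - diff3 p l k 0) - 2 * (diff3 p h k l - diff3 p h k 0)"
    unfolding diff3_def diff2_def by (simp add: algebra_simps)
  then show ?thesis by (simp add: assms)
qed

text \<open>The cube identity makes the polarisation \<open>B\<close> additive in each argument, and
  continuity makes it bilinear. The remainder p(h) - B(h,h)/2 is additive, hence linear, and a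
  linear function of size O(|h|^2) vanishes.\<close>

lemma quadratic_form_of_cube_zero:
  fixes p :: "real^'n \<Rightarrow> real"
  assumes cont: "continuous_on UNIV p" and bd: "\<And>h. \<bar>p h\<bar> \<le> K * (h \<bullet> h)"
    and cube: "\<And>l h k. p (l + h + k) - p (l + h) - p (l + k) - p (h + k) + p l + p h + p k - p 0 = 0"
  shows "\<exists>X. symmetric_mat X \<and> (\<forall>h. p h = (1/2) * (h \<bullet> (X *v h)))"
proof -
  define B where "B h k = p (h + k) - p h - p k" for h k
  have p0: "p 0 = 0" using bd[of 0] by simp
  have Bsym: "B h k = B k h" for h k unfolding B_def by (simp add: add.commute)
  have Badd: "B (h + l) k = B h k + B l k" for h l k
    using cube[of h l k] p0 unfolding B_def by simp
  have cB: "continuous_on UNIV (\<lambda>h. B h k)" for k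
    unfolding B_def by (intro continuous_intros continuous_on_compose2[OF cont]) auto
  have Bs: "B (t *\<^sub>R h) k = t * B h k" for t h k
    by (rule additive_continuous_scaleR[OF Badd cB])
  have linB: "linear (\<lambda>h. B h k)" for k
    by (rule linearI) (auto simp: Badd Bs)
  define X :: "real^'n^'n" where "X = (\<chi> i j. B (axis i 1) (axis j 1))"
  have expand: "B h k = (\<Sum>i\<in>UNIV. h $ i * B (axis i 1) k)" for h k
  proof -
    have "B h k = B (\<Sum>i\<in>UNIV. (h $ i) *\<^sub>R axis i 1) k"
      using basis_expansion[of h] by (simp add: scalar_mult_eq_scaleR)
    also have "\<dots> = (\<Sum>i\<in>UNIV. h $ i * B (axis i 1) k)"
      using linear_sum[OF linB[of k], of "\<lambda>i. (h $ i) *\<^sub>R axis i 1" UNIV] by (simp add: Bs)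
    finally show ?thesis .
  qed
  have XB: "h \<bullet> (X *v k) = B h k" for h k
  proof -
    have c: "(X *v k) $ i = (\<Sum>j\<in>UNIV. k $ j * B (axis j 1) (axis i 1))" for i
      unfolding matrix_vector_mult_def X_def vec_lambda_beta
    proof (rule sum.cong[OF refl])
      show "B (axis i 1) (axis j 1) * k $ j = k $ j * B (axis j 1) (axis i 1)" for j
        using Bsym[of "axis i 1" "axis j 1"] by simp
    qed
    have "B h k = (\<Sum>i\<in>UNIV. h $ i * (\<Sum>j\<in>UNIV. k $ j * B (axis j 1) (axis i 1)))"
      by (subst expand, subst Bsym, subst expand, rule refl)
    also have "\<dots> = h \<bullet> (X *v k)"
      unfolding inner_vec_def c by simp
    finally show ?thesis by simp
  qed
  have "symmetric_mat X"
    unfolding symmetric_mat_def X_def transpose_def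
    by (simp add: vec_eq_iff) (use Bsym in blast)
  moreover have "p h = (1/2) * (h \<bullet> (X *v h))" for h
  proof -
    define q where "q h = p h - (1/2) * B h h" for h
    have qadd: "q (x + y) = q x + q y" for x y
    proof -
      have "B (x + y) (x + y) = B x x + 2 * B x y + B y y"
        using Badd[of x y "x + y"] Badd[of x y x] Badd[of x y y] Bsym[of x "x + y"] Bsym[of y "x + y"] Bsym[of y x]
        by linarith
      moreover have "p (x + y) = p x + p y + B x y" unfolding B_def by simp
      ultimately show ?thesis unfolding q_def by (simp add: field_simps)
    qed
    have cq: "continuous_on UNIV q"
      unfolding q_def B_def by (intro continuous_intros continuous_on_compose2[OF cont]) auto
    have qs: "q (t *\<^sub>R h) = t * q h" for t h
      by (rule additive_continuous_scaleR[OF qadd cq])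
    have qb: "\<bar>q h\<bar> \<le> (4 * K) * (h \<bullet> h)" for h
    proof -
      have "q h = 2 * p h - (1/2) * p (2 *\<^sub>R h)" unfolding q_def B_def by (simp add: scaleR_2 field_simps)
      moreover have "\<bar>p (2 *\<^sub>R h)\<bar> \<le> K * (4 * (h \<bullet> h))" using bd[of "2 *\<^sub>R h"] by simp
      ultimately show ?thesis using bd[of h] by (simp add: abs_le_iff)
    qed
    have "q h = 0"
    proof (rule ccontr)
      assume nz: "q h \<noteq> 0"
      define c where "c = (4 * K) * (h \<bullet> h)"
      have c: "c > 0" using qb[of h] nz unfolding c_def by simp
      define t where "t = \<bar>q h\<bar> / (2 * c)"
      have t: "t > 0" unfolding t_def using nz c by simp
      have "t * \<bar>q h\<bar> \<le> t * (t * c)"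
        using qb[of "t *\<^sub>R h"] t unfolding qs c_def by (simp add: abs_mult algebra_simps)
      then have "\<bar>q h\<bar> \<le> t * c" using t by simp
      then show False using nz c unfolding t_def by simp
    qed
    then show ?thesis unfolding q_def XB by simp
  qed
  ultimately show ?thesis by blast
qed

text \<open>Prolonging the segment from x through y by unit length gives a point \<open>z\<close> of
  the larger ball; convexity bounds the slope from x to y by the slope from x to
  \<open>z\<close>.\<close>

lemma convex_bounded_imp_Lipschitz:
  fixes f :: "'a::real_normed_vector \<Rightarrow> real"
  assumes conv: "convex_on UNIV f" and bd: "\<And>x. norm x \<le> R + 1 \<Longrightarrow> \<bar>f x\<bar> \<le> M"
    and x: "norm x \<le> R" and y: "norm y \<le> R"
  shows "\<bar>f x - f y\<bar> \<le> 2 * M * norm (x - y)"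
proof -
  have *: "f y - f x \<le> 2 * M * norm (y - x)" if x: "norm x \<le> R" and y: "norm y \<le> R" for x y
  proof (cases "x = y")
    case False
    define d where "d = norm (y - x)"
    have d: "d > 0" unfolding d_def using False by simp
    define z where "z = y + (1/d) *\<^sub>R (y - x)"
    have "norm z \<le> norm y + norm ((1/d) *\<^sub>R (y - x))" unfolding z_def by (rule norm_triangle_ineq)
    also have "norm ((1/d) *\<^sub>R (y - x)) = 1" using d unfolding d_def by simp
    finally have z: "norm z \<le> R + 1" using y by simp
    define t where "t = d / (1 + d)"
    have t: "0 \<le> t" "t \<le> 1" "t \<le> d" unfolding t_def using d by (auto simp: field_simps)
    have "t + t / d = (d + 1) / (1 + d)" unfolding t_def using d by (simp add: add_divide_distrib)
    also have "\<dots> = 1" using d by simp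
    finally have "t + t / d = 1" .
    then have td: "t / d = 1 - t" by linarith
    have "(1 - t) *\<^sub>R x + t *\<^sub>R z = (1 - t) *\<^sub>R x + t *\<^sub>R y + (t / d) *\<^sub>R (y - x)"
      unfolding z_def by (simp add: algebra_simps)
    also have "\<dots> = y" unfolding td by (simp add: algebra_simps)
    finally have "f y \<le> (1 - t) * f x + t * f z"
      using convex_onD[OF conv t(1,2), of x z] by simp
    then have "f y - f x \<le> t * (f z - f x)" by (simp add: algebra_simps)
    also have "\<dots> \<le> t * (2 * M)"
      using bd[OF z] bd[of x] x t(1) by (intro mult_left_mono) auto
    also have "\<dots> \<le> d * (2 * M)"
      using bd[OF z] t(3) by (intro mult_right_mono) auto
    finally show ?thesis unfolding d_def by (simp add: algebra_simps)
  qed simp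
  show ?thesis using *[OF x y] *[OF y x] by (simp add: norm_minus_commute abs_le_iff)
qed

text \<open>Semiconvexity and the quadratic bound make the functions locally equi-Lipschitz, so
  convergence on the dense set \<open>D\<close> extends to the whole space. Third differences of the
  limit vanish on \<open>D\<close>, by continuity everywhere, and the limit is a quadratic
  form.\<close>

lemma quadratic_blowup_limit:
  fixes p :: "nat \<Rightarrow> real^'n \<Rightarrow> real"
  assumes K: "0 \<le> K" and conv: "\<And>n. convex_on UNIV (\<lambda>h. p n h + K * (h \<bullet> h))"
    and bd: "\<And>n h. \<bar>p n h\<bar> \<le> K * (h \<bullet> h)"
    and D: "countable D" "closure D = UNIV"
    and lim: "\<And>h k z. \<lbrakk>h \<in> D; k \<in> D; z \<in> D\<rbrakk> \<Longrightarrow> (\<lambda>n. diff3 (p n) h k z) \<longlonglongrightarrow> 0"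
  obtains s X where "strict_mono (s::nat\<Rightarrow>nat)" "symmetric_mat X"
    "\<And>\<sigma>. 0 < \<sigma> \<Longrightarrow> \<forall>\<^sub>F n in sequentially. \<forall>h\<in>cball 0 1. \<bar>p (s n) h - (1/2) * (h \<bullet> (X *v h))\<bar> \<le> \<sigma>"
proof -
  define L where "L R = 4 * K * (R + 1)\<^sup>2 + 2 * K * R" for R
  have Lip: "\<bar>p n x - p n y\<bar> \<le> L R * norm (x - y)" if x: "norm x \<le> R" and y: "norm y \<le> R" for n R and x y :: "real^'n"
  proof -
    define f where "f h = p n h + K * (h \<bullet> h)" for h
    have fb: "\<bar>f h\<bar> \<le> 2 * K * (R + 1)\<^sup>2" if "norm h \<le> R + 1" for h
    proof -
      have "h \<bullet> h \<le> (R + 1)\<^sup>2" using that by (metis norm_ge_zero power2_norm_eq_inner power_mono)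
      then have "K * (h \<bullet> h) \<le> K * (R + 1)\<^sup>2" using K by (rule mult_left_mono)
      moreover have "0 \<le> K * (h \<bullet> h)" using K by simp
      ultimately show ?thesis using bd[of n h] unfolding f_def by auto
    qed
    have f: "\<bar>f x - f y\<bar> \<le> 2 * (2 * K * (R + 1)\<^sup>2) * norm (x - y)"
      by (rule convex_bounded_imp_Lipschitz[OF _ fb x y]) (use conv in \<open>simp_all add: f_def\<close>)
    have "\<bar>x \<bullet> x - y \<bullet> y\<bar> = \<bar>(x + y) \<bullet> (x - y)\<bar>" by (simp add: inner_simps inner_commute)
    also have "\<dots> \<le> norm (x + y) * norm (x - y)" by (rule Cauchy_Schwarz_ineq2)
    also have "\<dots> \<le> (2 * R) * norm (x - y)"
      using x y norm_triangle_ineq[of x y] by (intro mult_right_mono) auto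
    finally have "K * \<bar>x \<bullet> x - y \<bullet> y\<bar> \<le> K * ((2 * R) * norm (x - y))" using K by (rule mult_left_mono)
    then have "\<bar>K * (x \<bullet> x) - K * (y \<bullet> y)\<bar> \<le> 2 * K * R * norm (x - y)"
      using K by (simp add: abs_mult flip: right_diff_distrib)
    then show ?thesis using f unfolding f_def L_def by (simp add: distrib_right abs_le_iff)
  qed
  have L0: "0 \<le> L R" if "0 \<le> R" for R unfolding L_def using K that by simp
  \<comment> \<open>Dividing by 1 + K|x|^2 gives the bound uniform in x that the diagonal extraction
    asks for.\<close>
  obtain k1 where k1: "strict_mono (k1::nat\<Rightarrow>nat)"
    "\<And>x. x \<in> D \<Longrightarrow> \<exists>l. (\<lambda>n. p (k1 n) x / (1 + K * (x \<bullet> x))) \<longlonglongrightarrow> l"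
  proof (rule function_convergent_subsequence[OF D(1), of "\<lambda>n x. p n x / (1 + K * (x \<bullet> x))" 1])
    fix n and x :: "real^'n"
    have "0 \<le> K * (x \<bullet> x)" using K by simp
    then show "norm (p n x / (1 + K * (x \<bullet> x))) \<le> 1"
      using bd[of n x] by (simp add: field_simps)
  qed blast
  have convD: "convergent (\<lambda>n. p (k1 n) x)" if x: "x \<in> D" for x
  proof -
    have nz: "1 + K * (x \<bullet> x) \<noteq> 0" using K inner_ge_zero[of x]
      by (metis add_le_same_cancel2 mult_nonneg_nonneg not_one_le_zero add.commute)
    obtain l where "(\<lambda>n. p (k1 n) x / (1 + K * (x \<bullet> x))) \<longlonglongrightarrow> l" using k1(2)[OF x] by blast
    from tendsto_mult_right[OF this, of "1 + K * (x \<bullet> x)"] show ?thesis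
      using nz by (auto simp: convergent_def)
  qed
  have "convergent (\<lambda>n. p (k1 n) x)" for x
  proof (rule Cauchy_convergent, rule metric_CauchyI)
    fix e :: real assume e: "0 < e"
    define R where "R = norm x + 1"
    have R: "0 \<le> R" unfolding R_def by simp
    define d where "d = min 1 (e / (3 * (L R + 1)))"
    have d: "0 < d" unfolding d_def using e L0[OF R] by simp
    obtain y where y: "y \<in> D" "dist y x < d"
      using D(2) closure_approachable[of x D] d by auto
    have yR: "norm y \<le> R" using y(2) norm_triangle_ineq[of x "y - x"]
      unfolding R_def d_def by (simp add: dist_norm)
    have "L R * norm (x - y) \<le> L R * (e / (3 * (L R + 1)))"
      using y(2) L0[OF R] unfolding d_def by (intro mult_left_mono) (auto simp: dist_norm norm_minus_commute)
    also have "\<dots> < e / 3" using e L0[OF R] by (simp add: field_simps)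
    finally have ux: "\<bar>p n x - p n y\<bar> < e / 3" for n
      using Lip[of x R y n] yR unfolding R_def by simp
    obtain N where N: "\<And>m n. m \<ge> N \<Longrightarrow> n \<ge> N \<Longrightarrow> dist (p (k1 m) y) (p (k1 n) y) < e / 3"
      using convergent_Cauchy[OF convD[OF y(1)]] e unfolding Cauchy_def by (meson divide_pos_pos zero_less_numeral)
    show "\<exists>M. \<forall>m\<ge>M. \<forall>n\<ge>M. dist (p (k1 m) x) (p (k1 n) x) < e"
    proof (intro exI allI impI)
      fix m n assume "m \<ge> N" "n \<ge> N"
      then show "dist (p (k1 m) x) (p (k1 n) x) < e"
        using N[of m n, unfolded dist_real_def] ux[of "k1 m"] ux[of "k1 n"] unfolding dist_real_def by linarith
    qed
  qed
  then have "\<forall>x. \<exists>l. (\<lambda>n. p (k1 n) x) \<longlonglongrightarrow> l" unfolding convergent_def by blast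
  then obtain q where q: "\<And>x. (\<lambda>n. p (k1 n) x) \<longlonglongrightarrow> q x" by metis
  have qLip: "\<bar>q x - q y\<bar> \<le> L R * norm (x - y)" if "norm x \<le> R" "norm y \<le> R" for R and x y :: "real^'n"
    by (rule tendsto_upperbound[OF tendsto_rabs[OF tendsto_diff[OF q q]]])
      (use Lip[OF that] in auto)
  have qcont: "continuous_on UNIV q"
  proof -
    have "isCont q x" for x
    proof -
      define R where "R = norm x + 1"
      have R: "0 \<le> R" unfolding R_def by simp
      have "(L R)-lipschitz_on (cball x 1) q"
      proof (rule lipschitz_onI)
        fix a b assume "a \<in> cball x 1" "b \<in> cball x 1"
        then have "norm a \<le> R" "norm b \<le> R"
          using norm_triangle_ineq[of x "a - x"] norm_triangle_ineq[of x "b - x"]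
          unfolding R_def by (auto simp: dist_norm norm_minus_commute)
        then show "dist (q a) (q b) \<le> L R * dist a b" using qLip by (simp add: dist_norm)
      qed (rule L0[OF R])
      then have "continuous_on (cball x 1) q" by (rule lipschitz_on_continuous_on)
      then show ?thesis by (rule continuous_on_interior) auto
    qed
    then show ?thesis by (simp add: continuous_at_imp_continuous_on)
  qed
  have qb: "\<bar>q h\<bar> \<le> K * (h \<bullet> h)" for h
    by (rule tendsto_upperbound[OF tendsto_rabs[OF q]]) (use bd in auto)
  have q3D: "diff3 q h k z = 0" if "h \<in> D" "k \<in> D" "z \<in> D" for h k z
  proof -
    have "(\<lambda>n. diff3 (p (k1 n)) h k z) \<longlonglongrightarrow> diff3 q h k z"
      unfolding diff3_def diff2_def by (intro tendsto_intros q)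
    moreover have "(\<lambda>n. diff3 (p (k1 n)) h k z) \<longlonglongrightarrow> 0"
      using LIMSEQ_subseq_LIMSEQ[OF lim[OF that] k1(1)] by (simp add: o_def)
    ultimately show ?thesis using LIMSEQ_unique by blast
  qed
  have q3: "diff3 q h k z = 0" for h k z
  proof -
    define G where "G w = diff3 q (fst w) (fst (snd w)) (snd (snd w))" for w
    have "continuous_on (closure (D \<times> D \<times> D)) G"
      unfolding G_def diff3_def diff2_def
      by (intro continuous_intros continuous_on_compose2[OF qcont]) auto
    moreover have "G w = 0" if "w \<in> D \<times> D \<times> D" for w using that q3D unfolding G_def by auto
    moreover have "(h, k, z) \<in> closure (D \<times> D \<times> D)"
      unfolding closure_Times D(2) by (intro SigmaI UNIV_I)
    ultimately have "G (h, k, z) = 0"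
      using continuous_constant_on_closure by blast
    then show ?thesis unfolding G_def by simp
  qed
  obtain X where X: "symmetric_mat X" "\<And>h. q h = (1/2) * (h \<bullet> (X *v h))"
    using quadratic_form_of_cube_zero[OF qcont qb diff3_zero_imp_cube_zero[OF q3]] by blast
  \<comment> \<open>The second extraction only upgrades convergence to uniform convergence on the
    unit ball, where its limit is again \<open>q\<close>.\<close>
  obtain g k2 where g: "strict_mono (k2::nat\<Rightarrow>nat)"
    "\<And>e. 0 < e \<Longrightarrow> \<exists>N. \<forall>n x. n \<ge> N \<and> x \<in> cball 0 1 \<longrightarrow> norm (p (k1 (k2 n)) x - g x) < e"
  proof (rule Arzela_Ascoli[of "cball (0::real^'n) 1" "\<lambda>n. p (k1 n)" K])
    show "norm (p (k1 n) x) \<le> K" if "x \<in> cball 0 1" for n x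
    proof -
      have "x \<bullet> x \<le> 1" using that by (simp add: norm_le_square)
      then have "K * (x \<bullet> x) \<le> K * 1" using K by (rule mult_left_mono)
      then show ?thesis using bd[of "k1 n" x] by simp
    qed
    show "\<exists>d>0. \<forall>n y. y \<in> cball 0 1 \<and> norm (x - y) < d \<longrightarrow> norm (p (k1 n) x - p (k1 n) y) < e"
      if x: "x \<in> cball 0 1" and e: "0 < e" for x e
    proof (intro exI[of _ "e / (L 1 + 1)"] conjI allI impI)
      show "0 < e / (L 1 + 1)" using e L0[of 1] by simp
      fix n y assume y: "y \<in> cball 0 1 \<and> norm (x - y) < e / (L 1 + 1)"
      have "norm (p (k1 n) x - p (k1 n) y) \<le> L 1 * norm (x - y)" using Lip[of x 1 y] x y by simp
      also have "\<dots> \<le> L 1 * (e / (L 1 + 1))" using y L0[of 1] by (intro mult_left_mono) auto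
      also have "\<dots> < e" using e L0[of 1] by (simp add: field_simps)
      finally show "norm (p (k1 n) x - p (k1 n) y) < e" .
    qed
  qed (auto intro: that)
  have gq: "g x = q x" if x: "x \<in> cball 0 1" for x
  proof (rule LIMSEQ_unique)
    show "(\<lambda>n. p (k1 (k2 n)) x) \<longlonglongrightarrow> g x"
      unfolding lim_sequentially dist_norm using g(2) x by meson
    show "(\<lambda>n. p (k1 (k2 n)) x) \<longlonglongrightarrow> q x"
      using LIMSEQ_subseq_LIMSEQ[OF q g(1)] by (simp add: o_def)
  qed
  show ?thesis
  proof (rule that[of "k1 \<circ> k2" X])
    show "strict_mono (k1 \<circ> k2)" using k1(1) g(1) by (rule strict_mono_o)
    show "\<forall>\<^sub>F n in sequentially. \<forall>h\<in>cball 0 1. \<bar>p ((k1 \<circ> k2) n) h - (1/2) * (h \<bullet> (X *v h))\<bar> \<le> \<sigma>"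
      if "0 < \<sigma>" for \<sigma>
      using g(2)[OF that] gq X(2) unfolding eventually_sequentially
      by (metis (no_types, lifting) comp_apply less_imp_le real_norm_def)
  qed (rule X(1))
qed

section \<open>Semiconvexity and third differences under rescaling\<close>

lemma convex_on_scaled_inner:
  fixes c :: real
  assumes "0 \<le> c"
  shows "convex_on UNIV (\<lambda>x::'a::real_inner. c * (x \<bullet> x))"
proof (rule convex_onI)
  fix t :: real and x y :: 'a
  assume t: "0 < t" "t < 1"
  define z where "z = (1 - t) *\<^sub>R x + t *\<^sub>R y"
  have "(1 - t) * (x \<bullet> x) + t * (y \<bullet> y) - z \<bullet> z = t * (1 - t) * ((x - y) \<bullet> (x - y))"
    unfolding z_def by (simp add: inner_simps inner_commute algebra_simps)
  moreover have "0 \<le> t * (1 - t) * ((x - y) \<bullet> (x - y))" using t by simp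
  ultimately have "z \<bullet> z \<le> (1 - t) * (x \<bullet> x) + t * (y \<bullet> y)" by linarith
  then have "c * (z \<bullet> z) \<le> c * ((1 - t) * (x \<bullet> x) + t * (y \<bullet> y))" using assms by (rule mult_left_mono)
  then show "c * (((1 - t) *\<^sub>R x + t *\<^sub>R y) \<bullet> ((1 - t) *\<^sub>R x + t *\<^sub>R y)) \<le> (1 - t) * (c * (x \<bullet> x)) + t * (c * (y \<bullet> y))"
    unfolding z_def by (simp add: algebra_simps)
qed simp

text \<open>K|x+rh|^2 / r^2 equals K|h|^2 up to a function affine in h, so a blow-up at quadratic
  rate keeps the constant \<open>K\<close>.\<close>

lemma semiconvex_rescale:
  fixes P :: "'a::real_inner \<Rightarrow> real"
  assumes conv: "convex_on UNIV (\<lambda>x. P x + K * (x \<bullet> x))" and r: "0 < r"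
  shows "convex_on UNIV (\<lambda>h. (P (x + r *\<^sub>R h) - P x - r * (b \<bullet> h)) / r\<^sup>2 + K * (h \<bullet> h))"
proof (rule convex_onI)
  fix t :: real and h k :: 'a
  assume t: "0 < t" "t < 1"
  define z where "z = (1 - t) *\<^sub>R h + t *\<^sub>R k"
  define f where "f y = P y + K * (y \<bullet> y)" for y
  define a where "a h = (P x + K * (x \<bullet> x) + r * ((b + (2 * K) *\<^sub>R x) \<bullet> h)) / r\<^sup>2" for h
  have eq: "(P (x + r *\<^sub>R h) - P x - r * (b \<bullet> h)) / r\<^sup>2 + K * (h \<bullet> h) = f (x + r *\<^sub>R h) / r\<^sup>2 - a h" for h
    unfolding f_def a_def using r
    by (simp add: inner_simps inner_commute field_simps power2_eq_square)
  have "x + r *\<^sub>R z = (1 - t) *\<^sub>R (x + r *\<^sub>R h) + t *\<^sub>R (x + r *\<^sub>R k)"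
    unfolding z_def by (simp add: algebra_simps)
  then have "f (x + r *\<^sub>R z) \<le> (1 - t) * f (x + r *\<^sub>R h) + t * f (x + r *\<^sub>R k)"
    using convex_onD[OF conv, of t "x + r *\<^sub>R h" "x + r *\<^sub>R k"] t unfolding f_def by simp
  then have "f (x + r *\<^sub>R z) / r\<^sup>2 \<le> ((1 - t) * f (x + r *\<^sub>R h) + t * f (x + r *\<^sub>R k)) / r\<^sup>2"
    using r by (intro divide_right_mono) auto
  also have "\<dots> = (1 - t) * (f (x + r *\<^sub>R h) / r\<^sup>2) + t * (f (x + r *\<^sub>R k) / r\<^sup>2)"
    by (simp add: add_divide_distrib)
  finally have "f (x + r *\<^sub>R z) / r\<^sup>2 \<le> (1 - t) * (f (x + r *\<^sub>R h) / r\<^sup>2) + t * (f (x + r *\<^sub>R k) / r\<^sup>2)" .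
  moreover have "a z = (1 - t) * a h + t * a k"
  proof -
    have "P x + K * (x \<bullet> x) + r * (w \<bullet> z) = (1 - t) * (P x + K * (x \<bullet> x) + r * (w \<bullet> h)) + t * (P x + K * (x \<bullet> x) + r * (w \<bullet> k))" for w
      unfolding z_def by (simp add: inner_simps algebra_simps)
    moreover have "u / s = (1 - t) * (v / s) + t * (w / s)" if "u = (1 - t) * v + t * w" for u v w s :: real
      using that by (simp add: add_divide_distrib)
    ultimately show ?thesis unfolding a_def by blast
  qed
  ultimately show "(P (x + r *\<^sub>R ((1 - t) *\<^sub>R h + t *\<^sub>R k)) - P x - r * (b \<bullet> ((1 - t) *\<^sub>R h + t *\<^sub>R k))) / r\<^sup>2 + K * (((1 - t) *\<^sub>R h + t *\<^sub>R k) \<bullet> ((1 - t) *\<^sub>R h + t *\<^sub>R k))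
    \<le> (1 - t) * ((P (x + r *\<^sub>R h) - P x - r * (b \<bullet> h)) / r\<^sup>2 + K * (h \<bullet> h)) + t * ((P (x + r *\<^sub>R k) - P x - r * (b \<bullet> k)) / r\<^sup>2 + K * (k \<bullet> k))"
    unfolding eq z_def[symmetric] right_diff_distrib by linarith
qed simp

lemma diff3_rescale:
  fixes P :: "'a::real_inner \<Rightarrow> real"
  shows "diff3 (\<lambda>h. (P (x + r *\<^sub>R h) - P x - r * (b \<bullet> h)) / s) h k z
    = diff3 P (r *\<^sub>R h) (r *\<^sub>R k) (x + r *\<^sub>R z) / s"
proof -
  have "diff3 (\<lambda>h. f h / s) h k z = diff3 f h k z / s" for f :: "'a \<Rightarrow> real"
    unfolding diff3_def diff2_def by (simp add: diff_divide_distrib add_divide_distrib)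
  moreover have "diff3 (\<lambda>h. P (x + r *\<^sub>R h) - P x - r * (b \<bullet> h)) h k z = diff3 P (r *\<^sub>R h) (r *\<^sub>R k) (x + r *\<^sub>R z)"
    unfolding diff3_def diff2_def by (simp add: inner_simps algebra_simps)
  ultimately show ?thesis by simp
qed

section \<open>Points of small third differences in sets of positive measure\<close>

lemma measure_pos_of_compact_nonnegligible:
  fixes A :: "'a::euclidean_space set"
  assumes "compact A" "\<not> negligible A"
  shows "0 < measure lborel A"
proof -
  have "A \<in> lmeasurable" using assms(1) by (rule lmeasurable_compact)
  then have "measure lebesgue A \<noteq> 0" using assms(2) negligible_iff_measure0 by blast
  moreover have "measure lebesgue A = measure lborel A"
    using assms(1) by (simp add: measure_completion borel_compact)
  ultimately show ?thesis by (metis measure_nonneg order_less_le)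
qed

text \<open>The normalised squares of the third differences, summed over the finite family, tend to
  zero in mean over \<open>A\<close>, so at some point of \<open>A\<close> the sum is at most the
  square of \<open>\<epsilon>\<close>. Point and scale depend on the family and on
  \<open>\<epsilon>\<close>; no point good at all scales is claimed.\<close>

lemma exists_small_diff3_point:
  fixes P :: "'i \<Rightarrow> 'a::euclidean_space \<Rightarrow> real"
  assumes A: "compact A" "\<not> negligible A"
    and P: "\<And>c. continuous_on UNIV (P c)"
    and bd: "\<And>c x h. \<bar>P c (x + h) + P c (x - h) - 2 * P c x\<bar> \<le> C * (h \<bullet> h)"
    and F: "finite F" and eps: "0 < \<epsilon>"
  shows "\<exists>x\<in>A. \<exists>r>0. r < \<epsilon> \<and> (\<forall>(c, h, k, z)\<in>F. \<bar>diff3 (P c) (r *\<^sub>R h) (r *\<^sub>R k) (x + r *\<^sub>R z)\<bar> \<le> \<epsilon> * r\<^sup>2)"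
proof -
  define r where "r m = (1/2::real)^m" for m :: nat
  define T where "T m w x = (diff3 (P (fst w)) (r m *\<^sub>R fst (snd w)) (r m *\<^sub>R fst (snd (snd w))) (x + r m *\<^sub>R snd (snd (snd w))))\<^sup>2" for m w x
  define I where "I m w = (\<integral>x. indicator A x * T m w x \<partial>lborel)" for m w
  define \<mu> where "\<mu> = measure lborel A"
  have mu: "0 < \<mu>" unfolding \<mu>_def using measure_pos_of_compact_nonnegligible[OF A] .
  obtain R where R: "A \<subseteq> cball 0 R"
    using compact_imp_bounded[OF A(1)] unfolding bounded_iff by (auto simp: subset_iff)
  have r0: "0 < r m" "r m \<le> 1" for m unfolding r_def by (auto simp: power_le_one)
  have cT: "continuous_on UNIV (T m w)" for m w
    unfolding T_def
    by (intro continuous_intros continuous_on_compose2[OF continuous_on_differences(2)[OF P]]) auto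
  have int: "integrable lborel (\<lambda>x. indicator A x * f x)" if "continuous_on UNIV f" for f :: "'a \<Rightarrow> real"
    by (rule integrable_cball_mult[OF that A(1)])
  have lim: "(\<lambda>m. 16^m * I m w) \<longlonglongrightarrow> 0" for w
  proof -
    obtain c h k z where w: "w = (c, h, k, z)" by (metis prod.exhaust)
    have "I m w \<le> (\<integral>x. indicator (cball 0 (R + norm z)) x * (diff3 (P c) (r m *\<^sub>R h) (r m *\<^sub>R k) x)\<^sup>2 \<partial>lborel)" for m
    proof -
      have "I m w \<le> (\<integral>x. indicator (cball 0 R) x * T m w x \<partial>lborel)"
        unfolding I_def
        by (intro integral_mono int cT integrable_cball_mult) (use R in \<open>auto simp: indicator_def T_def\<close>)
      also have "\<dots> \<le> (\<integral>x. indicator (cball 0 (R + norm z)) x * (diff3 (P c) (r m *\<^sub>R h) (r m *\<^sub>R k) x)\<^sup>2 \<partial>lborel)"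
        unfolding T_def w fst_conv snd_conv
        by (rule integral_cball_translate_le)
          (use r0[of m] in \<open>auto intro!: continuous_intros continuous_on_differences P simp: mult_left_le_one_le\<close>)
      finally show ?thesis .
    qed
    then have le: "16^m * I m w \<le> 16^m * (\<integral>x. indicator (cball 0 (R + norm z)) x * (diff3 (P c) (r m *\<^sub>R h) (r m *\<^sub>R k) x)\<^sup>2 \<partial>lborel)" for m
      by (intro mult_left_mono) auto
    have ge: "0 \<le> 16^m * I m w" for m
      unfolding I_def T_def by (intro mult_nonneg_nonneg integral_nonneg_AE AE_I2) auto
    show ?thesis
      by (rule tendsto_sandwich[OF _ _ tendsto_const
          diff3_energy_tendsto_0[OF P[of c] bd[of c], of "R + norm z" h k, folded r_def]])
        (use le ge in auto)
  qed
  have "(\<lambda>m. \<Sum>w\<in>F. 16^m * I m w) \<longlonglongrightarrow> (\<Sum>w\<in>F. 0)"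
    by (intro tendsto_sum lim)
  then have "\<forall>\<^sub>F m in sequentially. (\<Sum>w\<in>F. 16^m * I m w) < \<epsilon>\<^sup>2 * \<mu>"
    using eps mu by (auto intro!: order_tendstoD(2))
  moreover have "\<forall>\<^sub>F m in sequentially. r m < \<epsilon>"
    unfolding r_def using eps by (intro order_tendstoD(2)[OF LIMSEQ_power_zero]) auto
  ultimately have "\<forall>\<^sub>F m in sequentially. (\<Sum>w\<in>F. 16^m * I m w) < \<epsilon>\<^sup>2 * \<mu> \<and> r m < \<epsilon>"
    by (rule eventually_conj)
  then obtain m where m: "(\<Sum>w\<in>F. 16^m * I m w) < \<epsilon>\<^sup>2 * \<mu>" "r m < \<epsilon>"
    unfolding eventually_sequentially by blast
  have "\<exists>x\<in>A. (\<Sum>w\<in>F. 16^m * T m w x) \<le> \<epsilon>\<^sup>2"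
  proof (rule ccontr)
    assume "\<not> ?thesis"
    then have big: "\<epsilon>\<^sup>2 < (\<Sum>w\<in>F. 16^m * T m w x)" if "x \<in> A" for x using that by force
    have "\<epsilon>\<^sup>2 * \<mu> = (\<integral>x. indicator A x * \<epsilon>\<^sup>2 \<partial>lborel)"
      unfolding \<mu>_def using borel_compact[OF A(1)] by simp
    also have "\<dots> \<le> (\<integral>x. indicator A x * (\<Sum>w\<in>F. 16^m * T m w x) \<partial>lborel)"
    proof (intro integral_mono int continuous_on_const continuous_on_sum continuous_on_mult_left cT)
      fix x show "indicator A x * \<epsilon>\<^sup>2 \<le> indicator A x * (\<Sum>w\<in>F. 16^m * T m w x)"
        using big[of x] by (auto simp: indicator_def)
    qed
    also have "\<dots> = (\<integral>x. (\<Sum>w\<in>F. 16^m * (indicator A x * T m w x)) \<partial>lborel)"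
      by (simp add: sum_distrib_left algebra_simps)
    also have "\<dots> = (\<Sum>w\<in>F. 16^m * I m w)"
      unfolding I_def by (subst Bochner_Integration.integral_sum) (auto intro!: integrable_mult_right int cT)
    finally show False using m(1) by simp
  qed
  then obtain x where x: "x \<in> A" "(\<Sum>w\<in>F. 16^m * T m w x) \<le> \<epsilon>\<^sup>2" by blast
  have "\<bar>diff3 (P c) (r m *\<^sub>R h) (r m *\<^sub>R k) (x + r m *\<^sub>R z)\<bar> \<le> \<epsilon> * (r m)\<^sup>2" if w: "(c, h, k, z) \<in> F" for c h k z
  proof -
    have "16^m * T m (c, h, k, z) x \<le> (\<Sum>w\<in>F. 16^m * T m w x)"
      by (rule member_le_sum[OF w _ F]) (auto simp: T_def)
    then have *: "16^m * T m (c, h, k, z) x \<le> \<epsilon>\<^sup>2" using x(2) by linarith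
    have r4: "16^m * ((r m)\<^sup>2)\<^sup>2 = 1"
      unfolding r_def by (induction m) (auto simp: power2_eq_square)
    have "T m (c, h, k, z) x = (16^m * T m (c, h, k, z) x) * ((r m)\<^sup>2)\<^sup>2"
    proof -
      have "(16^m * T m (c, h, k, z) x) * ((r m)\<^sup>2)\<^sup>2 = (16^m * ((r m)\<^sup>2)\<^sup>2) * T m (c, h, k, z) x"
        by (simp only: mult_ac)
      then show ?thesis unfolding r4 by simp
    qed
    also have "\<dots> \<le> \<epsilon>\<^sup>2 * ((r m)\<^sup>2)\<^sup>2" using * by (intro mult_right_mono) auto
    also have "\<dots> = (\<epsilon> * (r m)\<^sup>2)\<^sup>2" by (simp add: power_mult_distrib)
    finally have "T m (c, h, k, z) x \<le> (\<epsilon> * (r m)\<^sup>2)\<^sup>2" .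
    then have "\<bar>diff3 (P c) (r m *\<^sub>R h) (r m *\<^sub>R k) (x + r m *\<^sub>R z)\<bar> \<le> \<bar>\<epsilon> * (r m)\<^sup>2\<bar>"
      unfolding T_def abs_le_square_iff by simp
    also have "\<dots> = \<epsilon> * (r m)\<^sup>2" using eps by simp
    finally show ?thesis .
  qed
  then show ?thesis using x(1) m(2) r0(1)[of m] by blast
qed

text \<open>The base points move: the j-th one serves an initial segment of an enumeration of all
  triples from a dense set, for both functions. As the bounds are uniform over \<open>A\<close>,
  blow-ups at moving points still converge to quadratic forms, and a far index gives the claim.
  Indexing by \<open>bool\<close> forces one point and one scale for both functions.\<close>

lemma exists_near_quadratic_point:
  fixes P :: "bool \<Rightarrow> real^'n \<Rightarrow> real" and b :: "bool \<Rightarrow> real^'n \<Rightarrow> real^'n"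
  assumes A: "compact A" "\<not> negligible A" and K: "0 \<le> K"
    and conv: "\<And>c. convex_on UNIV (\<lambda>x. P c x + K * (x \<bullet> x))"
    and bd: "\<And>c x h. \<bar>P c (x + h) + P c (x - h) - 2 * P c x\<bar> \<le> K * (h \<bullet> h)"
    and C11: "\<And>c x h. x \<in> A \<Longrightarrow> \<bar>P c (x + h) - P c x - b c x \<bullet> h\<bar> \<le> K * (h \<bullet> h)"
    and pos: "0 < \<sigma>" "0 < \<rho>"
  shows "\<exists>x\<in>A. \<exists>r X. 0 < r \<and> r < \<rho> \<and> (\<forall>c. symmetric_mat (X c) \<and>
      (\<forall>h. norm h \<le> r \<longrightarrow> \<bar>P c (x + h) - P c x - b c x \<bullet> h - (1/2) * (h \<bullet> (X c *v h))\<bar> \<le> \<sigma> * r\<^sup>2))"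
proof -
  have cP: "continuous_on UNIV (P c)" for c
  proof -
    have "continuous_on UNIV (\<lambda>x. (P c x + K * (x \<bullet> x)) - K * (x \<bullet> x))"
      by (intro continuous_intros convex_on_continuous conv) auto
    then show ?thesis by simp
  qed
  obtain D :: "(real^'n) set" where D: "countable D" "D \<subseteq> UNIV" "UNIV \<subseteq> closure D"
    using separable[of "UNIV :: (real^'n) set"] by blast
  have Dc: "closure D = UNIV" using D(3) by auto
  then have Dne: "D \<noteq> {}" by auto
  define J where "J = (UNIV::bool set) \<times> D \<times> D \<times> D"
  have J: "countable J" "J \<noteq> {}" unfolding J_def using D(1) Dne by auto
  define w where "w = from_nat_into J"
  have w: "range w = J" unfolding w_def using J by (simp add: range_from_nat_into)
  have "\<exists>x\<in>A. \<exists>r>0. r < inverse (real (Suc j)) \<and> (\<forall>(c, h, k, z)\<in>w ` {..j}.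
       \<bar>diff3 (P c) (r *\<^sub>R h) (r *\<^sub>R k) (x + r *\<^sub>R z)\<bar> \<le> inverse (real (Suc j)) * r\<^sup>2)" for j
    by (rule exists_small_diff3_point[OF A cP bd]) auto
  then obtain x r where x: "\<And>j. x j \<in> A" and r: "\<And>j. 0 < r j" "\<And>j. r j < inverse (real (Suc j))"
    and small: "\<And>j. \<forall>(c, h, k, z)\<in>w ` {..j}.
       \<bar>diff3 (P c) (r j *\<^sub>R h) (r j *\<^sub>R k) (x j + r j *\<^sub>R z)\<bar> \<le> inverse (real (Suc j)) * (r j)\<^sup>2"
    by metis
  define p where "p c j h = (P c (x j + r j *\<^sub>R h) - P c (x j) - r j * (b c (x j) \<bullet> h)) / (r j)\<^sup>2" for c j h
  have pconv: "convex_on UNIV (\<lambda>h. p c j h + K * (h \<bullet> h))" for c j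
    unfolding p_def by (rule semiconvex_rescale[OF conv r(1)])
  have pb: "\<bar>p c j h\<bar> \<le> K * (h \<bullet> h)" for c j h
  proof -
    have "\<bar>P c (x j + r j *\<^sub>R h) - P c (x j) - r j * (b c (x j) \<bullet> h)\<bar> \<le> K * (h \<bullet> h) * (r j)\<^sup>2"
      using C11[OF x, of c j "r j *\<^sub>R h"] by (simp add: power2_eq_square algebra_simps)
    then show ?thesis unfolding p_def using r(1)[of j] by (simp add: pos_divide_le_eq)
  qed
  have rlim: "(\<lambda>j. inverse (real (Suc j))) \<longlonglongrightarrow> 0" by (rule LIMSEQ_inverse_real_of_nat)
  have plim: "(\<lambda>j. diff3 (p c j) h k z) \<longlonglongrightarrow> 0" if "h \<in> D" "k \<in> D" "z \<in> D" for c h k z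
  proof -
    have "(c, h, k, z) \<in> range w" unfolding w J_def using that by simp
    then obtain i where i: "w i = (c, h, k, z)" by force
    have "\<bar>diff3 (p c j) h k z\<bar> \<le> inverse (real (Suc j))" if "i \<le> j" for j
    proof -
      have "(c, h, k, z) \<in> w ` {..j}" using i that by (metis atMost_iff imageI)
      with small[of j] have "\<bar>diff3 (P c) (r j *\<^sub>R h) (r j *\<^sub>R k) (x j + r j *\<^sub>R z)\<bar> \<le> inverse (real (Suc j)) * (r j)\<^sup>2"
        by blast
      then show ?thesis unfolding p_def diff3_rescale using r(1)[of j] by (simp add: pos_divide_le_eq)
    qed
    then have "\<forall>\<^sub>F j in sequentially. norm (diff3 (p c j) h k z) \<le> inverse (real (Suc j))"
      unfolding eventually_sequentially by auto
    then show ?thesis by (rule Lim_null_comparison[OF _ rlim])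
  qed
  \<comment> \<open>The second subsequence is extracted along the first, so both functions become
    nearly quadratic at common indices.\<close>
  obtain s1 X1 where s1: "strict_mono (s1::nat\<Rightarrow>nat)" and X1: "symmetric_mat X1"
    "\<And>\<sigma>. 0 < \<sigma> \<Longrightarrow> \<forall>\<^sub>F n in sequentially. \<forall>h\<in>cball 0 1. \<bar>p True (s1 n) h - (1/2) * (h \<bullet> (X1 *v h))\<bar> \<le> \<sigma>"
    using quadratic_blowup_limit[where p="p True", OF K pconv pb D(1) Dc plim] by blast
  have plim': "(\<lambda>j. diff3 (p False (s1 j)) h k z) \<longlonglongrightarrow> 0" if "h \<in> D" "k \<in> D" "z \<in> D" for h k z
    using LIMSEQ_subseq_LIMSEQ[OF plim[OF that] s1] by (simp add: o_def)
  obtain s2 X2 where s2: "strict_mono (s2::nat\<Rightarrow>nat)" and X2: "symmetric_mat X2"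
    "\<And>\<sigma>. 0 < \<sigma> \<Longrightarrow> \<forall>\<^sub>F n in sequentially. \<forall>h\<in>cball 0 1. \<bar>p False (s1 (s2 n)) h - (1/2) * (h \<bullet> (X2 *v h))\<bar> \<le> \<sigma>"
    using quadratic_blowup_limit[where p="\<lambda>n. p False (s1 n)", OF K pconv pb D(1) Dc plim'] by blast
  have e1: "\<forall>\<^sub>F n in sequentially. \<forall>h\<in>cball 0 1. \<bar>p True (s1 (s2 n)) h - (1/2) * (h \<bullet> (X1 *v h))\<bar> \<le> \<sigma>"
    using eventually_subseq[OF s2 X1(2)[OF pos(1)]] .
  have "\<forall>\<^sub>F j in sequentially. inverse (real (Suc j)) < \<rho>" using order_tendstoD(2)[OF rlim pos(2)] .
  then have e3: "\<forall>\<^sub>F n in sequentially. inverse (real (Suc (s1 (s2 n)))) < \<rho>"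
    using eventually_subseq[OF strict_mono_o[OF s1 s2]] by fastforce
  obtain n where n: "\<forall>h\<in>cball 0 1. \<bar>p True (s1 (s2 n)) h - (1/2) * (h \<bullet> (X1 *v h))\<bar> \<le> \<sigma>"
      "\<forall>h\<in>cball 0 1. \<bar>p False (s1 (s2 n)) h - (1/2) * (h \<bullet> (X2 *v h))\<bar> \<le> \<sigma>"
      "inverse (real (Suc (s1 (s2 n)))) < \<rho>"
    using eventually_happens'[OF sequentially_bot eventually_conj[OF e1 eventually_conj[OF X2(2)[OF pos(1)] e3]]] by auto
  define m where "m = s1 (s2 n)"
  define X where "X c = (if c then X1 else X2)" for c
  have pX: "\<bar>p c m h - (1/2) * (h \<bullet> (X c *v h))\<bar> \<le> \<sigma>" if "norm h \<le> 1" for c h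
    using n(1,2) that unfolding m_def X_def by auto
  have "\<bar>P c (x m + h) - P c (x m) - b c (x m) \<bullet> h - (1/2) * (h \<bullet> (X c *v h))\<bar> \<le> \<sigma> * (r m)\<^sup>2"
    if h: "norm h \<le> r m" for c h
  proof -
    define k where "k = (1 / r m) *\<^sub>R h"
    have hk: "h = r m *\<^sub>R k" unfolding k_def using r(1)[of m] by simp
    have "norm k \<le> 1" unfolding k_def using h r(1)[of m] by (simp add: field_simps)
    have rr: "r m \<noteq> 0" using r(1)[of m] by simp
    have "P c (x m + h) - P c (x m) - b c (x m) \<bullet> h - (1/2) * (h \<bullet> (X c *v h))
        = (r m)\<^sup>2 * (p c m k - (1/2) * (k \<bullet> (X c *v k)))"
      unfolding p_def hk using rr
      by (simp add: matrix_vector_mult_scaleR power2_eq_square field_simps)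
    then have "\<bar>P c (x m + h) - P c (x m) - b c (x m) \<bullet> h - (1/2) * (h \<bullet> (X c *v h))\<bar>
        = (r m)\<^sup>2 * \<bar>p c m k - (1/2) * (k \<bullet> (X c *v k))\<bar>"
      by (simp add: abs_mult)
    also have "\<dots> \<le> (r m)\<^sup>2 * \<sigma>" using pX[OF \<open>norm k \<le> 1\<close>] by (intro mult_left_mono) auto
    finally show ?thesis by (simp add: mult.commute)
  qed
  moreover have "symmetric_mat (X c)" for c unfolding X_def using X1(1) X2(1) by simp
  moreover have "r m < \<rho>" using r(2)[of m] n(3) unfolding m_def by linarith
  ultimately show ?thesis using x[of m] r(1)[of m] by blast
qed

section \<open>Interior comparison\<close>

subsection \<open>Sup-convolution\<close>

text \<open>The supremum runs over a fixed set but \<open>z\<close> is unrestricted, so that for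
  compact \<open>S\<close> semiconvexity holds on the whole space, as convex envelopes and global
  contact planes require.\<close>

definition supconv :: "'a::real_inner set \<Rightarrow> real \<Rightarrow> ('a \<Rightarrow> real) \<Rightarrow> 'a \<Rightarrow> real" where
  "supconv S k u z = (SUP y\<in>S. u y - k * ((y - z) \<bullet> (y - z)))"

lemma supconv_attained:
  fixes S :: "'a::euclidean_space set"
  assumes "compact S" "S \<noteq> {}" "continuous_on S u"
  obtains y where "y \<in> S" "supconv S k u z = u y - k * ((y - z) \<bullet> (y - z))"
    "\<And>x. x \<in> S \<Longrightarrow> u x - k * ((x - z) \<bullet> (x - z)) \<le> supconv S k u z"
proof -
  have "continuous_on S (\<lambda>y. u y - k * ((y - z) \<bullet> (y - z)))"
    by (intro continuous_intros assms)
  then obtain y where y: "y \<in> S" "\<And>x. x \<in> S \<Longrightarrow> u x - k * ((x - z) \<bullet> (x - z)) \<le> u y - k * ((y - z) \<bullet> (y - z))"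
    using continuous_attains_sup[OF assms(1,2)] by blast
  have "supconv S k u z = u y - k * ((y - z) \<bullet> (y - z))"
    unfolding supconv_def by (rule cSup_eq_maximum) (use y in auto)
  then show ?thesis using that[of y] y by simp
qed

lemma supconv_ge:
  fixes S :: "'a::euclidean_space set"
  assumes "compact S" "continuous_on S u" "x \<in> S"
  shows "u x - k * ((x - z) \<bullet> (x - z)) \<le> supconv S k u z"
  using supconv_attained[OF assms(1) _ assms(2)] assms(3) by (metis empty_iff)

text \<open>After adding k|z|^2 each competitor contributes a function affine in z, and a supremum
  of affine functions is convex.\<close>

lemma supconv_semiconvex:
  fixes S :: "'a::euclidean_space set"
  assumes S: "compact S" "S \<noteq> {}" "continuous_on S u"
  shows "convex_on UNIV (\<lambda>z. supconv S k u z + k * (z \<bullet> z))"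
proof (rule convex_onI)
  fix t :: real and x z :: 'a
  assume t: "0 < t" "t < 1"
  define w where "w = (1 - t) *\<^sub>R x + t *\<^sub>R z"
  obtain y where y: "y \<in> S" "supconv S k u w = u y - k * ((y - w) \<bullet> (y - w))"
    using supconv_attained[OF S] by metis
  have eq: "u y - k * ((y - w) \<bullet> (y - w)) + k * (w \<bullet> w) = u y - k * (y \<bullet> y) + 2 * k * (y \<bullet> w)" for w
    by (simp add: inner_simps inner_commute algebra_simps)
  have le: "u y - k * (y \<bullet> y) + 2 * k * (y \<bullet> w) \<le> supconv S k u w + k * (w \<bullet> w)" for w
    using supconv_ge[OF S(1,3) y(1), of k w] eq[of w] by linarith
  have "supconv S k u w + k * (w \<bullet> w) = u y - k * (y \<bullet> y) + 2 * k * (y \<bullet> w)"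
    unfolding y(2) eq ..
  also have "\<dots> = (1 - t) * (u y - k * (y \<bullet> y) + 2 * k * (y \<bullet> x)) + t * (u y - k * (y \<bullet> y) + 2 * k * (y \<bullet> z))"
    unfolding w_def by (simp add: inner_simps algebra_simps)
  also have "\<dots> \<le> (1 - t) * (supconv S k u x + k * (x \<bullet> x)) + t * (supconv S k u z + k * (z \<bullet> z))"
    using t by (intro add_mono mult_left_mono le) auto
  finally show "supconv S k u ((1 - t) *\<^sub>R x + t *\<^sub>R z) + k * (((1 - t) *\<^sub>R x + t *\<^sub>R z) \<bullet> ((1 - t) *\<^sub>R x + t *\<^sub>R z))
     \<le> (1 - t) * (supconv S k u x + k * (x \<bullet> x)) + t * (supconv S k u z + k * (z \<bullet> z))"
    unfolding w_def .
qed simp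

lemma supconv_continuous:
  fixes S :: "'a::euclidean_space set"
  assumes "compact S" "S \<noteq> {}" "continuous_on S u"
  shows "continuous_on UNIV (supconv S k u)"
proof -
  have "continuous_on UNIV (\<lambda>z. (supconv S k u z + k * (z \<bullet> z)) - k * (z \<bullet> z))"
    by (intro continuous_intros convex_on_continuous supconv_semiconvex assms) auto
  then show ?thesis by simp
qed

text \<open>Keeping the maximiser for z as competitor at z + h yields a paraboloid touching the
  sup-convolution from below at every point.\<close>

lemma supconv_translate_ge:
  fixes S :: "'a::euclidean_space set"
  assumes "compact S" "continuous_on S u" "y \<in> S" "supconv S k u z = u y - k * ((y - z) \<bullet> (y - z))"
  shows "supconv S k u z + (2 * k) *\<^sub>R (y - z) \<bullet> h - k * (h \<bullet> h) \<le> supconv S k u (z + h)"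
proof -
  have "(y - (z + h)) \<bullet> (y - (z + h)) = (y - z) \<bullet> (y - z) - 2 * ((y - z) \<bullet> h) + h \<bullet> h"
    by (simp add: inner_simps inner_commute)
  then have "k * ((y - (z + h)) \<bullet> (y - (z + h))) = k * ((y - z) \<bullet> (y - z)) - (2 * k) * ((y - z) \<bullet> h) + k * (h \<bullet> h)"
    by (simp only: right_diff_distrib distrib_left mult.assoc mult.left_commute)
  then show ?thesis
    using supconv_ge[OF assms(1-3), of k "z + h"] assms(4) by simp
qed

lemma semiconvex_second_diff:
  fixes f :: "'a::real_inner \<Rightarrow> real"
  assumes "convex_on UNIV (\<lambda>x. f x + k * (x \<bullet> x))"
  shows "- (2 * k) * (h \<bullet> h) \<le> f (x + h) + f (x - h) - 2 * f x"
proof -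
  have "(1 - 1/2) *\<^sub>R (x + h) + (1/2) *\<^sub>R (x - h) = (1/2 + 1/2) *\<^sub>R x"
    unfolding scaleR_add_left by (simp add: algebra_simps)
  then have "f x + k * (x \<bullet> x) \<le> (1 - 1/2) * (f (x + h) + k * ((x + h) \<bullet> (x + h))) + 1/2 * (f (x - h) + k * ((x - h) \<bullet> (x - h)))"
    using convex_onD[OF assms, of "1/2" "x + h" "x - h"] by simp
  then show ?thesis by (simp add: inner_simps inner_commute algebra_simps)
qed

subsection \<open>The largest convex minorant\<close>

text \<open>The family consists of convex rather than affine minorants, so that averages of
  translates of the envelope may compete directly. The lemmas below carry a convex minorant
  \<open>g\<close>, because the supremum over an empty family would be an arbitrary value.\<close>

definition cenv :: "('a::real_vector \<Rightarrow> real) \<Rightarrow> 'a \<Rightarrow> real" where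
  "cenv f z = (SUP g\<in>{g. convex_on UNIV g \<and> (\<forall>y. g y \<le> f y)}. g z)"

lemma cenv_ge:
  assumes "convex_on UNIV g" "\<And>y. g y \<le> f y"
  shows "g z \<le> cenv f z"
  unfolding cenv_def by (rule cSUP_upper) (use assms in \<open>auto intro!: bdd_aboveI2[where M="f z"]\<close>)

lemma cenv_le:
  assumes "convex_on UNIV g" "\<And>y. g y \<le> f y"
  shows "cenv f z \<le> f z"
  unfolding cenv_def by (rule cSUP_least) (use assms in auto)

lemma cenv_convex:
  assumes "convex_on UNIV g" "\<And>y. g y \<le> f y"
  shows "convex_on UNIV (cenv f)"
proof (rule convex_onI)
  fix t :: real and x y :: 'a
  assume t: "0 < t" "t < 1"
  show "cenv f ((1 - t) *\<^sub>R x + t *\<^sub>R y) \<le> (1 - t) * cenv f x + t * cenv f y"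
    unfolding cenv_def[of f "(1 - t) *\<^sub>R x + t *\<^sub>R y"]
  proof (rule cSUP_least)
    show "{g. convex_on UNIV g \<and> (\<forall>y. g y \<le> f y)} \<noteq> {}" using assms by auto
    fix l assume "l \<in> {g. convex_on UNIV g \<and> (\<forall>y. g y \<le> f y)}"
    then have l: "convex_on UNIV l" "\<And>y. l y \<le> f y" by auto
    have "l ((1 - t) *\<^sub>R x + t *\<^sub>R y) \<le> (1 - t) * l x + t * l y"
      using convex_onD[OF l(1), of t x y] t by simp
    also have "\<dots> \<le> (1 - t) * cenv f x + t * cenv f y"
      using t cenv_ge[OF l] by (intro add_mono mult_left_mono) auto
    finally show "l ((1 - t) *\<^sub>R x + t *\<^sub>R y) \<le> (1 - t) * cenv f x + t * cenv f y" .
  qed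
qed simp

text \<open>The average of the two translates of the envelope by h and -h, lowered by C|h|^2/2, is
  itself a convex minorant of f, hence lies below the envelope.\<close>

lemma cenv_second_diff:
  fixes f :: "'a::real_inner \<Rightarrow> real"
  assumes g: "convex_on UNIV g" "\<And>y. g y \<le> f y"
    and f: "\<And>x h. f (x + h) + f (x - h) - 2 * f x \<le> C * (h \<bullet> h)"
  shows "cenv f (x + h) + cenv f (x - h) - 2 * cenv f x \<le> C * (h \<bullet> h)"
proof -
  define l where "l z = (cenv f (z + h) + cenv f (z - h) - C * (h \<bullet> h)) / 2" for z
  have "convex_on UNIV l"
  proof (rule convex_onI)
    fix t :: real and x y :: 'a
    assume t: "0 < t" "t < 1"
    define z where "z = (1 - t) *\<^sub>R x + t *\<^sub>R y"
    have e: "z + h = (1 - t) *\<^sub>R (x + h) + t *\<^sub>R (y + h)" "z - h = (1 - t) *\<^sub>R (x - h) + t *\<^sub>R (y - h)"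
      unfolding z_def by (simp_all add: algebra_simps)
    have "cenv f (z + h) \<le> (1 - t) * cenv f (x + h) + t * cenv f (y + h)"
         "cenv f (z - h) \<le> (1 - t) * cenv f (x - h) + t * cenv f (y - h)"
      unfolding e using t by (auto intro!: convex_onD[OF cenv_convex[OF g]])
    then show "l ((1 - t) *\<^sub>R x + t *\<^sub>R y) \<le> (1 - t) * l x + t * l y"
      unfolding l_def z_def[symmetric] by (simp add: field_simps)
  qed simp
  moreover have "l y \<le> f y" for y
    using cenv_le[OF g, of "y + h"] cenv_le[OF g, of "y - h"] f[of y h] unfolding l_def by simp
  ultimately have "l x \<le> cenv f x" by (rule cenv_ge)
  then show ?thesis unfolding l_def by simp
qed

subsection \<open>Second-order superjets\<close>

text \<open>The inequality holds exactly near x, without an o(|h|^2) term, so the paraboloid itself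
  is a test function. The slope \<open>b\<close> is left existential because the equations involve
  the Hessian only.\<close>

definition superjet :: "(real^'n \<Rightarrow> real) \<Rightarrow> real^'n \<Rightarrow> real^'n^'n \<Rightarrow> bool" where
  "superjet U x X \<longleftrightarrow> symmetric_mat X \<and>
     (\<exists>\<delta>>0. \<exists>b. \<forall>h. norm h < \<delta> \<longrightarrow> U (x + h) \<le> U x + b \<bullet> h + (1/2) * (h \<bullet> (X *v h)))"

lemma symmetric_mat_iff: "symmetric_mat X \<longleftrightarrow> (\<forall>i j. X $ i $ j = X $ j $ i)"
  unfolding symmetric_mat_def transpose_def by (auto simp: vec_eq_iff)

lemma symmetric_mat_simps:
  "symmetric_mat X \<Longrightarrow> symmetric_mat Y \<Longrightarrow> symmetric_mat (X + Y)"
  "symmetric_mat X \<Longrightarrow> symmetric_mat (c *\<^sub>R X)"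
  "symmetric_mat X \<Longrightarrow> symmetric_mat (- X)"
  "symmetric_mat X \<Longrightarrow> symmetric_mat Y \<Longrightarrow> symmetric_mat (X - Y)"
  unfolding symmetric_mat_iff vector_add_component vector_scaleR_component
    vector_uminus_component vector_minus_component
  by presburger+

lemma symmetric_mat_mat: "symmetric_mat (mat c)"
  unfolding symmetric_mat_iff mat_def by auto

lemma mat_scaled_vector: "(c *\<^sub>R (mat 1 :: real^'n^'n)) *v h = c *\<^sub>R h"
  by (simp flip: scaleR_matrix_vector_assoc)

lemma symmetric_mat_inner:
  "symmetric_mat X \<Longrightarrow> x \<bullet> (X *v y) = (X *v x) \<bullet> y"
  unfolding symmetric_mat_def by (metis dot_lmul_matrix transpose_matrix_vector)

text \<open>Adding \<open>4 * \<sigma>\<close> times |h|^2 to the approximating quadratic forces w -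
  q to attain its maximum over the ball at some \<open>h0\<close> with |h0| at most r/2. The lifted
  paraboloid touches there, with Hessian raised by \<open>8 * \<sigma>\<close>.\<close>

lemma superjet_of_approx:
  fixes w :: "real^'n \<Rightarrow> real"
  assumes w: "continuous_on UNIV w" and X: "symmetric_mat X" and r: "0 < r" and s: "0 < \<sigma>"
    and ap: "\<And>h. norm h \<le> r \<Longrightarrow> w (x + h) \<le> w x + b \<bullet> h + (1/2) * (h \<bullet> (X *v h)) + \<sigma> * r\<^sup>2"
  shows "\<exists>z. norm (z - x) < r \<and> superjet w z (X + (8 * \<sigma>) *\<^sub>R mat 1)"
proof -
  define Y where "Y = X + (8 * \<sigma>) *\<^sub>R mat 1"
  define q where "q h = b \<bullet> h + (1/2) * (h \<bullet> (Y *v h))" for h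
  have Y: "symmetric_mat Y" unfolding Y_def using X by (intro symmetric_mat_simps symmetric_mat_mat)
  have hY: "h \<bullet> (Y *v h) = h \<bullet> (X *v h) + 8 * \<sigma> * (h \<bullet> h)" for h
    unfolding Y_def matrix_vector_mult_add_rdistrib mat_scaled_vector inner_add_right inner_scaleR_right ..
  have c: "continuous_on (cball 0 r) (\<lambda>h. w (x + h) - q h)"
    unfolding q_def
    by (intro continuous_intros continuous_on_compose2[OF w] linear_continuous_on_compose
        matrix_vector_mul_linear) (auto intro: continuous_intros)
  obtain h0 where h0: "h0 \<in> cball 0 r" "\<And>h. h \<in> cball 0 r \<Longrightarrow> w (x + h) - q h \<le> w (x + h0) - q h0"
    using continuous_attains_sup[OF compact_cball _ c] r by auto
  have "w x \<le> w (x + h0) - q h0" using h0(2)[of 0] r unfolding q_def by simp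
  moreover have "w (x + h0) \<le> w x + b \<bullet> h0 + (1/2) * (h0 \<bullet> (X *v h0)) + \<sigma> * r\<^sup>2"
    using ap h0(1) by simp
  ultimately have "4 * \<sigma> * (h0 \<bullet> h0) \<le> \<sigma> * r\<^sup>2" unfolding q_def hY by argo
  then have "\<sigma> * (4 * (h0 \<bullet> h0)) \<le> \<sigma> * r\<^sup>2" by argo
  then have "4 * (h0 \<bullet> h0) \<le> r\<^sup>2" using s by simp
  then have "(2 * norm h0)\<^sup>2 \<le> r\<^sup>2" by (simp add: power_mult_distrib power2_norm_eq_inner)
  then have "2 * norm h0 \<le> r" by (rule power2_le_imp_le) (rule less_imp_le[OF r])
  then have nh0: "norm h0 < r" using r by (smt (verit) norm_ge_zero)
  have "w (x + h0 + h) \<le> w (x + h0) + (b + Y *v h0) \<bullet> h + (1/2) * (h \<bullet> (Y *v h))" if "norm h < r - norm h0" for h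
  proof -
    have "norm (h0 + h) \<le> r" using that norm_triangle_ineq[of h0 h] by linarith
    then have "w (x + (h0 + h)) - q (h0 + h) \<le> w (x + h0) - q h0" using h0(2) by simp
    moreover have "q (h0 + h) = q h0 + (b + Y *v h0) \<bullet> h + (1/2) * (h \<bullet> (Y *v h))"
      unfolding q_def using symmetric_mat_inner[OF Y, of h0 h]
      by (simp add: inner_simps matrix_vector_right_distrib inner_commute algebra_simps)
    ultimately show ?thesis by (simp add: add.assoc)
  qed
  then have "superjet w (x + h0) Y"
    unfolding superjet_def using Y nh0 by (intro conjI exI[of _ "r - norm h0"] exI[of _ "b + Y *v h0"]) auto
  then show ?thesis using nh0 unfolding Y_def by (intro exI[of _ "x + h0"]) simp
qed

text \<open>A paraboloid above the sup-convolution at z, translated so that its contact point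
  becomes the maximiser y, lies above U with the same Hessian. The relation between
  \<open>B\<close>, \<open>k\<close> and \<open>d\<close> gives |y - z| at most d, which keeps y
  interior.\<close>

lemma superjet_supconv:
  fixes U :: "real^'n \<Rightarrow> real"
  assumes U: "continuous_on (cball 0 R) U" and B: "\<And>x. x \<in> cball 0 R \<Longrightarrow> \<bar>U x\<bar> \<le> B"
    and k: "0 < k" and d: "2 * B \<le> k * d\<^sup>2" "0 \<le> d" and z: "norm z + d < R"
    and j: "superjet (supconv (cball 0 R) k U) z X"
  shows "\<exists>y. norm y < R \<and> superjet U y X"
proof -
  have R: "cball (0::real^'n) R \<noteq> {}" using z d(2) norm_ge_zero[of z] by (auto simp del: norm_ge_zero)
  define w where "w = supconv (cball 0 R) k U"
  obtain y where y: "y \<in> cball 0 R" "w z = U y - k * ((y - z) \<bullet> (y - z))"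
    unfolding w_def using supconv_attained[OF compact_cball R U] by metis
  have zR: "z \<in> cball 0 R" using z d(2) by simp
  have "U z \<le> w z" unfolding w_def using supconv_ge[OF compact_cball U zR, of k z] by simp
  then have "k * ((y - z) \<bullet> (y - z)) \<le> k * d\<^sup>2" using y(2) B[OF zR] B[OF y(1)] d(1) by linarith
  then have "norm (y - z) \<le> d" using k d(2) by (simp add: power2_norm_eq_inner[symmetric])
  then have yR: "norm y < R" using z norm_triangle_ineq[of z "y - z"] by simp
  obtain \<delta> b where X: "symmetric_mat X" and \<delta>: "\<delta> > 0" "\<And>h. norm h < \<delta> \<Longrightarrow> w (z + h) \<le> w z + b \<bullet> h + (1/2) * (h \<bullet> (X *v h))"
    using j unfolding superjet_def w_def by blast
  have "U (y + h) \<le> U y + b \<bullet> h + (1/2) * (h \<bullet> (X *v h))" if h: "norm h < min \<delta> (R - norm y)" for h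
  proof -
    have "y + h \<in> cball 0 R" using h norm_triangle_ineq[of y h] by simp
    from supconv_ge[OF compact_cball U this, of k "z + h"]
    have "U (y + h) - k * ((y - z) \<bullet> (y - z)) \<le> w (z + h)" unfolding w_def by simp
    then show ?thesis using \<delta>(2)[of h] h y(2) by simp
  qed
  then have "superjet U y X"
    unfolding superjet_def using X \<delta>(1) yR by (intro conjI exI[of _ "min \<delta> (R - norm y)"] exI[of _ b]) auto
  then show ?thesis using yR by blast
qed

subsection \<open>Jensen's lemma\<close>

text \<open>For a semiconvex \<open>w\<close>, the points touched from above by planes of slope at most \<open>p0\<close> carry a
  Lipschitz slope map whose image contains a ball, so they cannot form a null set.\<close>

lemma contact_set_not_negligible:
  fixes w :: "real^'n \<Rightarrow> real"
  assumes C: "0 < C" and semi: "\<And>x h. - C * (h \<bullet> h) \<le> w (x + h) + w (x - h) - 2 * w x"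
    and p0: "0 < p0" and ex: "\<And>p. norm p \<le> p0 \<Longrightarrow> \<exists>z. \<forall>y. w y \<le> w z + p \<bullet> (y - z)"
  shows "\<not> negligible {z. \<exists>p. norm p \<le> p0 \<and> (\<forall>y. w y \<le> w z + p \<bullet> (y - z))}" (is "\<not> negligible ?A")
proof
  assume neg: "negligible ?A"
  define s where "s z = (SOME p. norm p \<le> p0 \<and> (\<forall>y. w y \<le> w z + p \<bullet> (y - z)))" for z
  have s: "w y \<le> w z + s z \<bullet> (y - z)" if "z \<in> ?A" for z y
    using someI_ex[of "\<lambda>p. norm p \<le> p0 \<and> (\<forall>y. w y \<le> w z + p \<bullet> (y - z))"] that
    unfolding s_def by auto
  have lip: "norm (p' - p) \<le> 2 * C * norm (x' - x)"
    if p: "\<And>y. w y \<le> w x + p \<bullet> (y - x)" and p': "\<And>y. w y \<le> w x' + p' \<bullet> (y - x')" for x x' p p'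
  proof -
    have lower: "w x + p \<bullet> h - C * (h \<bullet> h) \<le> w (x + h)" if "\<And>y. w y \<le> w x + p \<bullet> (y - x)" for x p h
      using semi[of h x] that[of "x - h"] by simp
    \<comment> \<open>\<open>h\<close> = v/(2C) maximises \<open>v \<bullet> h\<close> - C|h|^2, so
      that the inequality below becomes |v|^2/(4C) \<le> C|d|^2.\<close>
    define d v h where "d = x' - x" and "v = p' - p" and "h = (1 / (2 * C)) *\<^sub>R v"
    have "w x' + p' \<bullet> h - C * (h \<bullet> h) \<le> w x + p \<bullet> (d + h)"
      using lower[OF p', of h] p[of "x' + h"] unfolding d_def by (simp add: algebra_simps)
    moreover have "w x + p \<bullet> d - C * (d \<bullet> d) \<le> w x'"
      using lower[OF p, of d] unfolding d_def by simp
    ultimately have "v \<bullet> h \<le> C * (h \<bullet> h) + C * (d \<bullet> d)"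
      unfolding v_def by (simp add: inner_simps)
    moreover have "v \<bullet> h = 2 * (C * (h \<bullet> h))"
      unfolding h_def using C by (simp add: field_simps)
    moreover have "4 * C * (C * (h \<bullet> h)) = (norm v)\<^sup>2"
      unfolding h_def power2_norm_eq_inner using C by (simp add: field_simps)
    ultimately have "C * (h \<bullet> h) \<le> C * (d \<bullet> d)" by linarith
    then have "4 * C * (C * (h \<bullet> h)) \<le> 4 * C * (C * (d \<bullet> d))" using C by (intro mult_left_mono) auto
    then have "(norm v)\<^sup>2 \<le> (2 * C * norm d)\<^sup>2"
      using \<open>4 * C * (C * (h \<bullet> h)) = (norm v)\<^sup>2\<close>
      unfolding power_mult_distrib power2_norm_eq_inner by (simp add: power2_eq_square)
    then show ?thesis unfolding d_def v_def using C by (intro power2_le_imp_le[of "norm (p' - p)"]) auto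
  qed
  have "negligible (s ` ?A)"
  proof (rule negligible_locally_Lipschitz_image[OF _ neg])
    show "\<exists>T B. open T \<and> x \<in> T \<and> (\<forall>y\<in>?A \<inter> T. norm (s y - s x) \<le> B * norm (y - x))" if "x \<in> ?A" for x
      using lip[OF s[OF that] s] by (intro exI[of _ UNIV] exI[of _ "2 * C"]) auto
  qed simp
  \<comment> \<open>The estimate with x' = x shows that contact slopes at a point are unique, so the
    chosen slope there is the given \<open>p\<close>.\<close>
  moreover have "ball 0 p0 \<subseteq> s ` ?A"
  proof
    fix p :: "real^'n" assume "p \<in> ball 0 p0"
    then have p: "norm p \<le> p0" by simp
    then obtain z where z: "\<And>y. w y \<le> w z + p \<bullet> (y - z)" using ex by blast
    then have zA: "z \<in> ?A" using p by auto
    have "norm (s z - p) \<le> 2 * C * norm (z - z)" by (rule lip[OF z s[OF zA]])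
    then have "s z = p" by simp
    then show "p \<in> s ` ?A" using zA by blast
  qed
  ultimately have "negligible (ball (0::real^'n) p0)" by (rule negligible_subset)
  then show False using p0 open_not_negligible[of "ball (0::real^'n) p0"] by simp
qed

text \<open>The set is the projection of a compact set of pairs (point, slope); without the slope as
  a coordinate the conditions are not visibly closed.\<close>

lemma contact_set_compact:
  fixes w :: "'a::euclidean_space \<Rightarrow> real"
  assumes w: "continuous_on UNIV w"
    and sub: "{z. \<exists>p. norm p \<le> p0 \<and> (\<forall>y. w y \<le> w z + p \<bullet> (y - z))} \<subseteq> cball 0 R"
  shows "compact {z. \<exists>p. norm p \<le> p0 \<and> (\<forall>y. w y \<le> w z + p \<bullet> (y - z))}" (is "compact ?A")
proof -
  define Z where "Z = (cball 0 R \<times> cball 0 p0) \<inter> (\<Inter>y. {zp. w y \<le> w (fst zp) + snd zp \<bullet> (y - fst zp)})"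
  have "closed {zp. w y \<le> w (fst zp) + snd zp \<bullet> (y - fst zp)}" for y :: 'a
    by (intro closed_Collect_le continuous_intros continuous_on_compose2[OF w]) auto
  then have "compact Z" unfolding Z_def by (intro compact_Int_closed compact_Times compact_cball closed_INT) auto
  then have "compact (fst ` Z)" by (intro compact_continuous_image continuous_intros)
  moreover have "fst ` Z = ?A"
  proof
    show "fst ` Z \<subseteq> ?A" unfolding Z_def by auto
    show "?A \<subseteq> fst ` Z"
    proof
      fix z assume z: "z \<in> ?A"
      then obtain p where p: "norm p \<le> p0" "\<And>y. w y \<le> w z + p \<bullet> (y - z)" by blast
      have "z \<in> cball 0 R" using sub z by blast
      then have "(z, p) \<in> Z" unfolding Z_def using p by auto
      then show "z \<in> fst ` Z" by force
    qed
  qed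
  ultimately show ?thesis by simp
qed

subsection \<open>No strict contact in the interior\<close>

text \<open>Between the semiconvex \<open>w1\<close> and the semiconcave \<open>\<Gamma> - w2\<close>, where \<open>\<Gamma>\<close> is the concave envelope
  of \<open>w1 + w2\<close>, one inserts the largest function \<open>P\<close> that is still semiconvex. Both \<open>P\<close> and \<open>\<Gamma>\<close> have
  second differences of order \<open>|h|\<^sup>2\<close>, and \<open>P = w1\<close>, \<open>\<Gamma> - P = w2\<close> on the contact set.\<close>

lemma semiconvex_sum_jets:
  fixes w1 w2 :: "real^'n \<Rightarrow> real"
  assumes k: "0 < k"
    and w1: "convex_on UNIV (\<lambda>z. w1 z + k * (z \<bullet> z))" and w2: "convex_on UNIV (\<lambda>z. w2 z + k * (z \<bullet> z))"
    and sub1: "\<And>x. \<exists>b. \<forall>h. w1 x + b \<bullet> h - k * (h \<bullet> h) \<le> w1 (x + h)"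
    and M: "\<And>z. w1 z + w2 z \<le> M"
    and p0: "0 < p0" and ex: "\<And>p. norm p \<le> p0 \<Longrightarrow> \<exists>z. \<forall>y. w1 y + w2 y \<le> w1 z + w2 z + p \<bullet> (y - z)"
    and loc: "\<And>p z. norm p \<le> p0 \<Longrightarrow> \<forall>y. w1 y + w2 y \<le> w1 z + w2 z + p \<bullet> (y - z) \<Longrightarrow> norm z \<le> \<rho>"
    and pos: "0 < \<sigma>" "0 < \<rho>"
  shows "\<exists>z1 z2 X Y. norm z1 < 2 * \<rho> \<and> norm z2 < 2 * \<rho> \<and> superjet w1 z1 (X + (8 * \<sigma>) *\<^sub>R mat 1) \<and>
     superjet w2 z2 ((16 * \<sigma>) *\<^sub>R mat 1 - (X + Y)) \<and> psd_mat (Y + (2 * \<sigma>) *\<^sub>R mat 1) \<and> symmetric_mat X"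
proof -
  define w where "w z = w1 z + w2 z" for z
  define A where "A = {z. \<exists>p. norm p \<le> p0 \<and> (\<forall>y. w y \<le> w z + p \<bullet> (y - z))}"
  have cont: "continuous_on UNIV f" if "convex_on UNIV (\<lambda>z. f z + k * (z \<bullet> z))" for f :: "real^'n \<Rightarrow> real"
  proof -
    have "continuous_on UNIV (\<lambda>z. (f z + k * (z \<bullet> z)) - k * (z \<bullet> z))"
      by (intro continuous_intros convex_on_continuous that) auto
    then show ?thesis by simp
  qed
  have cw: "continuous_on UNIV w" unfolding w_def by (intro continuous_intros cont w1 w2)
  have wd: "- (4 * k) * (h \<bullet> h) \<le> w (x + h) + w (x - h) - 2 * w x" for x h
    using semiconvex_second_diff[OF w1, of h x] semiconvex_second_diff[OF w2, of h x] unfolding w_def by simp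
  have wd': "- w (x + h) + - w (x - h) - 2 * - w x \<le> 4 * k * (h \<bullet> h)" for x h
    using wd[of h x] by simp
  have A: "compact A" "\<not> negligible A"
  proof -
    have "A \<subseteq> cball 0 \<rho>" unfolding A_def w_def using loc by auto
    then show "compact A" unfolding A_def by (rule contact_set_compact[OF cw])
    show "\<not> negligible A"
      unfolding A_def by (rule contact_set_not_negligible[OF _ wd p0]) (use k ex in \<open>auto simp: w_def\<close>)
  qed
  define G where "G = cenv (\<lambda>z. - w z)"
  have cM: "convex_on UNIV (\<lambda>z::real^'n. - M)" by (simp add: convex_on_const)
  have leM: "- M \<le> - w z" for z using M[of z] unfolding w_def by simp
  have Gw: "G z \<le> - w z" for z unfolding G_def by (rule cenv_le[OF cM leM])
  have Gconv: "convex_on UNIV G" unfolding G_def by (rule cenv_convex[OF cM leM])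
  have Gup: "G (x + h) + G (x - h) - 2 * G x \<le> 4 * k * (h \<bullet> h)" for x h
    unfolding G_def by (rule cenv_second_diff[OF cM leM]) (rule wd')
  have Glow: "0 \<le> G (x + h) + G (x - h) - 2 * G x" for x h
    using semiconvex_second_diff[of G 0 h x] Gconv by simp
  \<comment> \<open>Adding k|z|^2 to both obstacles makes the lower one convex, so an envelope
    exists between them; \<open>P\<close> subtracts the paraboloid again.\<close>
  define \<theta> where "\<theta> z = - G z - w2 z + k * (z \<bullet> z)" for z
  have th: "w1 z + k * (z \<bullet> z) \<le> \<theta> z" for z using Gw[of z] unfolding \<theta>_def w_def by simp
  \<comment> \<open>Here -G contributes at most 0, -w2 at most 2k, and the paraboloid exactly 2k;
    subtracting the latter leaves 2k for \<open>P\<close>.\<close>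
  have thd: "\<theta> (x + h) + \<theta> (x - h) - 2 * \<theta> x \<le> 4 * k * (h \<bullet> h)" for x h
  proof -
    have "k * ((x + h) \<bullet> (x + h)) + k * ((x - h) \<bullet> (x - h)) - 2 * (k * (x \<bullet> x)) = 2 * k * (h \<bullet> h)"
      by (simp add: inner_simps inner_commute algebra_simps)
    then show ?thesis
      using Glow[of x h] semiconvex_second_diff[OF w2, of h x] unfolding \<theta>_def by argo
  qed
  define P where "P z = cenv \<theta> z - k * (z \<bullet> z)" for z
  have Pconv: "convex_on UNIV (\<lambda>z. P z + k * (z \<bullet> z))"
    unfolding P_def using cenv_convex[OF w1 th] by simp
  have Pw1: "w1 z \<le> P z" for z unfolding P_def using cenv_ge[OF w1 th, of z] by simp
  have Pw2: "w2 z \<le> - G z - P z" for z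
    unfolding P_def using cenv_le[OF w1 th, of z] unfolding \<theta>_def by simp
  have Pup: "P (x + h) + P (x - h) - 2 * P x \<le> 2 * k * (h \<bullet> h)" for x h
  proof -
    have "k * ((x + h) \<bullet> (x + h)) + k * ((x - h) \<bullet> (x - h)) - 2 * (k * (x \<bullet> x)) = 2 * k * (h \<bullet> h)"
      by (simp add: inner_simps inner_commute algebra_simps)
    then show ?thesis
      using cenv_second_diff[OF w1 th thd, of x h] unfolding P_def by argo
  qed
  have Plow: "- (2 * k) * (h \<bullet> h) \<le> P (x + h) + P (x - h) - 2 * P x" for x h
    by (rule semiconvex_second_diff[OF Pconv])
  have AG: "\<exists>p. \<forall>h. G x - p \<bullet> h \<le> G (x + h)" and AGw: "G x = - w x" if x: "x \<in> A" for x
  proof -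
    obtain p where p: "\<And>y. w y \<le> w x + p \<bullet> (y - x)" using x unfolding A_def by blast
    have lin: "convex_on UNIV (\<lambda>y. - w x - p \<bullet> (y - x))"
      by (rule convex_onI) (auto simp: algebra_simps)
    have ge: "- w x - p \<bullet> (y - x) \<le> G y" for y
      unfolding G_def by (rule cenv_ge[OF lin]) (use p in \<open>simp add: algebra_simps\<close>)
    show eq: "G x = - w x" using ge[of x] Gw[of x] by simp
    show "\<exists>p. \<forall>h. G x - p \<bullet> h \<le> G (x + h)" unfolding eq using ge[of "x + _"] by auto
  qed
  have AP: "P x = w1 x" if "x \<in> A" for x
    using Pw1[of x] Pw2[of x] AGw[OF that] unfolding w_def by simp
  obtain b1 where b1: "\<And>x h. w1 x + b1 x \<bullet> h - k * (h \<bullet> h) \<le> w1 (x + h)" using sub1 by metis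
  obtain p where p: "\<And>x h. x \<in> A \<Longrightarrow> G x - p x \<bullet> h \<le> G (x + h)" using AG by metis
  define Q where "Q c = (if c then P else G)" for c
  define b where "b c = (if c then b1 else (\<lambda>x. - p x))" for c
  have hh: "0 \<le> k * (h \<bullet> h)" for h :: "real^'n" using k by simp
  have Qconv: "convex_on UNIV (\<lambda>x. Q c x + 4 * k * (x \<bullet> x))" for c
  proof -
    have "convex_on UNIV (\<lambda>x. (P x + k * (x \<bullet> x)) + 3 * k * (x \<bullet> x))"
      by (rule convex_on_add[OF Pconv convex_on_scaled_inner]) (use k in simp)
    moreover have "convex_on UNIV (\<lambda>x. G x + 4 * k * (x \<bullet> x))"
      by (rule convex_on_add[OF Gconv convex_on_scaled_inner]) (use k in simp)
    ultimately show ?thesis unfolding Q_def by (auto simp: algebra_simps)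
  qed
  have Qd: "\<bar>Q c (x + h) + Q c (x - h) - 2 * Q c x\<bar> \<le> 4 * k * (h \<bullet> h)" for c x h
    using Pup[of x h] Plow[of h x] Gup[of x h] Glow[of x h] hh[of h] unfolding Q_def by (auto simp: abs_le_iff)
  have Q1: "\<bar>Q c (x + h) - Q c x - b c x \<bullet> h\<bar> \<le> 4 * k * (h \<bullet> h)" if x: "x \<in> A" for c x h
  proof (cases c)
    case True
    have l: "P x + b1 x \<bullet> h - k * (h \<bullet> h) \<le> P (x + h)" for h
      using b1[of x h] Pw1[of "x + h"] AP[OF x] by simp
    show ?thesis using l[of h] l[of "- h"] Pup[of x h] hh[of h] True unfolding Q_def b_def by (simp add: abs_le_iff)
  next
    case False
    show ?thesis using p[OF x, of h] p[OF x, of "- h"] Gup[of x h] hh[of h] False unfolding Q_def b_def by (simp add: abs_le_iff)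
  qed
  have k4: "0 \<le> 4 * k" using k by simp
  have "\<exists>x\<in>A. \<exists>r X. 0 < r \<and> r < \<rho> \<and> (\<forall>c. symmetric_mat (X c) \<and>
      (\<forall>h. norm h \<le> r \<longrightarrow> \<bar>Q c (x + h) - Q c x - b c x \<bullet> h - (1/2) * (h \<bullet> (X c *v h))\<bar> \<le> \<sigma> * r\<^sup>2))"
    by (rule exists_near_quadratic_point[OF A k4 Qconv Qd Q1 pos])
  then obtain x r X where x: "x \<in> A" and r: "0 < r" "r < \<rho>" and X: "\<And>c. symmetric_mat (X c)"
    and ap: "\<And>c h. norm h \<le> r \<Longrightarrow> \<bar>Q c (x + h) - Q c x - b c x \<bullet> h - (1/2) * (h \<bullet> (X c *v h))\<bar> \<le> \<sigma> * r\<^sup>2"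
    by blast
  have xr: "norm x \<le> \<rho>" using x loc unfolding A_def w_def by blast
  define X1 Y where "X1 = X True" and "Y = X False"
  have apP: "P (x + h) \<le> P x + b1 x \<bullet> h + (1/2) * (h \<bullet> (X1 *v h)) + \<sigma> * r\<^sup>2"
    and apP': "P x + b1 x \<bullet> h + (1/2) * (h \<bullet> (X1 *v h)) - \<sigma> * r\<^sup>2 \<le> P (x + h)"
    and apG: "G (x + h) \<le> G x - p x \<bullet> h + (1/2) * (h \<bullet> (Y *v h)) + \<sigma> * r\<^sup>2"
    and apG': "G x - p x \<bullet> h + (1/2) * (h \<bullet> (Y *v h)) - \<sigma> * r\<^sup>2 \<le> G (x + h)" if "norm h \<le> r" for h
    using ap[OF that, of True] ap[OF that, of False] unfolding Q_def b_def X1_def Y_def by (auto simp: abs_le_iff)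
  have sX: "symmetric_mat X1" "symmetric_mat Y" unfolding X1_def Y_def using X by auto
  have ap1: "w1 (x + h) \<le> w1 x + b1 x \<bullet> h + (1/2) * (h \<bullet> (X1 *v h)) + \<sigma> * r\<^sup>2" if "norm h \<le> r" for h
    using apP[OF that] Pw1[of "x + h"] AP[OF x] by linarith
  obtain z1 where z1: "norm (z1 - x) < r" "superjet w1 z1 (X1 + (8 * \<sigma>) *\<^sub>R mat 1)"
    using superjet_of_approx[OF cont[OF w1] sX(1) r(1) pos(1) ap1] by blast
  \<comment> \<open>w2 lies below -G - P with equality at x. The lower approximations of G and P add
    up, hence the Hessian -(X1+Y) and the doubled error.\<close>
  have ap2: "w2 (x + h) \<le> w2 x + (p x - b1 x) \<bullet> h + (1/2) * (h \<bullet> ((- (X1 + Y)) *v h)) + (2 * \<sigma>) * r\<^sup>2"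
    if "norm h \<le> r" for h
  proof -
    have "h \<bullet> ((- (X1 + Y)) *v h) = - (h \<bullet> (X1 *v h)) - h \<bullet> (Y *v h)"
      using matrix_vector_mult_add_rdistrib[of X1 Y h] matrix_vector_mult_diff_rdistrib[of 0 "X1 + Y" h]
      by (simp add: inner_simps)
    then show ?thesis
      using Pw2[of "x + h"] apP'[OF that] apG'[OF that] AP[OF x] AGw[OF x]
      unfolding w_def inner_diff_left by linarith
  qed
  have sXY: "symmetric_mat (- (X1 + Y))" by (intro symmetric_mat_simps sX)
  have pos2: "0 < 2 * \<sigma>" using pos(1) by simp
  obtain z2 where z2: "norm (z2 - x) < r" "superjet w2 z2 (- (X1 + Y) + (8 * (2 * \<sigma>)) *\<^sub>R mat 1)"
    using superjet_of_approx[OF cont[OF w2] sXY r(1) pos2 ap2] by blast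
  have "psd_mat (Y + (2 * \<sigma>) *\<^sub>R mat 1)"
    unfolding psd_mat_def
  proof (intro conjI allI)
    show "symmetric_mat (Y + (2 * \<sigma>) *\<^sub>R mat 1)" by (intro symmetric_mat_simps symmetric_mat_mat sX)
    fix v :: "real^'n"
    show "0 \<le> v \<bullet> ((Y + (2 * \<sigma>) *\<^sub>R mat 1) *v v)"
    proof (cases "v = 0")
      case False
      \<comment> \<open>Positivity is read off at the single scale |h| = r, where the supporting
        plane of G controls the approximating form; homogeneity transfers it to v.\<close>
      define h where "h = (r / norm v) *\<^sub>R v"
      have nh: "norm h = r" unfolding h_def using False r by simp
      have "0 \<le> (1/2) * (h \<bullet> (Y *v h)) + \<sigma> * r\<^sup>2" using apG[of h] p[OF x, of h] nh by simp
      then have "0 \<le> h \<bullet> (Y *v h) + 2 * \<sigma> * (h \<bullet> h)" using nh by (simp flip: power2_norm_eq_inner)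
      also have "\<dots> = (r / norm v)\<^sup>2 * (v \<bullet> (Y *v v) + 2 * \<sigma> * (v \<bullet> v))"
        unfolding h_def matrix_vector_mult_scaleR inner_scaleR_left inner_scaleR_right
        by (simp only: power2_eq_square distrib_left mult_ac)
      finally have "0 \<le> v \<bullet> (Y *v v) + 2 * \<sigma> * (v \<bullet> v)" using r False by (simp add: zero_le_mult_iff)
      then show ?thesis unfolding matrix_vector_mult_add_rdistrib mat_scaled_vector by (simp add: inner_simps)
    qed simp
  qed
  moreover have "norm z < 2 * \<rho>" if "norm (z - x) < r" for z
    using that xr r norm_triangle_ineq[of x "z - x"] by simp
  moreover have "- (X1 + Y) + (8 * (2 * \<sigma>)) *\<^sub>R mat 1 = (16 * \<sigma>) *\<^sub>R mat 1 - (X1 + Y)" by simp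
  ultimately show ?thesis using z1 z2 sX(1) by metis
qed

subsection \<open>Interior comparison for uniformly elliptic operators\<close>

lemma mat_norm_nonneg: "0 \<le> mat_norm N"
  unfolding mat_norm_def by (rule onorm_pos_le[OF matrix_vector_mul_bounded_linear])

lemma elliptic_mono:
  assumes "uniformly_elliptic lam Lam F" "0 \<le> lam" "symmetric_mat M" "psd_mat N"
  shows "F M \<le> F (M + N)"
  using assms mat_norm_nonneg[of N] unfolding uniformly_elliptic_def
  by (smt (verit) mult_nonneg_nonneg)

lemma psd_scaled_id: "0 \<le> c \<Longrightarrow> psd_mat (c *\<^sub>R (mat 1 :: real^'n^'n))"
  unfolding psd_mat_def mat_scaled_vector by (auto intro: symmetric_mat_simps symmetric_mat_mat)

lemma mat_norm_le:
  fixes N :: "real^'n^'n"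
  assumes "\<And>x. norm (N *v x) \<le> c * norm x"
  shows "mat_norm N \<le> c"
  unfolding mat_norm_def using assms by (rule onorm_le)

lemma elliptic_add_id:
  fixes M :: "real^'n^'n"
  assumes "uniformly_elliptic lam Lam F" "0 \<le> Lam" "symmetric_mat M" "0 \<le> c"
  shows "F (M + c *\<^sub>R mat 1) \<le> F M + Lam * c"
proof -
  have "mat_norm (c *\<^sub>R (mat 1 :: real^'n^'n)) \<le> c"
    using assms(4) by (intro mat_norm_le) (simp add: mat_scaled_vector)
  then have "Lam * mat_norm (c *\<^sub>R (mat 1 :: real^'n^'n)) \<le> Lam * c"
    using assms(2) by (rule mult_left_mono)
  then show ?thesis
    using assms(1,3) psd_scaled_id[OF assms(4), where 'n='n] unfolding uniformly_elliptic_def by (smt (verit))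
qed

text \<open>Strictness confines near-maximal points of the summed sup-convolutions to a smaller
  ball, so planes of small slope touch only there and the maximisers stay interior. The jets from
  \<open>semiconvex_sum_jets\<close> pass back to U and W, and ellipticity compares their Hessians
  up to a multiple of \<open>\<sigma>\<close>.\<close>

lemma interior_no_strict_contact:
  fixes U W :: "real^'n \<Rightarrow> real"
  assumes F: "uniformly_elliptic lam Lam F" "0 \<le> lam" "0 \<le> Lam" and R: "0 < R" and \<kappa>: "0 < \<kappa>"
    and U: "continuous_on (cball 0 R) U" and W: "continuous_on (cball 0 R) W"
    and contact: "\<And>x. norm x \<le> R \<Longrightarrow> U x + W x \<le> U 0 + W 0 - \<kappa> * (x \<bullet> x)"
    and sub: "\<And>x X. norm x < R \<Longrightarrow> superjet U x X \<Longrightarrow> k1 \<le> F X"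
    and sup: "\<And>x X. norm x < R \<Longrightarrow> superjet W x X \<Longrightarrow> F (- X) \<le> k2"
  shows "k1 \<le> k2"
proof -
  define S where "S = cball (0::real^'n) R"
  have S: "compact S" "S \<noteq> {}" "0 \<in> S" unfolding S_def using R by auto
  have Uc: "continuous_on S U" "continuous_on S W" using U W unfolding S_def by auto
  obtain BU where BU: "\<And>x. x \<in> S \<Longrightarrow> \<bar>U x\<bar> \<le> BU"
    using compact_imp_bounded[OF compact_continuous_image[OF Uc(1) S(1)]] unfolding bounded_iff by auto
  obtain BW where BW: "\<And>x. x \<in> S \<Longrightarrow> \<bar>W x\<bar> \<le> BW"
    using compact_imp_bounded[OF compact_continuous_image[OF Uc(2) S(1)]] unfolding bounded_iff by auto
  define B where "B = max BU BW"
  have B: "\<bar>U x\<bar> \<le> B" "\<bar>W x\<bar> \<le> B" if "x \<in> S" for x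
    using BU[OF that] BW[OF that] unfolding B_def by auto
  have B0: "0 \<le> B" using B(1)[OF S(3)] by simp
  define m where "m = U 0 + W 0"
  have mB: "- (2 * B) \<le> m" using B[OF S(3)] unfolding m_def by simp
  \<comment> \<open>One loss of \<open>\<theta>\<close> comes from near-maximality and one from
    replacing W y2 by W y1; together they must still force |y1| \<le> R/8.\<close>
  define \<theta> where "\<theta> = min 1 (\<kappa> * (R/8)\<^sup>2 / 2)"
  have th: "0 < \<theta>" "\<theta> \<le> 1" "2 * \<theta> \<le> \<kappa> * (R/8)\<^sup>2" unfolding \<theta>_def using \<kappa> R by auto
  have "uniformly_continuous_on S W" by (rule compact_uniformly_continuous[OF Uc(2) S(1)])
  then obtain d where d: "0 < d" "\<And>x y. x \<in> S \<Longrightarrow> y \<in> S \<Longrightarrow> dist y x < d \<Longrightarrow> dist (W y) (W x) < \<theta>"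
    unfolding uniformly_continuous_on_def using th(1) by meson
  define \<eta> where "\<eta> = min (R/8) (d/3)"
  have eta: "0 < \<eta>" "\<eta> \<le> R/8" "\<eta> + \<eta> < d" unfolding \<eta>_def using R d(1) by (auto simp: min_def)
  \<comment> \<open>The second entry forces maximisers within \<open>\<eta>\<close> of z; k \<ge> 1
    lets the penalty dominate the distance to the ball in \<open>far\<close>.\<close>
  define k where "k = max 1 ((4 * B + 1) / \<eta>\<^sup>2)"
  have k: "1 \<le> k" "4 * B + 1 \<le> k * \<eta>\<^sup>2"
  proof -
    show "1 \<le> k" unfolding k_def by simp
    have "4 * B + 1 = ((4 * B + 1) / \<eta>\<^sup>2) * \<eta>\<^sup>2" using eta(1) by simp
    also have "\<dots> \<le> k * \<eta>\<^sup>2" unfolding k_def by (intro mult_right_mono) auto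
    finally show "4 * B + 1 \<le> k * \<eta>\<^sup>2" .
  qed
  have k0: "0 < k" using k(1) by simp
  define w1 w2 where "w1 = supconv S k U" and "w2 = supconv S k W"
  have sc: "convex_on UNIV (\<lambda>z. w1 z + k * (z \<bullet> z))" "convex_on UNIV (\<lambda>z. w2 z + k * (z \<bullet> z))"
    unfolding w1_def w2_def by (rule supconv_semiconvex[OF S(1,2)], fact Uc)+
  have att: "\<exists>y\<in>S. w1 z = U y - k * ((y - z) \<bullet> (y - z))" "\<exists>y\<in>S. w2 z = W y - k * ((y - z) \<bullet> (y - z))" for z
    unfolding w1_def w2_def using supconv_attained[OF S(1,2)] Uc by metis+
  have sub1: "\<exists>b. \<forall>h. w1 x + b \<bullet> h - k * (h \<bullet> h) \<le> w1 (x + h)" for x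
    using att(1)[of x] supconv_translate_ge[OF S(1) Uc(1)] unfolding w1_def by blast
  have M: "w1 z + w2 z \<le> 2 * B" for z
  proof -
    obtain y1 y2 where y: "y1 \<in> S" "w1 z = U y1 - k * ((y1 - z) \<bullet> (y1 - z))" "y2 \<in> S" "w2 z = W y2 - k * ((y2 - z) \<bullet> (y2 - z))"
      using att[of z] by blast
    have "0 \<le> k * ((y1 - z) \<bullet> (y1 - z))" "0 \<le> k * ((y2 - z) \<bullet> (y2 - z))" using k0 by auto
    then show ?thesis using y B[OF y(1)] B[OF y(3)] by linarith
  qed
  have w0: "m \<le> w1 0 + w2 0"
    using supconv_ge[OF S(1) Uc(1) S(3), of k 0] supconv_ge[OF S(1) Uc(2) S(3), of k 0]
    unfolding m_def w1_def w2_def by simp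
  have local: "norm z \<le> R/4" if z: "m - \<theta> \<le> w1 z + w2 z" for z
  proof -
    obtain y1 y2 where y: "y1 \<in> S" "w1 z = U y1 - k * ((y1 - z) \<bullet> (y1 - z))" "y2 \<in> S" "w2 z = W y2 - k * ((y2 - z) \<bullet> (y2 - z))"
      using att[of z] by blast
    have nn: "0 \<le> k * ((y1 - z) \<bullet> (y1 - z))" "0 \<le> k * ((y2 - z) \<bullet> (y2 - z))" using k0 by auto
    then have "k * ((y1 - z) \<bullet> (y1 - z)) \<le> k * \<eta>\<^sup>2" "k * ((y2 - z) \<bullet> (y2 - z)) \<le> k * \<eta>\<^sup>2"
      using z y(2,4) B[OF y(1)] B[OF y(3)] mB th(2) k(2) by linarith+
    then have yz: "norm (y1 - z) \<le> \<eta>" "norm (y2 - z) \<le> \<eta>"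
      using k0 eta(1) by (simp_all add: power2_norm_eq_inner[symmetric])
    have "dist y1 y2 \<le> norm (y1 - z) + norm (y2 - z)"
      by (metis dist_norm dist_triangle2)
    then have "dist y1 y2 < d" using yz eta(3) by linarith
    then have "dist (W y1) (W y2) < \<theta>" using d(2)[OF y(3) y(1)] by simp
    then have "m - 2 * \<theta> \<le> U y1 + W y1" using z y(2,4) nn unfolding dist_real_def by linarith
    then have "\<kappa> * (y1 \<bullet> y1) \<le> \<kappa> * (R/8)\<^sup>2"
      using contact[of y1] y(1) th(3) unfolding m_def S_def by simp
    then have "norm y1 \<le> R/8" using \<kappa> R by (simp add: power2_norm_eq_inner[symmetric])
    then show ?thesis using yz(1) eta(2) norm_triangle_ineq[of y1 "z - y1"] by (simp add: norm_minus_commute)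
  qed
  \<comment> \<open>For |z| = R + t the two penalties are at least t each. Beyond \<open>R2\<close>
    they outweigh the bounds on U and W together with a tilt of slope at most 1.\<close>
  define R2 where "R2 = R + (4 * B + R + 2)"
  have R2: "0 < R2" unfolding R2_def using R B0 by simp
  have far: "w1 z + w2 z + norm z < m" if z: "R2 < norm z" for z
  proof -
    define t where "t = norm z - R"
    have t: "4 * B + R + 2 < t" using z unfolding t_def R2_def by simp
    obtain y1 y2 where y: "y1 \<in> S" "w1 z = U y1 - k * ((y1 - z) \<bullet> (y1 - z))" "y2 \<in> S" "w2 z = W y2 - k * ((y2 - z) \<bullet> (y2 - z))"
      using att[of z] by blast
    have dist: "t \<le> k * ((y - z) \<bullet> (y - z))" if "y \<in> S" for y
    proof -
      have "t \<le> norm (y - z)"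
        using that norm_triangle_ineq2[of z y] unfolding t_def S_def by (simp add: norm_minus_commute)
      moreover have "1 \<le> t" using t B0 R by simp
      ultimately have "1 * t \<le> norm (y - z) * norm (y - z)" by (intro mult_mono) auto
      also have "\<dots> = 1 * ((y - z) \<bullet> (y - z))" by (simp add: power2_norm_eq_inner[symmetric] power2_eq_square)
      also have "\<dots> \<le> k * ((y - z) \<bullet> (y - z))" using k(1) by (intro mult_right_mono) auto
      finally show ?thesis by simp
    qed
    have "w1 z \<le> B - t" "w2 z \<le> B - t"
      using y(2,4) dist[OF y(1)] dist[OF y(3)] B(1)[OF y(1)] B(2)[OF y(3)] by linarith+
    moreover have "norm z = R + t" unfolding t_def by simp
    ultimately show ?thesis using t mB by linarith
  qed
  \<comment> \<open>Tilting by such a slope changes values on the ball of radius \<open>R2\<close>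
    by at most \<open>\<theta>\<close>, the tolerance of \<open>local\<close>.\<close>
  define p0 where "p0 = min 1 (\<theta> / R2)"
  have p0: "0 < p0" "p0 \<le> 1" "p0 * R2 \<le> \<theta>"
  proof -
    show "0 < p0" "p0 \<le> 1" unfolding p0_def using th R2 by auto
    have "p0 * R2 \<le> (\<theta> / R2) * R2" unfolding p0_def using R2 by (intro mult_right_mono) auto
    then show "p0 * R2 \<le> \<theta>" using R2 by simp
  qed
  have cs: "p \<bullet> z \<le> norm z" "- (p \<bullet> z) \<le> norm z" "- (p \<bullet> z) \<le> p0 * norm z"  if "norm p \<le> p0" for p z :: "real^'n"
  proof -
    have "\<bar>p \<bullet> z\<bar> \<le> norm p * norm z" by (rule Cauchy_Schwarz_ineq2)
    moreover have "norm p * norm z \<le> 1 * norm z" "norm p * norm z \<le> p0 * norm z"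
      using that p0(2) by (intro mult_right_mono; simp)+
    ultimately show "p \<bullet> z \<le> norm z" "- (p \<bullet> z) \<le> norm z" "- (p \<bullet> z) \<le> p0 * norm z" by linarith+
  qed
  have ex: "\<exists>z. \<forall>y. w1 y + w2 y \<le> w1 z + w2 z + p \<bullet> (y - z)" if p: "norm p \<le> p0" for p
  proof -
    have "continuous_on (cball 0 R2) (\<lambda>y. w1 y + w2 y - p \<bullet> y)"
      unfolding w1_def w2_def
      by (intro continuous_intros continuous_on_subset[OF supconv_continuous[OF S(1,2)]] Uc) auto
    moreover have "cball (0::real^'n) R2 \<noteq> {}" using R2 by simp
    ultimately obtain z where z: "z \<in> cball 0 R2" "\<And>y. y \<in> cball 0 R2 \<Longrightarrow> w1 y + w2 y - p \<bullet> y \<le> w1 z + w2 z - p \<bullet> z"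
      using continuous_attains_sup[OF compact_cball] by blast
    have "w1 y + w2 y - p \<bullet> y \<le> w1 z + w2 z - p \<bullet> z" for y
    proof (cases "norm y \<le> R2")
      case False
      then have "w1 y + w2 y + norm y < m" using far by simp
      moreover have "w1 0 + w2 0 \<le> w1 z + w2 z - p \<bullet> z" using z(2)[of 0] R2 by simp
      ultimately show ?thesis using cs(2)[OF p, of y] w0 by linarith
    qed (use z(2) in simp)
    then show ?thesis by (intro exI[of _ z] allI) (simp add: inner_diff_right algebra_simps)
  qed
  have loc: "norm z \<le> R/4" if p: "norm p \<le> p0" and z: "\<forall>y. w1 y + w2 y \<le> w1 z + w2 z + p \<bullet> (y - z)" for p z
  proof -
    have mz: "m \<le> w1 z + w2 z - p \<bullet> z" using z[rule_format, of 0] w0 by simp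
    have "norm z \<le> R2" using far[of z] cs(2)[OF p, of z] mz by (cases "norm z \<le> R2") auto
    then have "p0 * norm z \<le> p0 * R2" using p0(1) by (intro mult_left_mono) auto
    then have "m - \<theta> \<le> w1 z + w2 z" using mz cs(3)[OF p, of z] p0(3) by linarith
    then show ?thesis by (rule local)
  qed
  have main: "k1 \<le> k2 + Lam * (26 * \<sigma>)" if \<sigma>: "0 < \<sigma>" for \<sigma>
  proof -
    have R4: "0 < R/4" using R by simp
    have "\<exists>z1 z2 X Y. norm z1 < 2 * (R/4) \<and> norm z2 < 2 * (R/4) \<and> superjet w1 z1 (X + (8 * \<sigma>) *\<^sub>R mat 1) \<and>
       superjet w2 z2 ((16 * \<sigma>) *\<^sub>R mat 1 - (X + Y)) \<and> psd_mat (Y + (2 * \<sigma>) *\<^sub>R mat 1) \<and> symmetric_mat X"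
      by (rule semiconvex_sum_jets[OF k0 sc sub1 M p0(1) ex loc \<sigma> R4])
    then obtain z1 z2 X Y where z: "norm z1 < 2 * (R/4)" "norm z2 < 2 * (R/4)"
      and j1: "superjet w1 z1 (X + (8 * \<sigma>) *\<^sub>R mat 1)"
      and j2: "superjet w2 z2 ((16 * \<sigma>) *\<^sub>R mat 1 - (X + Y))"
      and Y: "psd_mat (Y + (2 * \<sigma>) *\<^sub>R mat 1)" and X: "symmetric_mat X"
      by blast
    have dk: "2 * B \<le> k * \<eta>\<^sup>2" "0 \<le> \<eta>" using k(2) B0 eta(1) by auto
    have zz: "norm z1 + \<eta> < R" "norm z2 + \<eta> < R" using z eta(2) R by auto
    have "k1 \<le> F (X + (8 * \<sigma>) *\<^sub>R mat 1)"
      using superjet_supconv[OF U B(1) k0 dk zz(1)] j1 sub unfolding w1_def S_def by blast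
    \<comment> \<open>26 = 8 + 16 + 2 collects the errors of the two jets and of the positivity of
      Y.\<close>
    also have "X + (8 * \<sigma>) *\<^sub>R mat 1 = (X - (18 * \<sigma>) *\<^sub>R mat 1) + (26 * \<sigma>) *\<^sub>R mat 1"
      by (simp add: algebra_simps flip: scaleR_add_left)
    also have "F \<dots> \<le> F (X - (18 * \<sigma>) *\<^sub>R mat 1) + Lam * (26 * \<sigma>)"
      using \<sigma> X by (intro elliptic_add_id[OF F(1,3)] symmetric_mat_simps symmetric_mat_mat) auto
    also have "F (X - (18 * \<sigma>) *\<^sub>R mat 1) \<le> F ((X - (18 * \<sigma>) *\<^sub>R mat 1) + (Y + (2 * \<sigma>) *\<^sub>R mat 1))"
      using X by (intro elliptic_mono[OF F(1,2)] Y symmetric_mat_simps symmetric_mat_mat) auto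
    also have "(X - (18 * \<sigma>) *\<^sub>R mat 1) + (Y + (2 * \<sigma>) *\<^sub>R mat 1) = - ((16 * \<sigma>) *\<^sub>R mat 1 - (X + Y))"
      by (simp add: algebra_simps flip: scaleR_add_left)
    also have "F \<dots> \<le> k2"
      using superjet_supconv[OF W B(2) k0 dk zz(2)] j2 sup unfolding w2_def S_def by blast
    finally show ?thesis by simp
  qed
  show ?thesis
  proof (rule field_le_epsilon)
    fix e :: real assume e: "0 < e"
    define s where "s = e / (Lam + 1)"
    have s: "0 < s" "s * (Lam + 1) = e" unfolding s_def using F(3) e by auto
    then have "Lam * s \<le> e" by (simp add: algebra_simps)
    then show "k1 \<le> k2 + e" using main[of "s / 26"] s(1) by simp
  qed
qed

text \<open>Subtracting \<open>\<kappa>\<close> times |x|^2 from U creates strictness, moves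
  Hessians by \<open>2 * \<kappa>\<close> times the identity and so costs at most
  \<open>Lam * (2 * \<kappa>)\<close> in F; then \<open>\<kappa>\<close> tends to 0.\<close>

lemma interior_no_contact:
  fixes U W :: "real^'n \<Rightarrow> real"
  assumes F: "uniformly_elliptic lam Lam F" "0 \<le> lam" "0 \<le> Lam" and R: "0 < R"
    and U: "continuous_on (cball 0 R) U" and W: "continuous_on (cball 0 R) W"
    and contact: "\<And>x. norm x \<le> R \<Longrightarrow> U x + W x \<le> U 0 + W 0"
    and sub: "\<And>x X. norm x < R \<Longrightarrow> superjet U x X \<Longrightarrow> k1 \<le> F X"
    and sup: "\<And>x X. norm x < R \<Longrightarrow> superjet W x X \<Longrightarrow> F (- X) \<le> k2"
  shows "k1 \<le> k2"
proof -
  have main: "k1 - Lam * (2 * \<kappa>) \<le> k2" if \<kappa>: "0 < \<kappa>" for \<kappa>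
  proof (rule interior_no_strict_contact[OF F R \<kappa> _ W _ _ sup])
    show "continuous_on (cball 0 R) (\<lambda>x. U x - \<kappa> * (x \<bullet> x))" by (intro continuous_intros U)
    show "U x - \<kappa> * (x \<bullet> x) + W x \<le> U 0 - \<kappa> * (0 \<bullet> 0) + W 0 - \<kappa> * (x \<bullet> x)" if "norm x \<le> R" for x
      using contact[OF that] by simp
    fix x X assume x: "norm x < R" and j: "superjet (\<lambda>x. U x - \<kappa> * (x \<bullet> x)) x X"
    then obtain \<delta> b where X: "symmetric_mat X" and \<delta>: "0 < \<delta>"
      "\<And>h. norm h < \<delta> \<Longrightarrow> U (x + h) - \<kappa> * ((x + h) \<bullet> (x + h)) \<le> U x - \<kappa> * (x \<bullet> x) + b \<bullet> h + (1/2) * (h \<bullet> (X *v h))"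
      unfolding superjet_def by blast
    have "superjet U x (X + (2 * \<kappa>) *\<^sub>R mat 1)"
      unfolding superjet_def
    proof (intro conjI exI allI impI)
      show "symmetric_mat (X + (2 * \<kappa>) *\<^sub>R mat 1)" by (intro symmetric_mat_simps symmetric_mat_mat X)
      show "0 < \<delta>" by (rule \<delta>(1))
      fix h :: "real^'n" assume "norm h < \<delta>"
      from \<delta>(2)[OF this]
      show "U (x + h) \<le> U x + (b + (2 * \<kappa>) *\<^sub>R x) \<bullet> h + (1/2) * (h \<bullet> ((X + (2 * \<kappa>) *\<^sub>R mat 1) *v h))"
        unfolding matrix_vector_mult_add_rdistrib mat_scaled_vector
        by (simp add: inner_simps inner_commute algebra_simps)
    qed
    then have "k1 \<le> F (X + (2 * \<kappa>) *\<^sub>R mat 1)" using sub x by blast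
    also have "\<dots> \<le> F X + Lam * (2 * \<kappa>)" using \<kappa> by (intro elliptic_add_id[OF F(1,3) X]) auto
    finally show "k1 - Lam * (2 * \<kappa>) \<le> F X" by simp
  qed
  show ?thesis
  proof (rule field_le_epsilon)
    fix e :: real assume e: "0 < e"
    define s where "s = e / (Lam + 1)"
    have s: "0 < s" "s * (Lam + 1) = e" unfolding s_def using F(3) e by auto
    then have "Lam * s \<le> e" by (simp add: algebra_simps)
    then show "k1 \<le> k2 + e" using main[of "s / 2"] s(1) by simp
  qed
qed

section \<open>Slopes at the interface\<close>

text \<open>\<open>tsq e h\<close> is \<open>|h'|\<^sup>2\<close> for \<open>h = (h', h\<^sub>e)\<close>; the sign \<open>s = \<plusminus>1\<close> selects a side of the interface, where
  \<open>s h\<^sub>e\<close> is the height.\<close>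

definition tsq :: "'n::finite \<Rightarrow> real^'n \<Rightarrow> real" where
  "tsq e h = h \<bullet> h - (h $ e)\<^sup>2"

lemma tsq_nonneg: "0 \<le> tsq e h"
proof -
  have "(h $ e)\<^sup>2 \<le> (norm h)\<^sup>2"
    using component_le_norm_cart[of h e] by (metis abs_ge_zero power2_abs power_mono)
  then show ?thesis unfolding tsq_def by (simp add: power2_norm_eq_inner)
qed

lemma tsq_scaleR: "tsq e (c *\<^sub>R h) = c\<^sup>2 * tsq e h"
  unfolding tsq_def by (simp add: power2_eq_square algebra_simps)

lemma tsq_add_axis: "tsq e (h + c *\<^sub>R axis e 1) = tsq e h"
  unfolding tsq_def by (simp add: inner_simps inner_axis' inner_axis power2_eq_square algebra_simps)

text \<open>With N = Lam/lam the term -N A h_e^2 offsets the tangential Hessian in Pucci's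
  inequality. With t = s h_e, the \<open>K\<close> term has second derivative -K(2-a)(1-a)t^(-a),
  which beats the singular right-hand side. For a < 1 both corrections vanish to first order at t =
  0, so \<open>b\<close> is the slope there.\<close>

definition barrier :: "'n::finite \<Rightarrow> real \<Rightarrow> real \<Rightarrow> real \<Rightarrow> real \<Rightarrow> real \<Rightarrow> real \<Rightarrow> real^'n \<Rightarrow> real" where
  "barrier e s a N K b A h = b * (s * h $ e) + A * tsq e h - N * A * (h $ e)\<^sup>2 - K * (s * h $ e) powr (2 - a)"

text \<open>Up to height \<open>\<rho>\<close> one has t^2 \<le> \<open>\<rho> * t\<close> and
  t^(2-a) \<le> \<open>\<rho> powr (1 - a) * t\<close>: the negative terms cost only slope, and
  little of it when \<open>\<rho>\<close> is small.\<close>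

lemma barrier_ge:
  fixes h :: "real^'n"
  assumes s: "s\<^sup>2 = 1" and NK: "0 \<le> N" "0 \<le> K" "0 \<le> A" and a: "a < 1"
    and h: "0 \<le> s * h $ e" "s * h $ e \<le> \<rho>" and \<rho>: "0 < \<rho>"
  shows "(b - N * A * \<rho> - K * \<rho> powr (1 - a)) * (s * h $ e) + A * tsq e h \<le> barrier e s a N K b A h"
proof -
  define t where "t = s * h $ e"
  have t: "0 \<le> t" "t \<le> \<rho>" using h unfolding t_def .
  have "(h $ e)\<^sup>2 = t\<^sup>2" unfolding t_def using s by (simp add: power_mult_distrib)
  also have "t\<^sup>2 \<le> \<rho> * t" unfolding power2_eq_square using t by (intro mult_right_mono)
  finally have "N * A * (h $ e)\<^sup>2 \<le> N * A * (\<rho> * t)" using NK by (intro mult_left_mono) auto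
  moreover have "t powr (2 - a) = t powr (1 - a) * t"
    using t powr_mult_base[OF t(1), of "1 - a"] by (simp add: algebra_simps)
  then have "K * t powr (2 - a) \<le> K * (\<rho> powr (1 - a) * t)"
    using t a NK(2) by (auto intro!: mult_left_mono mult_right_mono powr_mono2)
  ultimately show ?thesis unfolding barrier_def t_def[symmetric] by (simp add: algebra_simps)
qed

lemma barrier_le:
  fixes h :: "real^'n"
  assumes "0 \<le> N" "0 \<le> K" "0 \<le> A"
  shows "barrier e s a N K b A h \<le> b * (s * h $ e) + A * tsq e h"
proof -
  have "0 \<le> N * A * (h $ e)\<^sup>2" "0 \<le> K * (s * h $ e) powr (2 - a)" using assms by auto
  then show ?thesis unfolding barrier_def by linarith
qed

text \<open>This collects what the slope argument uses of a tangential sup-convolution after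
  subtraction of its value and a linear part: comparison with barriers in cylinders, a quadratic
  bound on the interface, an upper bound, and semiconvexity between points of equal height. The
  abstraction treats both functions and both sides at once.\<close>

definition one_sided :: "'n::finite \<Rightarrow> real \<Rightarrow> real \<Rightarrow> real \<Rightarrow> real \<Rightarrow> real \<Rightarrow> real \<Rightarrow> real \<Rightarrow> (real^'n \<Rightarrow> real) \<Rightarrow> bool" where
  "one_sided e s a N K k r0 M U \<longleftrightarrow>
    (\<forall>A b \<rho> L. 0 \<le> A \<and> 0 < \<rho> \<and> 0 < L \<and> \<rho>\<^sup>2 + L\<^sup>2 \<le> r0\<^sup>2 \<longrightarrow>
       (\<forall>h. 0 \<le> s * h $ e \<and> s * h $ e \<le> \<rho> \<and> tsq e h \<le> L\<^sup>2 \<and> (s * h $ e = 0 \<or> s * h $ e = \<rho> \<or> tsq e h = L\<^sup>2)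
           \<longrightarrow> U h \<le> barrier e s a N K b A h) \<longrightarrow>
       (\<forall>h. 0 \<le> s * h $ e \<and> s * h $ e \<le> \<rho> \<and> tsq e h \<le> L\<^sup>2 \<longrightarrow> U h \<le> barrier e s a N K b A h)) \<and>
    (\<forall>h. norm h \<le> r0 \<and> h $ e = 0 \<longrightarrow> U h \<le> k * tsq e h) \<and>
    (\<forall>h. norm h \<le> r0 \<longrightarrow> U h \<le> M) \<and>
    (\<forall>h1 h2 t. norm h1 \<le> r0 \<and> norm h2 \<le> r0 \<and> h1 $ e = h2 $ e \<and> 0 \<le> t \<and> t \<le> 1 \<longrightarrow>
       U ((1 - t) *\<^sub>R h1 + t *\<^sub>R h2) \<le> (1 - t) * U h1 + t * U h2 + k * (t * (1 - t) * ((h1 - h2) \<bullet> (h1 - h2))))"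

lemma one_sidedD:
  assumes "one_sided e s a N K k r0 M U"
  shows "\<lbrakk>0 \<le> A; 0 < \<rho>; 0 < L; \<rho>\<^sup>2 + L\<^sup>2 \<le> r0\<^sup>2;
      \<And>h. \<lbrakk>0 \<le> s * h $ e; s * h $ e \<le> \<rho>; tsq e h \<le> L\<^sup>2; s * h $ e = 0 \<or> s * h $ e = \<rho> \<or> tsq e h = L\<^sup>2\<rbrakk>
           \<Longrightarrow> U h \<le> barrier e s a N K b A h;
      0 \<le> s * h $ e; s * h $ e \<le> \<rho>; tsq e h \<le> L\<^sup>2\<rbrakk> \<Longrightarrow> U h \<le> barrier e s a N K b A h"
    and "\<lbrakk>norm h \<le> r0; h $ e = 0\<rbrakk> \<Longrightarrow> U h \<le> k * tsq e h"
    and "norm h \<le> r0 \<Longrightarrow> U h \<le> M"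
    and "\<lbrakk>norm h1 \<le> r0; norm h2 \<le> r0; h1 $ e = h2 $ e; 0 \<le> t; t \<le> 1\<rbrakk> \<Longrightarrow>
       U ((1 - t) *\<^sub>R h1 + t *\<^sub>R h2) \<le> (1 - t) * U h1 + t * U h2 + k * (t * (1 - t) * ((h1 - h2) \<bullet> (h1 - h2)))"
  using assms unfolding one_sided_def by blast+

lemma norm_le_of_cylinder:
  fixes h :: "real^'n"
  assumes s: "s\<^sup>2 = 1" and h: "0 \<le> s * h $ e" "s * h $ e \<le> \<rho>" "tsq e h \<le> L\<^sup>2"
    and r: "\<rho>\<^sup>2 + L\<^sup>2 \<le> r0\<^sup>2" "0 \<le> r0"
  shows "norm h \<le> r0"
proof -
  have "(h $ e)\<^sup>2 = (s * h $ e)\<^sup>2" using s by (simp add: power_mult_distrib)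
  also have "\<dots> \<le> \<rho>\<^sup>2" using h by (intro power_mono) auto
  finally have "(norm h)\<^sup>2 \<le> r0\<^sup>2" using h(3) r(1) unfolding tsq_def power2_norm_eq_inner by linarith
  then show ?thesis using r(2) by (rule power2_le_imp_le)
qed

text \<open>The three boundary parts of the cylinder fix the constants: A \<ge> k on the interface,
  \<open>M \<le> A * \<rho>\<^sup>2\<close> on the lateral wall, and slope \<open>M / \<rho>\<close>
  at the top once the loss in \<open>barrier_ge\<close> is added.\<close>

lemma one_sided_linear_bound:
  fixes U :: "real^'n \<Rightarrow> real"
  assumes U: "one_sided e s a N K k r0 M U" and s: "s\<^sup>2 = 1" and a: "a < 1"
    and NK: "0 \<le> N" "0 \<le> K" and k: "0 \<le> k" and r0: "0 < r0" and M: "0 \<le> M"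
  shows "\<exists>B A \<rho>. 0 \<le> B \<and> 0 \<le> A \<and> 0 < \<rho> \<and> 2 * \<rho> \<le> r0 \<and>
    (\<forall>h. 0 \<le> s * h $ e \<and> s * h $ e \<le> \<rho> \<and> tsq e h \<le> \<rho>\<^sup>2 \<longrightarrow> U h \<le> B * (s * h $ e) + A * tsq e h)"
proof -
  define \<rho> where "\<rho> = r0 / 2"
  have \<rho>: "0 < \<rho>" "\<rho>\<^sup>2 + \<rho>\<^sup>2 \<le> r0\<^sup>2" unfolding \<rho>_def using r0 by (auto simp: power2_eq_square)
  define A where "A = max k (M / \<rho>\<^sup>2)"
  have A: "0 \<le> A" "k \<le> A" "M \<le> A * \<rho>\<^sup>2"
  proof -
    show "0 \<le> A" "k \<le> A" unfolding A_def using k by auto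
    have "M = M / \<rho>\<^sup>2 * \<rho>\<^sup>2" using \<rho>(1) by simp
    also have "\<dots> \<le> A * \<rho>\<^sup>2" unfolding A_def by (intro mult_right_mono) auto
    finally show "M \<le> A * \<rho>\<^sup>2" .
  qed
  define B where "B = M / \<rho> + N * A * \<rho> + K * \<rho> powr (1 - a)"
  have B: "0 \<le> B" unfolding B_def using M NK A(1) \<rho>(1) by simp
  have "U h \<le> B * (s * h $ e) + A * tsq e h" if h: "0 \<le> s * h $ e" "s * h $ e \<le> \<rho>" "tsq e h \<le> \<rho>\<^sup>2" for h
  proof -
    have "U h \<le> barrier e s a N K B A h"
    proof (rule one_sidedD(1)[OF U A(1) \<rho>(1) \<rho>(1) \<rho>(2) _ h])
      fix h :: "real^'n"
      assume h: "0 \<le> s * h $ e" "s * h $ e \<le> \<rho>" "tsq e h \<le> \<rho>\<^sup>2"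
        and bd: "s * h $ e = 0 \<or> s * h $ e = \<rho> \<or> tsq e h = \<rho>\<^sup>2"
      have nh: "norm h \<le> r0" using norm_le_of_cylinder[OF s h \<rho>(2)] r0 by simp
      have ge: "(M / \<rho>) * (s * h $ e) + A * tsq e h \<le> barrier e s a N K B A h"
        using barrier_ge[OF s NK A(1) a h(1,2) \<rho>(1), of B] unfolding B_def by simp
      have 0: "0 \<le> (M / \<rho>) * (s * h $ e)" "0 \<le> A * tsq e h"
        using h(1) M \<rho>(1) A(1) tsq_nonneg[of e h] by auto
      consider "s * h $ e = 0" | "s * h $ e = \<rho>" | "tsq e h = \<rho>\<^sup>2" using bd by blast
      then show "U h \<le> barrier e s a N K B A h"
      proof cases
        case 1
        then have "h $ e = 0" using s by auto
        then have "U h \<le> k * tsq e h" using one_sidedD(2)[OF U nh] by simp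
        also have "\<dots> \<le> A * tsq e h" using A(2) tsq_nonneg by (intro mult_right_mono)
        finally show ?thesis using ge 0 by linarith
      next
        case 2
        then have "(M / \<rho>) * (s * h $ e) = M" using \<rho>(1) by simp
        then show ?thesis using one_sidedD(3)[OF U nh] ge 0 by linarith
      next
        case 3
        then show ?thesis using one_sidedD(3)[OF U nh] ge 0 A(3) by simp
      qed
    qed
    also have "\<dots> \<le> B * (s * h $ e) + A * tsq e h" by (rule barrier_le[OF NK A(1)])
    finally show ?thesis .
  qed
  then show ?thesis using B A(1) \<rho>(1) unfolding \<rho>_def by (intro exI[of _ B] exI[of _ A] exI[of _ "r0/2"]) auto
qed

text \<open>A linear bound on the axis at one small height \<open>\<rho>\<close> spreads, by tangential semiconvexity and the
  crude linear bound, to a disc of radius much larger than \<open>\<rho>\<close>; the barrier then carries it down to the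
  interface. This replaces boundary regularity theory.\<close>

lemma one_sided_slope:
  fixes U :: "real^'n \<Rightarrow> real"
  assumes U: "one_sided e s a N K k r0 M U" and s: "s\<^sup>2 = 1" and a: "a < 1"
    and NK: "0 < N" "0 \<le> K" and k: "0 \<le> k" and r0: "0 < r0" and M: "0 \<le> M"
    and \<delta>: "0 < \<delta>" and C: "0 \<le> C"
  shows "\<exists>\<rho>0>0. \<forall>\<rho> b. 0 < \<rho> \<and> \<rho> \<le> \<rho>0 \<and> \<bar>b\<bar> \<le> C \<and> U ((\<rho> * s) *\<^sub>R axis e 1) \<le> b * \<rho> \<longrightarrow>
    (\<exists>A. 0 \<le> A \<and> (\<forall>h. norm h \<le> \<rho> \<and> 0 \<le> s * h $ e \<longrightarrow> U h \<le> (b + \<delta>) * (s * h $ e) + A * tsq e h))"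
proof -
  have N0: "0 \<le> N" using NK(1) by simp
  obtain B A0 \<rho>1 where B: "0 \<le> B" "0 \<le> A0" "0 < \<rho>1" "2 * \<rho>1 \<le> r0"
    and lin: "\<And>h. 0 \<le> s * h $ e \<Longrightarrow> s * h $ e \<le> \<rho>1 \<Longrightarrow> tsq e h \<le> \<rho>1\<^sup>2 \<Longrightarrow> U h \<le> B * (s * h $ e) + A0 * tsq e h"
    using one_sided_linear_bound[OF U s a N0 NK(2) k r0 M] by blast
  \<comment> \<open>1/T is the weight given to a far point in a convex combination; the crude slope
    error C + B then costs at most \<open>\<delta> / 8\<close>.\<close>
  define T where "T = max 1 (8 * (C + B) / \<delta>)"
  have T: "1 \<le> T" "C + B \<le> \<delta> / 8 * T"
  proof -
    show "1 \<le> T" unfolding T_def by simp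
    have "C + B = \<delta> / 8 * (8 * (C + B) / \<delta>)" using \<delta> by simp
    also have "\<dots> \<le> \<delta> / 8 * T" unfolding T_def using \<delta> by (intro mult_left_mono) auto
    finally show "C + B \<le> \<delta> / 8 * T" .
  qed
  \<comment> \<open>Ratio of disc radius to height: with the curvature \<open>A\<close> chosen
    below, \<open>A * (R * \<rho>)\<^sup>2\<close> must exceed \<open>(C + B + 1) * \<rho>\<close>
    on the lateral wall.\<close>
  define R where "R = max 1 (4 * N * (C + B + 1) / \<delta>)"
  have R: "1 \<le> R" "C + B + 1 \<le> \<delta> / (4 * N) * R\<^sup>2"
  proof -
    show R1: "1 \<le> R" unfolding R_def by simp
    have "C + B + 1 = \<delta> / (4 * N) * (4 * N * (C + B + 1) / \<delta>)" using \<delta> NK(1) by simp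
    also have "\<dots> \<le> \<delta> / (4 * N) * R" unfolding R_def using \<delta> NK(1) by (intro mult_left_mono) auto
    also have "\<dots> \<le> \<delta> / (4 * N) * R\<^sup>2" using R1 \<delta> NK(1) by (intro mult_left_mono) (auto simp: power2_eq_square)
    finally show "C + B + 1 \<le> \<delta> / (4 * N) * R\<^sup>2" .
  qed
  have TR: "0 < T * R" "1 \<le> T * R" using T(1) R(1) by (auto intro: mult_ge1_I)
  \<comment> \<open>In order: room for the far points, the power loss of the barrier, the quadratic
    errors in \<open>top\<close>, the relation A \<ge> k, and the crude quadratic term on the
    lateral wall.\<close>
  have ev: "\<forall>\<^sub>F \<rho> in at_right 0. \<rho> < \<rho>1 / (T * R) \<and> K * \<rho> powr (1 - a) < \<delta> / 4 \<and>
     (A0 + k) * T * R\<^sup>2 * \<rho> < \<delta> / 8 \<and> \<rho> < \<delta> / (4 * N * (k + 1)) \<and> A0 * R\<^sup>2 * \<rho> < 1"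
  proof (intro eventually_conj)
    show "\<forall>\<^sub>F \<rho> in at_right 0. \<rho> < \<rho>1 / (T * R)" "\<forall>\<^sub>F \<rho> in at_right 0. \<rho> < \<delta> / (4 * N * (k + 1))"
      using B(3) TR \<delta> NK(1) k by (auto intro!: eventually_at_right_less order_tendstoD(2)[OF tendsto_ident_at])
    have "((\<lambda>\<rho>. K * \<rho> powr (1 - a)) \<longlongrightarrow> K * 0 powr (1 - a)) (at_right 0)"
      using a by (intro tendsto_intros) (auto simp: eventually_at_right_field intro!: exI[of _ 1])
    then have "((\<lambda>\<rho>. K * \<rho> powr (1 - a)) \<longlongrightarrow> 0) (at_right 0)" using a by simp
    then show "\<forall>\<^sub>F \<rho> in at_right 0. K * \<rho> powr (1 - a) < \<delta> / 4"
      by (rule order_tendstoD(2)) (use \<delta> in simp)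
    have *: "\<forall>\<^sub>F \<rho> in at_right 0. c * \<rho> < d" if "0 < d" for c d :: real
    proof (rule order_tendstoD(2))
      show "((\<lambda>\<rho>. c * \<rho>) \<longlongrightarrow> c * 0) (at_right 0)" by (intro tendsto_intros)
    qed (use that in simp)
    show "\<forall>\<^sub>F \<rho> in at_right 0. (A0 + k) * T * R\<^sup>2 * \<rho> < \<delta> / 8" "\<forall>\<^sub>F \<rho> in at_right 0. A0 * R\<^sup>2 * \<rho> < 1"
      by (rule *, use \<delta> in simp)+
  qed
  then obtain \<rho>0 where \<rho>0: "0 < \<rho>0" and small: "\<And>\<rho>. 0 < \<rho> \<Longrightarrow> \<rho> < \<rho>0 \<Longrightarrow> \<rho> < \<rho>1 / (T * R) \<and> K * \<rho> powr (1 - a) < \<delta> / 4 \<and>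
     (A0 + k) * T * R\<^sup>2 * \<rho> < \<delta> / 8 \<and> \<rho> < \<delta> / (4 * N * (k + 1)) \<and> A0 * R\<^sup>2 * \<rho> < 1"
    unfolding eventually_at_right_field by auto
  have "\<exists>A. 0 \<le> A \<and> (\<forall>h. norm h \<le> \<rho> \<and> 0 \<le> s * h $ e \<longrightarrow> U h \<le> (b + \<delta>) * (s * h $ e) + A * tsq e h)"
    if \<rho>: "0 < \<rho>" "\<rho> \<le> \<rho>0 / 2" and b: "\<bar>b\<bar> \<le> C" and ax: "U ((\<rho> * s) *\<^sub>R axis e 1) \<le> b * \<rho>" for \<rho> b
  proof -
    have sm: "\<rho> < \<rho>1 / (T * R)" "K * \<rho> powr (1 - a) < \<delta> / 4" "(A0 + k) * T * R\<^sup>2 * \<rho> < \<delta> / 8"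
       "\<rho> < \<delta> / (4 * N * (k + 1))" "A0 * R\<^sup>2 * \<rho> < 1"
      using small[of \<rho>] \<rho> \<rho>0 by auto
    have TRr: "T * R * \<rho> \<le> \<rho>1" using sm(1) TR(1) by (simp add: pos_less_divide_eq mult.commute less_imp_le)
    have Rr: "R * \<rho> \<le> T * R * \<rho>" "\<rho> \<le> R * \<rho>" using T(1) R(1) \<rho>(1) by (auto simp: mult_le_cancel_right1)
    have \<rho>1: "\<rho> \<le> \<rho>1" "R * \<rho> \<le> \<rho>1" using TRr Rr by linarith+
    have cyl: "\<rho>1\<^sup>2 + \<rho>1\<^sup>2 \<le> r0\<^sup>2"
    proof -
      have "4 * \<rho>1\<^sup>2 \<le> r0\<^sup>2" using power_mono[OF B(4), of 2] B(3) by (simp add: power_mult_distrib)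
      then show ?thesis using zero_le_power2[of \<rho>1] by linarith
    qed
    have cyl2: "\<rho>\<^sup>2 + (R * \<rho>)\<^sup>2 \<le> r0\<^sup>2"
      using power_mono[OF \<rho>1(1), of 2] power_mono[OF \<rho>1(2), of 2] \<rho>(1) R(1) cyl by auto
    \<comment> \<open>The largest curvature with slope loss \<open>N * A * \<rho>\<close> within
      \<open>\<delta> / 4\<close>. It blows up as \<open>\<rho>\<close> shrinks, harmlessly, since
      its term has no first-order part at the contact point.\<close>
    define A where "A = \<delta> / (4 * N * \<rho>)"
    have A: "0 \<le> A" "k \<le> A" "N * A * \<rho> = \<delta> / 4" "A * (R * \<rho>)\<^sup>2 = (\<delta> / (4 * N) * R\<^sup>2) * \<rho>"
    proof -
      show "0 \<le> A" "N * A * \<rho> = \<delta> / 4" unfolding A_def using \<delta> NK(1) \<rho>(1) by auto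
      show "A * (R * \<rho>)\<^sup>2 = (\<delta> / (4 * N) * R\<^sup>2) * \<rho>"
        unfolding A_def using \<rho>(1) by (simp add: power2_eq_square field_simps)
      have "\<rho> * (4 * N * (k + 1)) < \<delta>" using sm(4) NK(1) k by (simp add: pos_less_divide_eq)
      moreover have "\<rho> * (4 * N * (k + 1)) = k * (4 * N * \<rho>) + 4 * N * \<rho>" by (simp add: algebra_simps)
      moreover have "0 \<le> 4 * N * \<rho>" using NK(1) \<rho>(1) by simp
      ultimately have "k * (4 * N * \<rho>) \<le> \<delta>" by linarith
      then show "k \<le> A" unfolding A_def using NK(1) \<rho>(1) by (simp add: pos_le_divide_eq)
    qed
    have top: "U h \<le> (b + \<delta> / 4) * \<rho>" if h: "s * h $ e = \<rho>" "tsq e h \<le> (R * \<rho>)\<^sup>2" for h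
    proof -
      \<comment> \<open>\<open>h1\<close> is the axis point and \<open>h2\<close> lies T times as
        far from the axis as h, at the same height. Then h is their combination with weight 1/T on
        \<open>h2\<close>, so the axis bound dominates.\<close>
      define h1 h' h2 where "h1 = (\<rho> * s) *\<^sub>R axis e (1::real)" and "h' = h - h1" and "h2 = h1 + T *\<^sub>R h'"
      have ss: "s * s = 1" using s by (simp add: power2_eq_square)
      have he: "h $ e = \<rho> * s" using h(1) ss by (metis mult.assoc mult.commute mult.left_neutral)
      have h1: "h1 $ e = \<rho> * s" "tsq e h1 = 0" unfolding h1_def using tsq_add_axis[of e 0] by (auto simp: tsq_def)
      have h'e: "h' $ e = 0" unfolding h'_def using he h1 by simp
      have h't: "tsq e h' = tsq e h" unfolding h'_def h1_def using tsq_add_axis[of e h "- (\<rho> * s)"] by simp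
      have h2e: "h2 $ e = \<rho> * s" unfolding h2_def using h1 h'e by simp
      have h2t: "tsq e h2 = T\<^sup>2 * tsq e h"
        unfolding h2_def h1_def using tsq_add_axis[of e "T *\<^sub>R h'" "\<rho> * s"] by (simp add: tsq_scaleR h't add.commute)
      have h2t': "tsq e h2 \<le> \<rho>1\<^sup>2"
      proof -
        have "tsq e h2 \<le> T\<^sup>2 * (R * \<rho>)\<^sup>2" unfolding h2t using h(2) by (intro mult_left_mono) auto
        also have "\<dots> = (T * R * \<rho>)\<^sup>2" by (simp add: power_mult_distrib)
        also have "\<dots> \<le> \<rho>1\<^sup>2" using TRr TR(1) \<rho>(1) by (intro power_mono) auto
        finally show ?thesis .
      qed
      have sh: "s * h1 $ e = \<rho>" "s * h2 $ e = \<rho>" using h1(1) h2e ss by (metis mult.assoc mult.commute mult.left_neutral)+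
      have n1: "norm h1 \<le> r0" "norm h2 \<le> r0"
        using norm_le_of_cylinder[OF s _ _ _ cyl, of h1 e] norm_le_of_cylinder[OF s _ _ _ cyl, of h2 e]
          sh h1(2) h2t' \<rho>(1) \<rho>1(1) r0 by auto
      have U2: "U h2 \<le> B * \<rho> + A0 * (T\<^sup>2 * tsq e h)"
        using lin[of h2] sh(2) \<rho>(1) \<rho>1(1) h2t' h2t by simp
      define t where "t = 1 / T"
      have t: "0 \<le> t" "t \<le> 1" "t * T = 1" unfolding t_def using T(1) by auto
      have "(1 - t) *\<^sub>R h1 + t *\<^sub>R h2 = h1 + (t * T) *\<^sub>R h'" unfolding h2_def by (simp add: algebra_simps)
      then have hc: "(1 - t) *\<^sub>R h1 + t *\<^sub>R h2 = h" unfolding t(3) h'_def by simp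
      have d: "(h1 - h2) \<bullet> (h1 - h2) = T\<^sup>2 * tsq e h"
        unfolding h2_def using h'e h't unfolding tsq_def by (simp add: power2_eq_square)
      have "U h \<le> (1 - t) * U h1 + t * U h2 + k * (t * (1 - t) * (T\<^sup>2 * tsq e h))"
        using one_sidedD(4)[OF U n1 _ t(1,2)] h1(1) h2e unfolding hc d by simp
      also have "\<dots> \<le> (1 - t) * (b * \<rho>) + t * (B * \<rho> + A0 * (T\<^sup>2 * tsq e h)) + k * (t * 1 * (T\<^sup>2 * tsq e h))"
        using ax t U2 k tsq_nonneg[of e h] unfolding h1_def[symmetric]
        by (intro add_mono mult_left_mono mult_right_mono) auto
      also have "\<dots> = b * \<rho> + t * (B - b) * \<rho> + (A0 + k) * ((t * T) * T * tsq e h)"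
        by (simp add: power2_eq_square algebra_simps)
      also have "\<dots> \<le> b * \<rho> + (\<delta> / 8) * \<rho> + (A0 + k) * (T * (R * \<rho>)\<^sup>2)"
      proof (intro add_mono mult_right_mono order_refl)
        have "t * (B - b) \<le> t * (\<delta> / 8 * T)" using t(1) T(2) b by (intro mult_left_mono) auto
        also have "\<dots> = \<delta> / 8" using t(3) by simp
        finally show "t * (B - b) \<le> \<delta> / 8" .
        show "0 \<le> \<rho>" using \<rho> by simp
        show "(A0 + k) * ((t * T) * T * tsq e h) \<le> (A0 + k) * (T * (R * \<rho>)\<^sup>2)"
          unfolding t(3) using B(2) k T(1) h(2) by (intro mult_left_mono) auto
      qed (use \<rho> in auto)
      also have "\<dots> = b * \<rho> + (\<delta> / 8) * \<rho> + ((A0 + k) * T * R\<^sup>2 * \<rho>) * \<rho>"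
        by (simp add: power2_eq_square algebra_simps)
      also have "\<dots> \<le> b * \<rho> + (\<delta> / 8) * \<rho> + (\<delta> / 8) * \<rho>"
        using sm(3) \<rho>(1) by (intro add_left_mono mult_right_mono) auto
      finally show ?thesis by (simp add: algebra_simps)
    qed
    have "U h \<le> (b + \<delta>) * (s * h $ e) + A * tsq e h" if nh: "norm h \<le> \<rho>" and sh: "0 \<le> s * h $ e" for h
    proof -
      have s1: "\<bar>s\<bar> = 1" using s by (metis abs_square_eq_1 )
      have "s * h $ e \<le> \<bar>h $ e\<bar>" using s1 abs_ge_self[of "s * h $ e"] by (simp add: abs_mult)
      then have sh2: "s * h $ e \<le> \<rho>" using component_le_norm_cart[of h e] nh by linarith
      have "tsq e h \<le> (norm h)\<^sup>2" unfolding tsq_def power2_norm_eq_inner by simp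
      also have "\<dots> \<le> (R * \<rho>)\<^sup>2" using nh Rr(2) by (intro power_mono) auto
      finally have th: "tsq e h \<le> (R * \<rho>)\<^sup>2" .
      have R\<rho>: "0 < R * \<rho>" using R(1) \<rho>(1) by simp
      have "U h \<le> barrier e s a N K (b + \<delta>) A h"
      proof (rule one_sidedD(1)[OF U A(1) \<rho>(1) R\<rho> cyl2 _ sh sh2 th])
        fix h :: "real^'n"
        assume h: "0 \<le> s * h $ e" "s * h $ e \<le> \<rho>" "tsq e h \<le> (R * \<rho>)\<^sup>2"
          and bd: "s * h $ e = 0 \<or> s * h $ e = \<rho> \<or> tsq e h = (R * \<rho>)\<^sup>2"
        have nh: "norm h \<le> r0" using norm_le_of_cylinder[OF s h cyl2] r0 by simp
        have "(b + \<delta> / 2) * (s * h $ e) \<le> (b + \<delta> - N * A * \<rho> - K * \<rho> powr (1 - a)) * (s * h $ e)"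
          unfolding A(3) using sm(2) h(1) by (intro mult_right_mono) auto
        then have ge: "(b + \<delta> / 2) * (s * h $ e) + A * tsq e h \<le> barrier e s a N K (b + \<delta>) A h"
          using barrier_ge[OF s N0 NK(2) A(1) a h(1,2) \<rho>(1), of "b + \<delta>"] by linarith
        have 0: "0 \<le> A * tsq e h" using A(1) tsq_nonneg[of e h] by auto
        consider "s * h $ e = 0" | "s * h $ e = \<rho>" | "tsq e h = (R * \<rho>)\<^sup>2" using bd by blast
        then show "U h \<le> barrier e s a N K (b + \<delta>) A h"
        proof cases
          case 1
          then have "h $ e = 0" using s by auto
          then have "U h \<le> k * tsq e h" using one_sidedD(2)[OF U nh] by simp
          also have "\<dots> \<le> A * tsq e h" using A(2) tsq_nonneg by (intro mult_right_mono)
          finally show ?thesis using ge 1 by simp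
        next
          case 2
          have "U h \<le> (b + \<delta> / 4) * \<rho>" using top 2 h(3) by simp
          also have "\<dots> \<le> (b + \<delta> / 2) * \<rho>" using \<delta> \<rho>(1) by (intro mult_right_mono) auto
          finally show ?thesis using ge 0 2 by simp
        next
          case 3
          define t where "t = s * h $ e"
          have t: "0 \<le> t" "t \<le> \<rho>" unfolding t_def using h by auto
          have "tsq e h \<le> \<rho>1\<^sup>2" using h(3) power_mono[OF \<rho>1(2), of 2] R\<rho> by simp
          then have "U h \<le> B * t + A0 * (R * \<rho>)\<^sup>2"
            using lin[of h] h \<rho>1(1) 3 unfolding t_def by simp
          also have "A0 * (R * \<rho>)\<^sup>2 = (A0 * R\<^sup>2 * \<rho>) * \<rho>" by (simp add: power2_eq_square)
          also have "\<dots> \<le> 1 * \<rho>" using sm(5) \<rho>(1) by (intro mult_right_mono) auto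
          finally have u1: "U h \<le> B * t + \<rho>" by simp
          have "B * t - (b + \<delta> / 2) * t \<le> (B + C) * t"
            using b \<delta> t by (auto simp flip: left_diff_distrib intro!: mult_right_mono)
          also have "\<dots> \<le> (B + C) * \<rho>" using B(1) C t by (intro mult_left_mono) auto
          finally have u2: "U h \<le> (b + \<delta> / 2) * t + (C + B + 1) * \<rho>" using u1 by (simp add: algebra_simps)
          have "(C + B + 1) * \<rho> \<le> A * tsq e h"
            unfolding 3 A(4) using R(2) \<rho>(1) by (intro mult_right_mono) auto
          then show ?thesis using ge u2 unfolding t_def by linarith
        qed
      qed
      also have "\<dots> \<le> (b + \<delta>) * (s * h $ e) + A * tsq e h" by (rule barrier_le[OF N0 NK(2) A(1)])
      finally show ?thesis .
    qed
    then show ?thesis using A(1) by blast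
  qed
  then show ?thesis using \<rho>0 by (intro exI[of _ "\<rho>0 / 2"]) auto
qed

text \<open>Both slopes are read off at one axis point: b is essentially the quotient of U there by
  the height, and U + W \<le> 0 gives W the bound -b. \<open>one_sided_slope\<close> carries both
  down to the interface at the cost of \<open>\<delta>\<close>.\<close>

lemma matching_slopes:
  fixes U W :: "real^'n \<Rightarrow> real"
  assumes U: "one_sided e s a N K k r0 M U" and W: "one_sided e s a N K k r0 M W"
    and s: "s\<^sup>2 = 1" and a: "a < 1"
    and NK: "0 < N" "0 \<le> K" and k: "0 \<le> k" and r0: "0 < r0" and M: "0 \<le> M" and \<delta>: "0 < \<delta>"
    and UW: "\<And>h. norm h \<le> r0 \<Longrightarrow> U h + W h \<le> 0"
  shows "\<exists>b A r. 0 \<le> A \<and> 0 < r \<and> (\<forall>h. norm h \<le> r \<and> 0 \<le> s * h $ e \<longrightarrow>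
     U h \<le> (b + \<delta>) * (s * h $ e) + A * tsq e h \<and> W h \<le> (- b + \<delta>) * (s * h $ e) + A * tsq e h)"
proof -
  have N0: "0 \<le> N" using NK by simp
  obtain B1 A1 \<rho>1 where B1: "0 \<le> B1" "0 < \<rho>1"
    and lin1: "\<And>h. 0 \<le> s * h $ e \<Longrightarrow> s * h $ e \<le> \<rho>1 \<Longrightarrow> tsq e h \<le> \<rho>1\<^sup>2 \<Longrightarrow> U h \<le> B1 * (s * h $ e) + A1 * tsq e h"
    using one_sided_linear_bound[OF U s a N0 NK(2) k r0 M] by blast
  obtain B2 A2 \<rho>2 where B2: "0 \<le> B2" "0 < \<rho>2"
    and lin2: "\<And>h. 0 \<le> s * h $ e \<Longrightarrow> s * h $ e \<le> \<rho>2 \<Longrightarrow> tsq e h \<le> \<rho>2\<^sup>2 \<Longrightarrow> W h \<le> B2 * (s * h $ e) + A2 * tsq e h"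
    using one_sided_linear_bound[OF W s a N0 NK(2) k r0 M] by blast
  define B where "B = B1 + B2"
  have B: "0 \<le> B" "B1 \<le> B" "B2 \<le> B" unfolding B_def using B1 B2 by auto
  obtain \<rho>3 where \<rho>3: "0 < \<rho>3" and U3: "\<And>\<rho> b. 0 < \<rho> \<Longrightarrow> \<rho> \<le> \<rho>3 \<Longrightarrow> \<bar>b\<bar> \<le> B \<Longrightarrow> U ((\<rho> * s) *\<^sub>R axis e 1) \<le> b * \<rho> \<Longrightarrow>
    \<exists>A. 0 \<le> A \<and> (\<forall>h. norm h \<le> \<rho> \<and> 0 \<le> s * h $ e \<longrightarrow> U h \<le> (b + \<delta>) * (s * h $ e) + A * tsq e h)"
    using one_sided_slope[OF U s a NK k r0 M \<delta> B(1)] by blast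
  obtain \<rho>4 where \<rho>4: "0 < \<rho>4" and W4: "\<And>\<rho> b. 0 < \<rho> \<Longrightarrow> \<rho> \<le> \<rho>4 \<Longrightarrow> \<bar>b\<bar> \<le> B \<Longrightarrow> W ((\<rho> * s) *\<^sub>R axis e 1) \<le> b * \<rho> \<Longrightarrow>
    \<exists>A. 0 \<le> A \<and> (\<forall>h. norm h \<le> \<rho> \<and> 0 \<le> s * h $ e \<longrightarrow> W h \<le> (b + \<delta>) * (s * h $ e) + A * tsq e h)"
    using one_sided_slope[OF W s a NK k r0 M \<delta> B(1)] by blast
  define \<rho> where "\<rho> = min (min \<rho>1 \<rho>2) (min (min \<rho>3 \<rho>4) r0)"
  have \<rho>: "0 < \<rho>" "\<rho> \<le> \<rho>1" "\<rho> \<le> \<rho>2" "\<rho> \<le> \<rho>3" "\<rho> \<le> \<rho>4" "\<rho> \<le> r0"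
    unfolding \<rho>_def using B1 B2 \<rho>3 \<rho>4 r0 by auto
  define h where "h = (\<rho> * s) *\<^sub>R axis e (1::real)"
  have ss: "s * s = 1" using s by (simp add: power2_eq_square)
  have h: "s * h $ e = \<rho>" "tsq e h = 0" unfolding h_def using tsq_add_axis[of e 0] ss by (auto simp: tsq_def)
  have "norm h = \<rho>" unfolding h_def using s \<rho>(1) by (simp add: abs_mult power2_eq_1_iff)  (auto simp: power2_eq_1_iff)
  then have nh: "norm h \<le> r0" using \<rho>(6) by simp
  have UB: "U h \<le> B * \<rho>"
  proof -
    have "U h \<le> B1 * \<rho>" using lin1[of h] h \<rho> by simp
    also have "\<dots> \<le> B * \<rho>" using B(2) \<rho>(1) by (intro mult_right_mono) auto
    finally show ?thesis .
  qed
  have WB: "W h \<le> B * \<rho>"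
  proof -
    have "W h \<le> B2 * \<rho>" using lin2[of h] h \<rho> by simp
    also have "\<dots> \<le> B * \<rho>" using B(3) \<rho>(1) by (intro mult_right_mono) auto
    finally show ?thesis .
  qed
  \<comment> \<open>Truncation at -B keeps b bounded when U is very negative at h; the crude linear
    bound for W then takes over.\<close>
  define b where "b = max (- B) (U h / \<rho>)"
  have b: "\<bar>b\<bar> \<le> B" "U h \<le> b * \<rho>" "W h \<le> (- b) * \<rho>"
  proof -
    have "U h / \<rho> \<le> B" using UB \<rho>(1) by (simp add: pos_divide_le_eq)
    then show "\<bar>b\<bar> \<le> B" unfolding b_def using B(1) by auto
    have "U h = (U h / \<rho>) * \<rho>" using \<rho>(1) by simp
    also have "\<dots> \<le> b * \<rho>" unfolding b_def using \<rho>(1) by (intro mult_right_mono) auto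
    finally show "U h \<le> b * \<rho>" .
    show "W h \<le> (- b) * \<rho>"
    proof (cases "- B \<le> U h / \<rho>")
      case True
      then have "b * \<rho> = U h" unfolding b_def using \<rho>(1) by simp
      then show ?thesis using UW[OF nh] by simp
    next
      case False
      then have "b = - B" unfolding b_def by simp
      then show ?thesis using WB by simp
    qed
  qed
  have mb: "\<bar>- b\<bar> \<le> B" using b(1) by simp
  obtain A3 where A3: "0 \<le> A3" "\<And>h. norm h \<le> \<rho> \<Longrightarrow> 0 \<le> s * h $ e \<Longrightarrow> U h \<le> (b + \<delta>) * (s * h $ e) + A3 * tsq e h"
    using U3[OF \<rho>(1,4) b(1)] b(2) unfolding h_def by blast
  obtain A4 where A4: "0 \<le> A4" "\<And>h. norm h \<le> \<rho> \<Longrightarrow> 0 \<le> s * h $ e \<Longrightarrow> W h \<le> (- b + \<delta>) * (s * h $ e) + A4 * tsq e h"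
    using W4[OF \<rho>(1,5) mb] b(3) unfolding h_def by blast
  have le: "A3 * tsq e h \<le> (A3 + A4) * tsq e h" "A4 * tsq e h \<le> (A3 + A4) * tsq e h" for h
    using A3(1) A4(1) tsq_nonneg[of e h] by (auto intro: mult_right_mono)
  show ?thesis
  proof (intro exI conjI allI impI; (elim conjE)?)
    show "0 \<le> A3 + A4" "0 < \<rho>" using A3(1) A4(1) \<rho>(1) by auto
    fix h :: "real^'n" assume h: "norm h \<le> \<rho>" "0 \<le> s * h $ e"
    show "U h \<le> (b + \<delta>) * (s * h $ e) + (A3 + A4) * tsq e h"
      using A3(2)[OF h] le(1)[of h] by linarith
    show "W h \<le> (- b + \<delta>) * (s * h $ e) + (A3 + A4) * tsq e h"
      using A4(2)[OF h] le(2)[of h] by linarith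
  qed
qed

subsection \<open>The barrier as a test function\<close>

text \<open>This is the projection onto the normal axis and \<open>mat 1 - ecoord e\<close> the
  tangential one; they split the Hessian of a barrier with nonnegative \<open>A\<close>,
  \<open>N\<close>, \<open>K\<close> into a positive tangential and a negative normal part.\<close>

definition ecoord :: "'n::finite \<Rightarrow> real^'n^'n" where
  "ecoord e = (\<chi> i j. if i = e \<and> j = e then 1 else 0)"

lemma ecoord_mult: "ecoord e *v h = (h $ e) *\<^sub>R axis e 1"
  by (auto simp: ecoord_def matrix_vector_mult_def vec_eq_iff axis_def if_distrib[of "\<lambda>c. c * _"] cong: if_cong)

lemma symmetric_ecoord: "symmetric_mat (ecoord e)"
  unfolding symmetric_mat_iff ecoord_def by auto

lemma norm_minus_axis_sq: "(norm (h - (h $ e) *\<^sub>R axis e 1))\<^sup>2 = tsq e (h::real^'n)"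
  unfolding power2_norm_eq_inner tsq_def
  by (simp add: inner_simps inner_axis inner_axis' power2_eq_square algebra_simps)

lemma psd_scaled_ecoord:
  fixes e :: "'n::finite"
  assumes "0 \<le> c" shows "psd_mat (c *\<^sub>R ecoord e)"
  unfolding psd_mat_def
proof (intro conjI allI symmetric_mat_simps symmetric_ecoord)
  fix x :: "real^'n"
  have "x \<bullet> ((c *\<^sub>R ecoord e) *v x) = c * (x $ e)\<^sup>2"
    by (simp add: ecoord_mult inner_axis power2_eq_square flip: scaleR_matrix_vector_assoc)
  then show "0 \<le> x \<bullet> ((c *\<^sub>R ecoord e) *v x)" using assms by simp
qed

lemma psd_scaled_tangential:
  fixes e :: "'n::finite"
  assumes "0 \<le> c" shows "psd_mat (c *\<^sub>R (mat 1 - ecoord e))"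
  unfolding psd_mat_def
proof (intro conjI allI symmetric_mat_simps symmetric_ecoord symmetric_mat_mat)
  fix x :: "real^'n"
  have "x \<bullet> ((c *\<^sub>R (mat 1 - ecoord e)) *v x) = c * tsq e x"
    by (simp add: ecoord_mult inner_axis tsq_def power2_eq_square matrix_vector_mult_diff_rdistrib inner_diff_right
        flip: scaleR_matrix_vector_assoc)
  then show "0 \<le> x \<bullet> ((c *\<^sub>R (mat 1 - ecoord e)) *v x)" using assms tsq_nonneg[of e x] by simp
qed

lemma mat_norm_scaled_ecoord_ge:
  fixes e :: "'n::finite"
  assumes "0 \<le> c" shows "c \<le> mat_norm (c *\<^sub>R ecoord e)"
proof -
  have "norm ((c *\<^sub>R ecoord e) *v axis e 1) \<le> mat_norm (c *\<^sub>R ecoord e) * norm (axis e (1::real))"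
    unfolding mat_norm_def by (rule onorm[OF matrix_vector_mul_bounded_linear])
  moreover have "(c *\<^sub>R ecoord e) *v axis e 1 = c *\<^sub>R axis e 1"
    by (simp add: ecoord_mult flip: scaleR_matrix_vector_assoc)
  ultimately show ?thesis using assms by simp
qed

lemma mat_norm_scaled_tangential_le:
  fixes e :: "'n::finite"
  assumes "0 \<le> c" shows "mat_norm (c *\<^sub>R (mat 1 - ecoord e)) \<le> c"
proof (rule mat_norm_le)
  fix x :: "real^'n"
  have "(norm (x - (x $ e) *\<^sub>R axis e 1))\<^sup>2 \<le> (norm x)\<^sup>2"
    unfolding norm_minus_axis_sq by (simp add: tsq_def power2_norm_eq_inner)
  then have "norm (x - (x $ e) *\<^sub>R axis e 1) \<le> norm x" by (rule power2_le_imp_le) simp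
  moreover have "(c *\<^sub>R (mat 1 - ecoord e)) *v x = c *\<^sub>R (x - (x $ e) *\<^sub>R axis e 1)"
    by (simp add: ecoord_mult matrix_vector_mult_diff_rdistrib flip: scaleR_matrix_vector_assoc)
  ultimately show "norm ((c *\<^sub>R (mat 1 - ecoord e)) *v x) \<le> c * norm x"
    using assms by (simp add: mult_left_mono)
qed

section \<open>Translation of test functions and the Hessian of the barrier\<close>

lemma C2_with_hessian_translate:
  assumes "C2_with_hessian \<phi> H S" and sub: "\<And>y. y \<in> S' \<Longrightarrow> y - w \<in> S"
  shows "C2_with_hessian (\<lambda>y. c + q \<bullet> y + \<phi> (y - w)) (\<lambda>y. H (y - w)) S'"
proof -
  obtain G where G: "\<And>y. y \<in> S \<Longrightarrow> (\<phi> has_derivative (\<lambda>h. G y \<bullet> h)) (at y)"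
      "\<And>y. y \<in> S \<Longrightarrow> (G has_derivative (\<lambda>h. H y *v h)) (at y)" "continuous_on S H"
    using assms(1) unfolding C2_with_hessian_def by blast
  have tr: "((\<lambda>y. y - w) has_derivative (\<lambda>h. h)) (at y)" for y
    by (auto intro!: derivative_eq_intros)
  show ?thesis
    unfolding C2_with_hessian_def
  proof (intro exI[of _ "\<lambda>y. q + G (y - w)"] conjI ballI)
    fix y assume y: "y \<in> S'"
    have "((\<lambda>y. \<phi> (y - w)) has_derivative (\<lambda>h. G (y - w) \<bullet> h)) (at y)"
      using has_derivative_compose[OF tr G(1)[OF sub[OF y]]] .
    then show "((\<lambda>y. c + q \<bullet> y + \<phi> (y - w)) has_derivative (\<lambda>h. (q + G (y - w)) \<bullet> h)) (at y)"
      by (auto intro!: derivative_eq_intros simp: inner_add_left)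
    have "((\<lambda>y. G (y - w)) has_derivative (\<lambda>h. H (y - w) *v h)) (at y)"
      using has_derivative_compose[OF tr G(2)[OF sub[OF y]]] .
    then show "((\<lambda>y. q + G (y - w)) has_derivative (\<lambda>h. H (y - w) *v h)) (at y)"
      by (auto intro!: derivative_eq_intros)
  next
    show "continuous_on S' (\<lambda>y. H (y - w))"
      by (rule continuous_on_compose2[OF G(3)]) (use sub in \<open>auto intro!: continuous_intros\<close>)
  qed
qed

lemma has_derivative_vec_nth: "((\<lambda>x::real^'n. x $ e) has_derivative (\<lambda>h. h $ e)) F"
  by (rule bounded_linear_imp_has_derivative[OF bounded_linear_vec_nth])

lemma has_derivative_side_powr:
  assumes "0 < s * (x::real^'n) $ e"
  shows "((\<lambda>x. (s * x $ e) powr c) has_derivative (\<lambda>h. (s * h $ e) * (c * (s * x $ e) powr (c - 1)))) (at x)"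
proof -
  have "((\<lambda>x. s * x $ e) has_derivative (\<lambda>h. s * h $ e)) (at x)"
    by (intro has_derivative_mult_right has_derivative_vec_nth)
  from DERIV_compose_FDERIV[OF has_real_derivative_powr[OF assms] this] show ?thesis .
qed

lemma C2_barrier:
  fixes e :: "'n::finite"
  assumes s: "s\<^sup>2 = 1"
  shows "C2_with_hessian (barrier e s a N K b A)
     (\<lambda>h. (2 * A) *\<^sub>R (mat 1 - ecoord e) - (2 * N * A + K * (2 - a) * (1 - a) * (s * h $ e) powr (- a)) *\<^sub>R ecoord e)
     {h. 0 < s * h $ e}"
proof -
  define G where "G h = (b * s - 2 * N * A * h $ e - K * ((2 - a) * (s * h $ e) powr (1 - a)) * s) *\<^sub>R axis e 1
      + (2 * A) *\<^sub>R (h - (h $ e) *\<^sub>R axis e 1)" for h :: "real^'n"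
  have ss: "s * (s * x) = x" for x using s by (simp add: power2_eq_square flip: mult.assoc)
  show ?thesis
    unfolding C2_with_hessian_def
  proof (intro exI[of _ G] conjI ballI)
    fix h :: "real^'n" assume "h \<in> {h. 0 < s * h $ e}"
    then have h: "0 < s * h $ e" by simp
    define pw where "pw c h = (s * h $ e) powr c" for c and h :: "real^'n"
    have dpw: "(pw (2 - a) has_derivative (\<lambda>k. (s * k $ e) * ((2 - a) * pw (1 - a) h))) (at h)"
      unfolding pw_def using has_derivative_side_powr[OF h, of "2 - a"] by simp
    have "(barrier e s a N K b A has_derivative (\<lambda>k. b * (s * k $ e) + A * (2 * (h \<bullet> k) - 2 * (h $ e) * (k $ e))
        - N * A * (2 * (h $ e) * (k $ e)) - K * ((s * k $ e) * ((2 - a) * pw (1 - a) h)))) (at h)"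
      unfolding barrier_def tsq_def power2_eq_square pw_def[symmetric]
      by (auto intro!: derivative_eq_intros dpw has_derivative_vec_nth simp: inner_commute algebra_simps fun_eq_iff)
    also have "(\<lambda>k. b * (s * k $ e) + A * (2 * (h \<bullet> k) - 2 * (h $ e) * (k $ e))
        - N * A * (2 * (h $ e) * (k $ e)) - K * ((s * k $ e) * ((2 - a) * pw (1 - a) h))) = (\<lambda>k. G h \<bullet> k)"
      unfolding G_def pw_def by (simp add: fun_eq_iff inner_add_left inner_diff_left inner_axis' algebra_simps)
    finally show "(barrier e s a N K b A has_derivative (\<lambda>k. G h \<bullet> k)) (at h)" .
    define D where "D = (2 - a) * ((1 - a) * (s * h $ e) powr (- a))"
    have dpw1: "(pw (1 - a) has_derivative (\<lambda>k. (s * k $ e) * ((1 - a) * pw (- a) h))) (at h)"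
      unfolding pw_def using has_derivative_side_powr[OF h, of "1 - a"] by simp
    have "(G has_derivative (\<lambda>k. (- (2 * N * A * k $ e) - K * ((2 - a) * ((s * k $ e) * ((1 - a) * pw (- a) h))) * s) *\<^sub>R axis e 1
       + (2 * A) *\<^sub>R (k - (k $ e) *\<^sub>R axis e 1))) (at h)"
      unfolding G_def pw_def[symmetric]
      by (auto intro!: derivative_eq_intros dpw1 has_derivative_vec_nth)
    then have "(G has_derivative (\<lambda>k. (- (2 * N * A * k $ e) - K * ((2 - a) * ((s * k $ e) * ((1 - a) * (s * h $ e) powr (- a)))) * s) *\<^sub>R axis e 1
       + (2 * A) *\<^sub>R (k - (k $ e) *\<^sub>R axis e 1))) (at h)"
      unfolding pw_def .
    also have "(\<lambda>k. (- (2 * N * A * k $ e) - K * ((2 - a) * ((s * k $ e) * ((1 - a) * (s * h $ e) powr (- a)))) * s) *\<^sub>R axis e 1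
       + (2 * A) *\<^sub>R (k - (k $ e) *\<^sub>R axis e 1))
     = (\<lambda>k. ((2 * A) *\<^sub>R (mat 1 - ecoord e) - (2 * N * A + K * (2 - a) * (1 - a) * (s * h $ e) powr (- a)) *\<^sub>R ecoord e) *v k)"
    proof
      fix k :: "real^'n"
      have "- (2 * N * A * k $ e) - K * ((2 - a) * ((s * k $ e) * ((1 - a) * (s * h $ e) powr (- a)))) * s
        = - (2 * N * A * k $ e) - K * (2 - a) * (1 - a) * (s * h $ e) powr (- a) * (s * (s * k $ e))"
        by (simp only: mult_ac)
      also have "\<dots> = - ((2 * N * A + K * (2 - a) * (1 - a) * (s * h $ e) powr (- a)) * k $ e)"
        unfolding ss by (simp add: distrib_right)
      finally have c: "- (2 * N * A * k $ e) - K * ((2 - a) * ((s * k $ e) * ((1 - a) * (s * h $ e) powr (- a)))) * s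
        = - ((2 * N * A + K * (2 - a) * (1 - a) * (s * h $ e) powr (- a)) * k $ e)" .
      show "(- (2 * N * A * k $ e) - K * ((2 - a) * ((s * k $ e) * ((1 - a) * (s * h $ e) powr (- a)))) * s) *\<^sub>R axis e 1
        + (2 * A) *\<^sub>R (k - (k $ e) *\<^sub>R axis e 1)
        = ((2 * A) *\<^sub>R (mat 1 - ecoord e) - (2 * N * A + K * (2 - a) * (1 - a) * (s * h $ e) powr (- a)) *\<^sub>R ecoord e) *v k"
        unfolding c
        by (simp add: matrix_vector_mult_diff_rdistrib ecoord_mult flip: scaleR_matrix_vector_assoc)
    qed
    finally show "(G has_derivative (\<lambda>k. ((2 * A) *\<^sub>R (mat 1 - ecoord e) - (2 * N * A + K * (2 - a) * (1 - a) * (s * h $ e) powr (- a)) *\<^sub>R ecoord e) *v k)) (at h)" .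
  next
    show "continuous_on {h. 0 < s * h $ e} (\<lambda>h. (2 * A) *\<^sub>R (mat 1 - ecoord e) - (2 * N * A + K * (2 - a) * (1 - a) * (s * h $ e) powr (- a)) *\<^sub>R ecoord e)"
      by (intro continuous_intros) auto
  qed
qed

subsection \<open>Tangential sup-convolution\<close>

definition slice :: "'n::finite \<Rightarrow> real^'n \<Rightarrow> (real^'n) set" where
  "slice e z = {x \<in> cball 0 1. x $ e = z $ e}"

text \<open>Competitors keep the height of z, so neither the weight nor the power in the barrier is
  disturbed. As the slice moves with z, semiconvexity relates only points of equal height.\<close>

definition tsup :: "'n::finite \<Rightarrow> real \<Rightarrow> (real^'n \<Rightarrow> real) \<Rightarrow> real^'n \<Rightarrow> real" where
  "tsup e k u z = supconv (slice e z) k u z"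

lemma compact_slice:
  fixes e :: "'n::finite"
  shows "compact (slice e z)"
proof -
  have "slice e z = cball 0 1 \<inter> {x. x $ e = z $ e}" unfolding slice_def by auto
  moreover have "closed {x::real^'n. x $ e = z $ e}" by (intro closed_Collect_eq continuous_intros)
  ultimately show ?thesis by (simp add: compact_Int_closed)
qed

lemma tsup_attained:
  assumes u: "continuous_on (cball 0 1) u" and B: "\<And>x. x \<in> cball 0 1 \<Longrightarrow> \<bar>u x\<bar> \<le> B"
    and z: "z \<in> cball 0 1"
  obtains x where "x \<in> cball 0 1" "x $ e = z $ e" "tsup e k u z = u x - k * ((x - z) \<bullet> (x - z))"
    "k * ((x - z) \<bullet> (x - z)) \<le> 2 * B"
proof -
  have zs: "z \<in> slice e z" unfolding slice_def using z by simp
  have us: "continuous_on (slice e z) u" by (rule continuous_on_subset[OF u]) (auto simp: slice_def)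
  obtain x where x: "x \<in> slice e z" "supconv (slice e z) k u z = u x - k * ((x - z) \<bullet> (x - z))"
    "\<And>y. y \<in> slice e z \<Longrightarrow> u y - k * ((y - z) \<bullet> (y - z)) \<le> supconv (slice e z) k u z"
    using supconv_attained[OF compact_slice _ us] zs by blast
  have xc: "x \<in> cball 0 1" "x $ e = z $ e" using x(1) unfolding slice_def by auto
  have "u z \<le> u x - k * ((x - z) \<bullet> (x - z))" using x(2) x(3)[OF zs] by simp
  then have "k * ((x - z) \<bullet> (x - z)) \<le> 2 * B" using B[OF z] B[OF xc(1)] by linarith
  then show ?thesis using that xc x(2) unfolding tsup_def by blast
qed

lemma tsup_ge:
  assumes "continuous_on (cball 0 1) u" "x \<in> cball 0 1" "x $ e = z $ e"
  shows "u x - k * ((x - z) \<bullet> (x - z)) \<le> tsup e k u z"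
  unfolding tsup_def
  by (rule supconv_ge[OF compact_slice continuous_on_subset[OF assms(1)]]) (use assms in \<open>auto simp: slice_def\<close>)

text \<open>A maximiser for the intermediate point competes at both ends, and the convexity defect
  of the squared distance along a segment is exactly t(1-t)|z1-z2|^2.\<close>

lemma tsup_semiconvex:
  assumes u: "continuous_on (cball 0 1) u" and B: "\<And>x. x \<in> cball 0 1 \<Longrightarrow> \<bar>u x\<bar> \<le> B"
    and z: "z1 \<in> cball 0 1" "z2 \<in> cball 0 1" "z1 $ e = z2 $ e" and t: "0 \<le> t" "t \<le> 1"
  shows "tsup e k u ((1 - t) *\<^sub>R z1 + t *\<^sub>R z2)
    \<le> (1 - t) * tsup e k u z1 + t * tsup e k u z2 + k * (t * (1 - t) * ((z1 - z2) \<bullet> (z1 - z2)))"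
proof -
  define z where "z = (1 - t) *\<^sub>R z1 + t *\<^sub>R z2"
  have zc: "z \<in> cball 0 1" unfolding z_def using convexD_alt[OF convex_cball z(1,2) t] .
  have ze: "z $ e = z1 $ e" "z $ e = z2 $ e" unfolding z_def using z(3) by (auto simp: algebra_simps)
  obtain x where x: "x \<in> cball 0 1" "x $ e = z $ e" "tsup e k u z = u x - k * ((x - z) \<bullet> (x - z))"
    using tsup_attained[OF u B zc] by metis
  have "tsup e k u z = (1 - t) * (u x - k * ((x - z1) \<bullet> (x - z1))) + t * (u x - k * ((x - z2) \<bullet> (x - z2)))
     + k * (t * (1 - t) * ((z1 - z2) \<bullet> (z1 - z2)))"
    unfolding x(3) unfolding z_def by (simp add: inner_simps inner_commute algebra_simps)
  also have "\<dots> \<le> (1 - t) * tsup e k u z1 + t * tsup e k u z2 + k * (t * (1 - t) * ((z1 - z2) \<bullet> (z1 - z2)))"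
    using t x(1,2) ze by (intro add_right_mono add_mono mult_left_mono tsup_ge u) auto
  finally show ?thesis unfolding z_def .
qed

text \<open>\<open>M\<^sup>+(D\<^sup>2\<phi>) \<ge> - C |x\<^sub>e| powr (- a)\<close> with the extremal operator spelled out through decompositions of
  the Hessian into positive and negative parts.\<close>

definition pucci_sub :: "'n::finite \<Rightarrow> real \<Rightarrow> real \<Rightarrow> real \<Rightarrow> real \<Rightarrow> real \<Rightarrow> (real^'n \<Rightarrow> real) \<Rightarrow> bool" where
  "pucci_sub e s a lam Lam C u \<longleftrightarrow>
    (\<forall>x0 \<delta> \<phi> H P Q. x0 \<in> ball 0 1 \<and> 0 < s * x0 $ e \<and> 0 < \<delta> \<and> ball x0 \<delta> \<subseteq> ball 0 1 \<and>
       \<phi> x0 = u x0 \<and> (\<forall>y\<in>ball x0 \<delta>. u y \<le> \<phi> y) \<and> C2_with_hessian \<phi> H (ball x0 \<delta>) \<and>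
       psd_mat P \<and> psd_mat Q \<and> H x0 = P - Q
       \<longrightarrow> lam * mat_norm Q \<le> Lam * mat_norm P + C * (s * x0 $ e) powr (- a))"

text \<open>Maximising over pairs of equal height unfolds the sup-convolution, so continuity of u is
  enough. At an interior maximum a tangential translate of the barrier, plus an affine function,
  touches u from above, against the Pucci inequality; \<open>d\<close> keeps the touching point
  inside the ball.\<close>

lemma tsup_barrier_comparison:
  fixes u :: "real^'n \<Rightarrow> real"
  assumes u: "continuous_on (cball 0 1) u" and B: "\<And>x. x \<in> cball 0 1 \<Longrightarrow> \<bar>u x\<bar> \<le> B"
    and k: "0 < k" and d: "2 * B \<le> k * d\<^sup>2" "0 \<le> d"
    and sub: "pucci_sub e s a lam Lam C u" and s: "s\<^sup>2 = 1" and a: "a < 1"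
    and lam: "0 < lam" "0 \<le> Lam" and K: "0 \<le> K" "C < lam * (K * (2 - a) * (1 - a))"
    and zh: "zh $ e = 0" and room: "0 \<le> r0" "norm zh + r0 + d < 1"
    and A: "0 \<le> A" and \<rho>: "\<rho>\<^sup>2 + L\<^sup>2 \<le> r0\<^sup>2"
    and bdry: "\<And>h. \<lbrakk>0 \<le> s * h $ e; s * h $ e \<le> \<rho>; tsq e h \<le> L\<^sup>2; s * h $ e = 0 \<or> s * h $ e = \<rho> \<or> tsq e h = L\<^sup>2\<rbrakk>
           \<Longrightarrow> tsup e k u (zh + h) \<le> c + p \<bullet> h + barrier e s a (Lam / lam) K b A h"
    and h0: "0 \<le> s * h0 $ e" "s * h0 $ e \<le> \<rho>" "tsq e h0 \<le> L\<^sup>2"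
  shows "tsup e k u (zh + h0) \<le> c + p \<bullet> h0 + barrier e s a (Lam / lam) K b A h0"
proof (rule ccontr)
  define \<phi> where "\<phi> h = c + p \<bullet> h + barrier e s a (Lam / lam) K b A h" for h
  define Cyl where "Cyl = {h. 0 \<le> s * h $ e \<and> s * h $ e \<le> \<rho> \<and> tsq e h \<le> L\<^sup>2}"
  define Z where "Z = (cball 0 1 \<times> Cyl) \<inter> {w. fst w $ e = snd w $ e}"
  define f where "f w = u (fst w) - k * ((fst w - (zh + snd w)) \<bullet> (fst w - (zh + snd w))) - \<phi> (snd w)" for w
  assume "\<not> ?thesis"
  then have neg: "\<phi> h0 < tsup e k u (zh + h0)" unfolding \<phi>_def by simp
  have nC: "norm h \<le> r0" if "h \<in> Cyl" for h
    using norm_le_of_cylinder[OF s _ _ _ \<rho> room(1)] that unfolding Cyl_def by auto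
  have zC: "zh + h \<in> cball 0 1" "norm (zh + h) + d < 1" if "h \<in> Cyl" for h
    using nC[OF that] room norm_triangle_ineq[of zh h] d(2) by auto
  have Cclosed: "closed Cyl"
  proof -
    have "Cyl = {h. 0 \<le> s * h $ e} \<inter> {h. s * h $ e \<le> \<rho>} \<inter> {h. tsq e h \<le> L\<^sup>2}" unfolding Cyl_def by auto
    then show ?thesis unfolding tsq_def by (auto intro!: closed_Int closed_Collect_le continuous_intros)
  qed
  have Ccomp: "compact Cyl"
    using nC Cclosed by (auto simp: compact_eq_bounded_closed bounded_iff)
  have Zcomp: "compact Z"
    unfolding Z_def by (intro compact_Int_closed compact_Times compact_cball Ccomp closed_Collect_eq continuous_intros)
  have fcont: "continuous_on Z f"
  proof -
    define pw where "pw h = (s * h $ e) powr (2 - a)" for h :: "real^'n"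
    have "continuous_on Cyl pw"
      unfolding pw_def by (rule continuous_on_powr') (use a in \<open>auto simp: Cyl_def intro!: continuous_intros\<close>)
    then have "continuous_on Cyl \<phi>"
      unfolding \<phi>_def barrier_def tsq_def pw_def[symmetric] by (intro continuous_intros)
    then have "continuous_on Z (\<lambda>w. \<phi> (snd w))"
      by (rule continuous_on_compose2) (auto simp: Z_def intro!: continuous_intros)
    moreover have "continuous_on Z (\<lambda>w. u (fst w))"
      by (rule continuous_on_compose2[OF u]) (auto simp: Z_def intro!: continuous_intros)
    ultimately show ?thesis unfolding f_def by (intro continuous_intros)
  qed
  have h0C: "h0 \<in> Cyl" unfolding Cyl_def using h0 by simp
  obtain x1 where x1: "x1 \<in> cball 0 1" "x1 $ e = (zh + h0) $ e"
    "tsup e k u (zh + h0) = u x1 - k * ((x1 - (zh + h0)) \<bullet> (x1 - (zh + h0)))"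
    using tsup_attained[OF u B zC(1)[OF h0C]] by metis
  have x1Z: "(x1, h0) \<in> Z" unfolding Z_def using x1 h0C zh by simp
  then have "Z \<noteq> {}" by auto
  then obtain w where w: "w \<in> Z" "\<And>w'. w' \<in> Z \<Longrightarrow> f w' \<le> f w"
    using continuous_attains_sup[OF Zcomp _ fcont] by blast
  define x h where "x = fst w" and "h = snd w"
  have x: "x \<in> cball 0 1" "x $ e = h $ e" and hC: "h \<in> Cyl" using w(1) unfolding Z_def x_def h_def by auto
  have max: "f (y, h') \<le> f (x, h)" if "y \<in> cball 0 1" "h' \<in> Cyl" "y $ e = h' $ e" for y h'
    using w(2)[of "(y, h')"] that unfolding Z_def x_def h_def by simp
  have fpos: "0 < f (x, h)"
    using max[of x1 h0] x1 h0C zh neg unfolding f_def by simp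
  have "u x - k * ((x - (zh + h)) \<bullet> (x - (zh + h))) \<le> tsup e k u (zh + h)"
    by (rule tsup_ge[OF u x(1)]) (use x(2) zh in simp)
  then have big: "\<phi> h < tsup e k u (zh + h)" using fpos unfolding f_def by simp
  have nb: "\<not> (s * h $ e = 0 \<or> s * h $ e = \<rho> \<or> tsq e h = L\<^sup>2)"
    using bdry[of h] hC big unfolding Cyl_def \<phi>_def by auto
  define O' where "O' = {h. 0 < s * h $ e} \<inter> {h. s * h $ e < \<rho>} \<inter> {h. tsq e h < L\<^sup>2}"
  have hO: "h \<in> O'" using nb hC unfolding O'_def Cyl_def Int_iff mem_Collect_eq by argo
  have "open O'" unfolding O'_def tsq_def by (intro open_Int open_Collect_less continuous_intros)
  then obtain \<delta>1 where \<delta>1: "0 < \<delta>1" "ball h \<delta>1 \<subseteq> O'" using hO openE by blast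
  have OC: "O' \<subseteq> Cyl" unfolding O'_def Cyl_def by auto
  have "f (zh + h, h) \<le> f (x, h)" using max[of "zh + h" h] zC[OF hC] hC zh by simp
  then have "k * ((x - (zh + h)) \<bullet> (x - (zh + h))) \<le> k * d\<^sup>2"
    using B[OF x(1)] B[OF zC(1)[OF hC]] d(1) unfolding f_def by simp
  then have "norm (x - (zh + h)) \<le> d" using k d(2) by (simp add: power2_norm_eq_inner[symmetric])
  then have nx: "norm x < 1" using zC(2)[OF hC] norm_triangle_ineq[of "zh + h" "x - (zh + h)"] by simp
  define \<delta> where "\<delta> = min \<delta>1 (1 - norm x)"
  have \<delta>: "0 < \<delta>" unfolding \<delta>_def using \<delta>1 nx by simp
  have sub1: "ball x \<delta> \<subseteq> ball 0 1"
  proof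
    fix y assume "y \<in> ball x \<delta>"
    then have "norm (y - x) < 1 - norm x" unfolding \<delta>_def by (simp add: dist_norm norm_minus_commute)
    then show "y \<in> ball 0 1" using norm_triangle_ineq[of x "y - x"] by simp
  qed
  have yO: "y - (x - h) \<in> O'" if "y \<in> ball x \<delta>" for y
  proof -
    have "dist h (y - (x - h)) = dist x y" by (simp add: dist_norm)
    then show ?thesis using that \<delta>1(2) unfolding \<delta>_def by auto
  qed
  \<comment> \<open>The shift x - h is tangential because x and h have equal height, so the power
    keeps its base; moving y and h' together leaves the penalty constant.\<close>
  define \<psi> where "\<psi> y = (u x - \<phi> h + c - p \<bullet> (x - h)) + p \<bullet> y + barrier e s a (Lam / lam) K b A (y - (x - h))" for y
  have psi: "\<psi> y = u x - \<phi> h + \<phi> (y - (x - h))" for y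
    unfolding \<psi>_def \<phi>_def by (simp add: inner_diff_right)
  define Hb where "Hb h = (2 * A) *\<^sub>R (mat 1 - ecoord e) - (2 * (Lam / lam) * A + K * (2 - a) * (1 - a) * (s * h $ e) powr (- a)) *\<^sub>R ecoord e" for h :: "real^'n"
  have C2: "C2_with_hessian \<psi> (\<lambda>y. Hb (y - (x - h))) (ball x \<delta>)"
    unfolding \<psi>_def Hb_def
    by (rule C2_with_hessian_translate[OF C2_barrier[OF s]]) (use yO in \<open>auto simp: O'_def\<close>)
  have touch: "u y \<le> \<psi> y" if y: "y \<in> ball x \<delta>" for y
  proof -
    define h' where "h' = y - (x - h)"
    have "h' \<in> Cyl" using yO[OF y] OC unfolding h'_def by auto
    moreover have "y \<in> cball 0 1" using sub1 y by auto
    moreover have "y $ e = h' $ e" unfolding h'_def using x(2) by simp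
    ultimately have "f (y, h') \<le> f (x, h)" by (intro max)
    moreover have "y - (zh + h') = x - (zh + h)" unfolding h'_def by simp
    ultimately show ?thesis unfolding psi f_def h'_def[symmetric] by simp
  qed
  define t where "t = s * h $ e"
  have t: "0 < t" using hO unfolding O'_def t_def by simp
  define q where "q = 2 * (Lam / lam) * A + K * (2 - a) * (1 - a) * t powr (- a)"
  have q0: "0 \<le> q" unfolding q_def using lam A K(1) a by simp
  have "lam * mat_norm (q *\<^sub>R ecoord e) \<le> Lam * mat_norm ((2 * A) *\<^sub>R (mat 1 - ecoord e)) + C * t powr (- a)"
  proof -
    have "x \<in> ball 0 1" "0 < s * x $ e" "\<psi> x = u x" "Hb (x - (x - h)) = (2 * A) *\<^sub>R (mat 1 - ecoord e) - q *\<^sub>R ecoord e"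
      using nx t x(2) unfolding t_def psi Hb_def q_def by auto
    moreover have "psd_mat ((2 * A) *\<^sub>R (mat 1 - ecoord e))" "psd_mat (q *\<^sub>R ecoord e)"
      using A q0 by (auto intro: psd_scaled_tangential psd_scaled_ecoord)
    ultimately show ?thesis
      using sub[unfolded pucci_sub_def, rule_format, of x \<delta> \<psi> "\<lambda>y. Hb (y - (x - h))"] \<delta> sub1 touch C2 x(2)
      unfolding t_def by metis
  qed
  moreover have "lam * q \<le> lam * mat_norm (q *\<^sub>R ecoord e)"
    using lam by (intro mult_left_mono mat_norm_scaled_ecoord_ge q0) auto
  moreover have "Lam * mat_norm ((2 * A) *\<^sub>R (mat 1 - ecoord e)) \<le> Lam * (2 * A)"
    using lam A by (intro mult_left_mono mat_norm_scaled_tangential_le) auto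
  ultimately have "lam * q \<le> Lam * (2 * A) + C * t powr (- a)" by linarith
  \<comment> \<open>The factor Lam/lam cancels the contribution of \<open>A\<close>; what remains
    contradicts the choice of \<open>K\<close>.\<close>
  moreover have "lam * q = Lam * (2 * A) + lam * (K * (2 - a) * (1 - a)) * t powr (- a)"
    unfolding q_def using lam(1) by (simp add: distrib_left)
  ultimately have "lam * (K * (2 - a) * (1 - a)) * t powr (- a) \<le> C * t powr (- a)" by linarith
  then show False using K(2) t by simp
qed

text \<open>Only \<open>flat\<close>, the expansion along the interface, is special to the contact
  point; the other clauses of \<open>one_sided\<close> hold at any base point with enough
  room.\<close>

lemma tsup_one_sided:
  fixes u :: "real^'n \<Rightarrow> real"
  assumes u: "continuous_on (cball 0 1) u" and B: "\<And>x. x \<in> cball 0 1 \<Longrightarrow> \<bar>u x\<bar> \<le> B"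
    and k: "0 < k" and d: "2 * B \<le> k * d\<^sup>2" "0 \<le> d"
    and sub: "pucci_sub e s a lam Lam C u" and s: "s\<^sup>2 = 1" and a: "a < 1"
    and lam: "0 < lam" "0 \<le> Lam" and K: "0 \<le> K" "C < lam * (K * (2 - a) * (1 - a))"
    and zh: "zh $ e = 0" and room: "0 \<le> r0" "norm zh + r0 + d < 1"
    and flat: "\<And>z. z \<in> cball 0 1 \<Longrightarrow> z $ e = 0 \<Longrightarrow>
      tsup e k u z \<le> tsup e k u zh + p \<bullet> (z - zh) + k * ((z - zh) \<bullet> (z - zh))"
  shows "one_sided e s a (Lam / lam) K k r0 (2 * B + norm p * r0) (\<lambda>h. tsup e k u (zh + h) - tsup e k u zh - p \<bullet> h)"
  unfolding one_sided_def
proof (intro conjI allI impI; (elim conjE)?)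
  fix A b \<rho> L h
  assume A: "0 \<le> A" and \<rho>: "0 < \<rho>" "0 < L" "\<rho>\<^sup>2 + L\<^sup>2 \<le> r0\<^sup>2"
    and bd: "\<forall>h. 0 \<le> s * h $ e \<and> s * h $ e \<le> \<rho> \<and> tsq e h \<le> L\<^sup>2 \<and> (s * h $ e = 0 \<or> s * h $ e = \<rho> \<or> tsq e h = L\<^sup>2)
           \<longrightarrow> tsup e k u (zh + h) - tsup e k u zh - p \<bullet> h \<le> barrier e s a (Lam / lam) K b A h"
    and h: "0 \<le> s * h $ e" "s * h $ e \<le> \<rho>" "tsq e h \<le> L\<^sup>2"
  have "tsup e k u (zh + h) \<le> tsup e k u zh + p \<bullet> h + barrier e s a (Lam / lam) K b A h"
    by (rule tsup_barrier_comparison[OF u B k d sub s a lam K zh room A \<rho>(3) _ h])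
      (use bd in \<open>force simp: algebra_simps\<close>)+
  then show "tsup e k u (zh + h) - tsup e k u zh - p \<bullet> h \<le> barrier e s a (Lam / lam) K b A h" by simp
next
  have in1: "zh + h \<in> cball 0 1" if "norm h \<le> r0" for h
    using that room(2) d(2) norm_triangle_ineq[of zh h] by simp
  { fix h :: "real^'n" assume h: "norm h \<le> r0" "h $ e = 0"
    show "tsup e k u (zh + h) - tsup e k u zh - p \<bullet> h \<le> k * tsq e h"
      using flat[OF in1[OF h(1)]] h(2) zh by (simp add: tsq_def) }
  { fix h :: "real^'n" assume h: "norm h \<le> r0"
    obtain x where x: "x \<in> cball 0 1" "tsup e k u (zh + h) = u x - k * ((x - (zh + h)) \<bullet> (x - (zh + h)))"
      using tsup_attained[OF u B in1[OF h]] by metis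
    have "0 \<le> k * ((x - (zh + h)) \<bullet> (x - (zh + h)))" using k by simp
    then have 1: "tsup e k u (zh + h) \<le> B" using x(2) B[OF x(1)] by simp
    have z0: "zh \<in> cball 0 1" using in1[of 0] room(1) by simp
    have "u zh \<le> tsup e k u zh" using tsup_ge[OF u z0 refl, where k=k and e=e] by simp
    then have 2: "- B \<le> tsup e k u zh" using B[OF z0] by linarith
    have "\<bar>p \<bullet> h\<bar> \<le> norm p * norm h" by (rule Cauchy_Schwarz_ineq2)
    also have "\<dots> \<le> norm p * r0" using h by (intro mult_left_mono) auto
    finally show "tsup e k u (zh + h) - tsup e k u zh - p \<bullet> h \<le> 2 * B + norm p * r0" using 1 2 by linarith }
  { fix h1 h2 :: "real^'n" and t :: real
    assume h: "norm h1 \<le> r0" "norm h2 \<le> r0" "h1 $ e = h2 $ e" and t: "0 \<le> t" "t \<le> 1"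
    have e1: "(1 - t) *\<^sub>R (zh + h1) + t *\<^sub>R (zh + h2) = zh + ((1 - t) *\<^sub>R h1 + t *\<^sub>R h2)"
      by (simp add: algebra_simps)
    have he: "(zh + h1) $ e = (zh + h2) $ e" using h(3) by simp
    have "p \<bullet> ((1 - t) *\<^sub>R h1 + t *\<^sub>R h2) = (1 - t) * (p \<bullet> h1) + t * (p \<bullet> h2)" by (simp add: inner_simps)
    then show "tsup e k u (zh + ((1 - t) *\<^sub>R h1 + t *\<^sub>R h2)) - tsup e k u zh - p \<bullet> ((1 - t) *\<^sub>R h1 + t *\<^sub>R h2)
      \<le> (1 - t) * (tsup e k u (zh + h1) - tsup e k u zh - p \<bullet> h1) + t * (tsup e k u (zh + h2) - tsup e k u zh - p \<bullet> h2)
        + k * (t * (1 - t) * ((h1 - h2) \<bullet> (h1 - h2)))"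
      using tsup_semiconvex[OF u B in1[OF h(1)] in1[OF h(2)] he t, where k=k, unfolded e1]
      by (simp add: algebra_simps) }
qed

section \<open>The equation on one side of the interface\<close>

text \<open>Ellipticity constrains F on symmetric matrices only, hence the symmetry clause on the
  test Hessian. The sign s covers both sides in one definition.\<close>

definition side_sub :: "'n::finite \<Rightarrow> real \<Rightarrow> real \<Rightarrow> (real^'n^'n \<Rightarrow> real) \<Rightarrow> (real^'n \<Rightarrow> real) \<Rightarrow> (real^'n \<Rightarrow> real) \<Rightarrow> bool" where
  "side_sub e s a F f u \<longleftrightarrow>
    (\<forall>x0 \<delta> \<phi> H. x0 \<in> ball 0 1 \<and> 0 < s * x0 $ e \<and> 0 < \<delta> \<and> ball x0 \<delta> \<subseteq> ball 0 1 \<and>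
       \<phi> x0 = u x0 \<and> (\<forall>y\<in>ball x0 \<delta>. u y \<le> \<phi> y) \<and> C2_with_hessian \<phi> H (ball x0 \<delta>) \<and> symmetric_mat (H x0)
       \<longrightarrow> f x0 \<le> weight a e x0 * F (H x0))"

text \<open>Testing is restricted to one explicit family. \<open>c1\<close> and \<open>c2\<close>
  are slopes pointing away from the interface on either side, so the jump of the normal derivative
  is their sum; \<open>A\<close> does not enter the conclusion.\<close>

definition jump_sub :: "'n::finite \<Rightarrow> (real^'n \<Rightarrow> real) \<Rightarrow> (real^'n \<Rightarrow> real) \<Rightarrow> bool" where
  "jump_sub e g u \<longleftrightarrow>
    (\<forall>x0 r q c1 c2 A. x0 \<in> Tflat e \<and> 0 < r \<and> ball x0 r \<subseteq> ball 0 1 \<and>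
       (\<forall>h. norm h < r \<longrightarrow> (0 \<le> h $ e \<longrightarrow> u (x0 + h) \<le> u x0 + q \<bullet> h + c1 * (h $ e) + A * tsq e h) \<and>
                           (h $ e \<le> 0 \<longrightarrow> u (x0 + h) \<le> u x0 + q \<bullet> h - c2 * (h $ e) + A * tsq e h))
       \<longrightarrow> g x0 \<le> c1 + c2)"

text \<open>If v is a supersolution for F, then -v is a subsolution for this operator, with the same
  ellipticity constants, so only subsolutions have to be treated.\<close>

definition dual_op :: "(real^'n^'n \<Rightarrow> real) \<Rightarrow> real^'n^'n \<Rightarrow> real" where
  "dual_op F M = - F (- M)"

lemma uniformly_elliptic_dual:
  fixes F :: "real^'n^'n \<Rightarrow> real"
  assumes "uniformly_elliptic lam Lam F"
  shows "uniformly_elliptic lam Lam (dual_op F)"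
  unfolding uniformly_elliptic_def
proof (intro allI impI)
  fix M N :: "real^'n^'n" assume MN: "symmetric_mat M \<and> psd_mat N"
  then have "symmetric_mat (- (M + N))"
    unfolding psd_mat_def by (intro symmetric_mat_simps) auto
  then show "lam * mat_norm N \<le> dual_op F (M + N) - dual_op F M \<and> dual_op F (M + N) - dual_op F M \<le> Lam * mat_norm N"
    using assms[unfolded uniformly_elliptic_def, rule_format, of "- (M + N)" N] MN
    unfolding dual_op_def by simp
qed

section \<open>From viscosity sub- and supersolutions to the one-sided conditions\<close>

lemma matrix_vector_uminus: "(- (A::real^'n^'m)) *v x = - (A *v x)"
  by (simp add: matrix_vector_mult_def vec_eq_iff sum_negf)

lemma C2_with_hessian_uminus:
  assumes "C2_with_hessian \<phi> H S"
  shows "C2_with_hessian (\<lambda>y. - \<phi> y) (\<lambda>y. - H y) S"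
proof -
  obtain G where G: "\<And>y. y \<in> S \<Longrightarrow> (\<phi> has_derivative (\<lambda>h. G y \<bullet> h)) (at y)"
      "\<And>y. y \<in> S \<Longrightarrow> (G has_derivative (\<lambda>h. H y *v h)) (at y)" "continuous_on S H"
    using assms unfolding C2_with_hessian_def by blast
  show ?thesis
    unfolding C2_with_hessian_def
  proof (intro exI[of _ "\<lambda>y. - G y"] conjI ballI)
    fix y assume y: "y \<in> S"
    have e: "(\<lambda>h. - G y \<bullet> h) = (\<lambda>h. - (G y \<bullet> h))" "(\<lambda>h. - H y *v h) = (\<lambda>h. - (H y *v h))"
      by (auto simp: fun_eq_iff matrix_vector_uminus)
    show "((\<lambda>y. - \<phi> y) has_derivative (\<lambda>h. - G y \<bullet> h)) (at y)"
      unfolding e by (rule has_derivative_minus[OF G(1)[OF y]])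
    show "((\<lambda>y. - G y) has_derivative (\<lambda>h. - H y *v h)) (at y)"
      unfolding e by (rule has_derivative_minus[OF G(2)[OF y]])
  next
    show "continuous_on S (\<lambda>y. - H y)" by (intro continuous_intros G(3))
  qed
qed

lemma C2_with_hessian_add:
  assumes "C2_with_hessian \<phi> H S" "C2_with_hessian \<psi> J S"
  shows "C2_with_hessian (\<lambda>y. \<phi> y + \<psi> y) (\<lambda>y. H y + J y) S"
proof -
  obtain G where G: "\<And>y. y \<in> S \<Longrightarrow> (\<phi> has_derivative (\<lambda>h. G y \<bullet> h)) (at y)"
      "\<And>y. y \<in> S \<Longrightarrow> (G has_derivative (\<lambda>h. H y *v h)) (at y)" "continuous_on S H"
    using assms(1) unfolding C2_with_hessian_def by blast
  obtain G' where G': "\<And>y. y \<in> S \<Longrightarrow> (\<psi> has_derivative (\<lambda>h. G' y \<bullet> h)) (at y)"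
      "\<And>y. y \<in> S \<Longrightarrow> (G' has_derivative (\<lambda>h. J y *v h)) (at y)" "continuous_on S J"
    using assms(2) unfolding C2_with_hessian_def by blast
  show ?thesis
    unfolding C2_with_hessian_def
  proof (intro exI[of _ "\<lambda>y. G y + G' y"] conjI ballI)
    fix y assume y: "y \<in> S"
    have e: "(\<lambda>h. (G y + G' y) \<bullet> h) = (\<lambda>h. G y \<bullet> h + G' y \<bullet> h)" "(\<lambda>h. (H y + J y) *v h) = (\<lambda>h. H y *v h + J y *v h)"
      by (auto simp: fun_eq_iff inner_add_left matrix_vector_mult_add_rdistrib)
    show "((\<lambda>y. \<phi> y + \<psi> y) has_derivative (\<lambda>h. (G y + G' y) \<bullet> h)) (at y)"
      unfolding e by (rule has_derivative_add[OF G(1)[OF y] G'(1)[OF y]])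
    show "((\<lambda>y. G y + G' y) has_derivative (\<lambda>h. (H y + J y) *v h)) (at y)"
      unfolding e by (rule has_derivative_add[OF G(2)[OF y] G'(2)[OF y]])
  next
    show "continuous_on S (\<lambda>y. H y + J y)" by (intro continuous_intros G(3) G'(3))
  qed
qed

lemma C2_with_hessian_subset:
  "C2_with_hessian \<phi> H S \<Longrightarrow> S' \<subseteq> S \<Longrightarrow> C2_with_hessian \<phi> H S'"
  unfolding C2_with_hessian_def by (meson continuous_on_subset subset_iff)

lemma C2_quadratic:
  fixes X :: "real^'n^'n"
  assumes "symmetric_mat X"
  shows "C2_with_hessian (\<lambda>h. (1/2) * (h \<bullet> (X *v h))) (\<lambda>_. X) S"
  unfolding C2_with_hessian_def
proof (intro exI[of _ "\<lambda>h. X *v h"] conjI ballI)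
  fix y :: "real^'n"
  have X: "((\<lambda>h. X *v h) has_derivative (\<lambda>h. X *v h)) (at y)"
    by (rule bounded_linear_imp_has_derivative[OF matrix_vector_mul_bounded_linear])
  then show "((\<lambda>h. X *v h) has_derivative (\<lambda>h. X *v h)) (at y)" .
  have "((\<lambda>h. (1/2) * (h \<bullet> (X *v h))) has_derivative (\<lambda>h. (1/2) * (y \<bullet> (X *v h) + h \<bullet> (X *v y)))) (at y)"
    by (intro has_derivative_mult_right has_derivative_inner has_derivative_ident X)
  also have "(\<lambda>h. (1/2) * (y \<bullet> (X *v h) + h \<bullet> (X *v y))) = (\<lambda>h. (X *v y) \<bullet> h)"
  proof
    fix h :: "real^'n"
    show "(1/2) * (y \<bullet> (X *v h) + h \<bullet> (X *v y)) = (X *v y) \<bullet> h"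
      using symmetric_mat_inner[OF assms, of y h] inner_commute[of h "X *v y"] by simp
  qed
  finally show "((\<lambda>h. (1/2) * (h \<bullet> (X *v h))) has_derivative (\<lambda>h. (X *v y) \<bullet> h)) (at y)" .
qed (rule continuous_on_const)

lemma side_sub_of_subsolution:
  assumes "viscosity_subsolution a e Fp Fm fp fm g u"
  shows "side_sub e 1 a Fp fp u" "side_sub e (- 1) a Fm fm u"
proof -
  note a = assms[unfolded viscosity_subsolution_def]
  note a1 = conjunct1[OF a] and a2 = conjunct1[OF conjunct2[OF a]]
  show "side_sub e 1 a Fp fp u"
    unfolding side_sub_def
  proof (intro allI impI; elim conjE)
    fix x0 \<delta> \<phi> H
    assume 1: "x0 \<in> ball 0 1" "0 < 1 * x0 $ e" "0 < \<delta>" "ball x0 \<delta> \<subseteq> ball 0 1"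
      and 2: "\<phi> x0 = u x0" "\<forall>y\<in>ball x0 \<delta>. u y \<le> \<phi> y" "C2_with_hessian \<phi> H (ball x0 \<delta>)"
    have "x0 \<in> Bplus e" using 1(1,2) unfolding Bplus_def by simp
    then show "fp x0 \<le> weight a e x0 * Fp (H x0)"
      using a1[rule_format, of x0 \<delta> \<phi> H] 1 2 by blast
  qed
  show "side_sub e (- 1) a Fm fm u"
    unfolding side_sub_def
  proof (intro allI impI; elim conjE)
    fix x0 \<delta> \<phi> H
    assume 1: "x0 \<in> ball 0 1" "0 < - 1 * x0 $ e" "0 < \<delta>" "ball x0 \<delta> \<subseteq> ball 0 1"
      and 2: "\<phi> x0 = u x0" "\<forall>y\<in>ball x0 \<delta>. u y \<le> \<phi> y" "C2_with_hessian \<phi> H (ball x0 \<delta>)"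
    have "x0 \<in> Bminus e" using 1(1,2) unfolding Bminus_def by simp
    then show "fm x0 \<le> weight a e x0 * Fm (H x0)"
      using a2[rule_format, of x0 \<delta> \<phi> H] 1 2 by blast
  qed
qed

lemma side_sub_of_supersolution:
  assumes "viscosity_supersolution a e Fp Fm fp fm g v"
  shows "side_sub e 1 a (dual_op Fp) (\<lambda>x. - fp x) (\<lambda>x. - v x)"
    "side_sub e (- 1) a (dual_op Fm) (\<lambda>x. - fm x) (\<lambda>x. - v x)"
proof -
  have *: "\<lbrakk>\<phi> x0 = - v x0; \<forall>y\<in>B. - v y \<le> \<phi> y; C2_with_hessian \<phi> H B\<rbrakk> \<Longrightarrow>
      - \<phi> x0 = v x0 \<and> (\<forall>y\<in>B. - \<phi> y \<le> v y) \<and> C2_with_hessian (\<lambda>y. - \<phi> y) (\<lambda>y. - H y) B"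
    for \<phi> H x0 B by (force intro: C2_with_hessian_uminus)
  note a = assms[unfolded viscosity_supersolution_def]
  show "side_sub e 1 a (dual_op Fp) (\<lambda>x. - fp x) (\<lambda>x. - v x)"
    unfolding side_sub_def dual_op_def
  proof (intro allI impI; elim conjE)
    fix x0 \<delta> \<phi> H
    assume 1: "x0 \<in> ball 0 1" "0 < 1 * x0 $ e" "0 < \<delta>" "ball x0 \<delta> \<subseteq> ball 0 1"
      and 2: "\<phi> x0 = - v x0" "\<forall>y\<in>ball x0 \<delta>. - v y \<le> \<phi> y" "C2_with_hessian \<phi> H (ball x0 \<delta>)"
    show "- fp x0 \<le> weight a e x0 * - Fp (- H x0)"
      using conjunct1[OF a, rule_format, of x0 \<delta> "\<lambda>y. - \<phi> y" "\<lambda>y. - H y"] 1 *[OF 2]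
      unfolding Bplus_def by auto
  qed
  show "side_sub e (- 1) a (dual_op Fm) (\<lambda>x. - fm x) (\<lambda>x. - v x)"
    unfolding side_sub_def dual_op_def
  proof (intro allI impI; elim conjE)
    fix x0 \<delta> \<phi> H
    assume 1: "x0 \<in> ball 0 1" "0 < - 1 * x0 $ e" "0 < \<delta>" "ball x0 \<delta> \<subseteq> ball 0 1"
      and 2: "\<phi> x0 = - v x0" "\<forall>y\<in>ball x0 \<delta>. - v y \<le> \<phi> y" "C2_with_hessian \<phi> H (ball x0 \<delta>)"
    show "- fm x0 \<le> weight a e x0 * - Fm (- H x0)"
      using conjunct1[OF conjunct2[OF a], rule_format, of x0 \<delta> "\<lambda>y. - \<phi> y" "\<lambda>y. - H y"] 1 *[OF 2]
      unfolding Bminus_def by auto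
  qed
qed

text \<open>On each closed side this is a polynomial of degree at most two, hence C^1 up to the
  interface, with normal derivatives q_e + c1 and q_e - c2.\<close>

definition wedge :: "'n::finite \<Rightarrow> real^'n \<Rightarrow> real \<Rightarrow> real^'n \<Rightarrow> real \<Rightarrow> real \<Rightarrow> real \<Rightarrow> real^'n \<Rightarrow> real" where
  "wedge e x0 c q c1 c2 A y = c + q \<bullet> (y - x0) + (if 0 \<le> y $ e then c1 * (y $ e) else - c2 * (y $ e)) + A * tsq e (y - x0)"

lemma C1_upto_affine_tangential:
  fixes x0 :: "real^'n"
  assumes "\<And>y. y \<in> K \<Longrightarrow> \<phi> y = c + q \<bullet> (y - x0) + c1 * (y $ e) + A * tsq e (y - x0)"
  shows "C1_upto_with_grad \<phi> (\<lambda>y. q + c1 *\<^sub>R axis e 1 + (2 * A) *\<^sub>R ((y - x0) - ((y - x0) $ e) *\<^sub>R axis e 1)) K"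
  unfolding C1_upto_with_grad_def
proof (intro conjI ballI)
  fix y assume y: "y \<in> K"
  have D: "((\<lambda>y. c + q \<bullet> (y - x0) + c1 * (y $ e) + A * tsq e (y - x0)) has_derivative
      (\<lambda>h. q \<bullet> h + c1 * (h $ e) + A * (2 * ((y - x0) \<bullet> h) - 2 * ((y - x0) $ e * h $ e)))) (at y within K)"
    unfolding tsq_def power2_eq_square
    by (auto intro!: derivative_eq_intros has_derivative_vec_nth simp: inner_commute fun_eq_iff algebra_simps)
  have "(\<phi> has_derivative (\<lambda>h. q \<bullet> h + c1 * (h $ e) + A * (2 * ((y - x0) \<bullet> h) - 2 * ((y - x0) $ e * h $ e)))) (at y within K)"
    by (rule has_derivative_transform[OF y _ D]) (rule assms)
  also have "(\<lambda>h. q \<bullet> h + c1 * (h $ e) + A * (2 * ((y - x0) \<bullet> h) - 2 * ((y - x0) $ e * h $ e)))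
     = (\<lambda>h. (q + c1 *\<^sub>R axis e 1 + (2 * A) *\<^sub>R ((y - x0) - ((y - x0) $ e) *\<^sub>R axis e 1)) \<bullet> h)"
    by (simp add: fun_eq_iff inner_add_left inner_diff_left inner_axis' algebra_simps)
  finally show "(\<phi> has_derivative (\<lambda>h. (q + c1 *\<^sub>R axis e 1 + (2 * A) *\<^sub>R ((y - x0) - ((y - x0) $ e) *\<^sub>R axis e 1)) \<bullet> h)) (at y within K)" .
qed (intro continuous_intros)

lemma wedge_C1:
  fixes x0 :: "real^'n" and q :: "real^'n"
  assumes x0: "x0 $ e = 0"
  obtains Gp Gm where "C1_upto_with_grad (wedge e x0 c q c1 c2 A) Gp {y \<in> cball x0 r. 0 \<le> y $ e}"
    "C1_upto_with_grad (wedge e x0 c q c1 c2 A) Gm {y \<in> cball x0 r. y $ e \<le> 0}"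
    "Gp x0 $ e - Gm x0 $ e = c1 + c2"
proof
  show "C1_upto_with_grad (wedge e x0 c q c1 c2 A) (\<lambda>y. q + c1 *\<^sub>R axis e 1 + (2 * A) *\<^sub>R ((y - x0) - ((y - x0) $ e) *\<^sub>R axis e 1)) {y \<in> cball x0 r. 0 \<le> y $ e}"
    by (rule C1_upto_affine_tangential) (simp add: wedge_def)
  show "C1_upto_with_grad (wedge e x0 c q c1 c2 A) (\<lambda>y. q + (- c2) *\<^sub>R axis e 1 + (2 * A) *\<^sub>R ((y - x0) - ((y - x0) $ e) *\<^sub>R axis e 1)) {y \<in> cball x0 r. y $ e \<le> 0}"
    by (rule C1_upto_affine_tangential) (auto simp: wedge_def)
qed simp

lemma C1_upto_uminus:
  "C1_upto_with_grad \<phi> G K \<Longrightarrow> C1_upto_with_grad (\<lambda>y. - \<phi> y) (\<lambda>y. - G y) K"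
  unfolding C1_upto_with_grad_def
proof (elim conjE, intro conjI ballI)
  fix y assume 1: "\<forall>y\<in>K. (\<phi> has_derivative (\<lambda>h. G y \<bullet> h)) (at y within K)" and y: "y \<in> K"
  have e: "(\<lambda>h. - G y \<bullet> h) = (\<lambda>h. - (G y \<bullet> h))" by (simp add: fun_eq_iff)
  show "((\<lambda>y. - \<phi> y) has_derivative (\<lambda>h. - G y \<bullet> h)) (at y within K)"
    unfolding e by (rule has_derivative_minus) (use 1 y in blast)
qed (intro continuous_intros)

lemma wedge_touch:
  assumes x0: "x0 \<in> Tflat e"
    and h: "\<forall>h. norm h < r \<longrightarrow> (0 \<le> h $ e \<longrightarrow> u (x0 + h) \<le> u x0 + q \<bullet> h + c1 * (h $ e) + A * tsq e h) \<and>
                           (h $ e \<le> 0 \<longrightarrow> u (x0 + h) \<le> u x0 + q \<bullet> h - c2 * (h $ e) + A * tsq e h)"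
  shows "wedge e x0 (u x0) q c1 c2 A x0 = u x0" "\<forall>y\<in>ball x0 r. u y \<le> wedge e x0 (u x0) q c1 c2 A y"
proof -
  have x0e: "x0 $ e = 0" using x0 unfolding Tflat_def by simp
  then show "wedge e x0 (u x0) q c1 c2 A x0 = u x0" unfolding wedge_def tsq_def by simp
  show "\<forall>y\<in>ball x0 r. u y \<le> wedge e x0 (u x0) q c1 c2 A y"
  proof
    fix y assume "y \<in> ball x0 r"
    then have "norm (y - x0) < r" by (simp add: dist_norm norm_minus_commute)
    from h[rule_format, OF this] show "u y \<le> wedge e x0 (u x0) q c1 c2 A y"
      unfolding wedge_def using x0e by auto
  qed
qed

lemma jump_sub_of_subsolution:
  assumes "viscosity_subsolution a e Fp Fm fp fm g u"
  shows "jump_sub e g u"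
  unfolding jump_sub_def
proof (intro allI impI; elim conjE)
  fix x0 r q c1 c2 A
  assume 1: "x0 \<in> Tflat e" "0 < r" "ball x0 r \<subseteq> ball 0 1"
    and h: "\<forall>h. norm h < r \<longrightarrow> (0 \<le> h $ e \<longrightarrow> u (x0 + h) \<le> u x0 + q \<bullet> h + c1 * (h $ e) + A * tsq e h) \<and>
                           (h $ e \<le> 0 \<longrightarrow> u (x0 + h) \<le> u x0 + q \<bullet> h - c2 * (h $ e) + A * tsq e h)"
  have "x0 $ e = 0" using 1(1) unfolding Tflat_def by simp
  then obtain Gp Gm where G: "C1_upto_with_grad (wedge e x0 (u x0) q c1 c2 A) Gp {y \<in> cball x0 r. 0 \<le> y $ e}"
    "C1_upto_with_grad (wedge e x0 (u x0) q c1 c2 A) Gm {y \<in> cball x0 r. y $ e \<le> 0}"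
    "Gp x0 $ e - Gm x0 $ e = c1 + c2" by (rule wedge_C1)
  show "g x0 \<le> c1 + c2"
    using conjunct2[OF conjunct2[OF assms[unfolded viscosity_subsolution_def]], rule_format,
        of x0 r "wedge e x0 (u x0) q c1 c2 A" Gp Gm] 1 wedge_touch[OF 1(1) h] G by simp
qed

lemma jump_sub_of_supersolution:
  assumes "viscosity_supersolution a e Fp Fm fp fm g v"
  shows "jump_sub e (\<lambda>x. - g x) (\<lambda>x. - v x)"
  unfolding jump_sub_def
proof (intro allI impI; elim conjE)
  fix x0 r q c1 c2 A
  assume 1: "x0 \<in> Tflat e" "0 < r" "ball x0 r \<subseteq> ball 0 1"
    and h: "\<forall>h. norm h < r \<longrightarrow> (0 \<le> h $ e \<longrightarrow> - v (x0 + h) \<le> - v x0 + q \<bullet> h + c1 * (h $ e) + A * tsq e h) \<and>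
                           (h $ e \<le> 0 \<longrightarrow> - v (x0 + h) \<le> - v x0 + q \<bullet> h - c2 * (h $ e) + A * tsq e h)"
  define \<phi> where "\<phi> = wedge e x0 (- v x0) q c1 c2 A"
  have "x0 $ e = 0" using 1(1) unfolding Tflat_def by simp
  then obtain Gp Gm where G: "C1_upto_with_grad \<phi> Gp {y \<in> cball x0 r. 0 \<le> y $ e}"
    "C1_upto_with_grad \<phi> Gm {y \<in> cball x0 r. y $ e \<le> 0}"
    "Gp x0 $ e - Gm x0 $ e = c1 + c2" unfolding \<phi>_def by (rule wedge_C1)
  have t: "\<phi> x0 = - v x0" "\<forall>y\<in>ball x0 r. - v y \<le> \<phi> y"
    unfolding \<phi>_def using wedge_touch[where u="\<lambda>x. - v x", OF 1(1) h] by auto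
  have "\<forall>y\<in>ball x0 r. - \<phi> y \<le> v y" using t(2) by force
  then have "(- Gp x0) $ e - (- Gm x0) $ e \<le> g x0"
    using conjunct2[OF conjunct2[OF assms[unfolded viscosity_supersolution_def]], rule_format,
        of x0 r "\<lambda>y. - \<phi> y" "\<lambda>y. - Gp y" "\<lambda>y. - Gm y"] 1 t(1) G(1,2)[THEN C1_upto_uminus] by simp
  then show "- g x0 \<le> c1 + c2" using G(3) by simp
qed

subsection \<open>Strict subsolutions\<close>

text \<open>The first term has a normal-derivative jump of 2; the power contributes no slope at the
  interface when a < 1 and a constant after weighting its second derivative.\<close>

definition bump :: "real \<Rightarrow> 'n::finite \<Rightarrow> real^'n \<Rightarrow> real" where
  "bump a e x = \<bar>x $ e\<bar> + \<bar>x $ e\<bar> powr (2 - a)"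

text \<open>The bump vanishes at x0 and is at least |h_e| at x0 + h, so removing it lowers each
  outward slope of the test function by \<open>\<eta>\<close>.\<close>

lemma jump_sub_bump:
  assumes u: "jump_sub e g u" and \<eta>: "0 \<le> \<eta>"
  shows "jump_sub e (\<lambda>x. g x + 2 * \<eta>) (\<lambda>x. u x + \<eta> * bump a e x)"
  unfolding jump_sub_def
proof (intro allI impI; elim conjE)
  fix x0 r q c1 c2 A
  assume 1: "x0 \<in> Tflat e" "0 < r" "ball x0 r \<subseteq> ball 0 1"
    and h: "\<forall>h. norm h < r \<longrightarrow>
      (0 \<le> h $ e \<longrightarrow> u (x0 + h) + \<eta> * bump a e (x0 + h) \<le> u x0 + \<eta> * bump a e x0 + q \<bullet> h + c1 * (h $ e) + A * tsq e h) \<and>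
      (h $ e \<le> 0 \<longrightarrow> u (x0 + h) + \<eta> * bump a e (x0 + h) \<le> u x0 + \<eta> * bump a e x0 + q \<bullet> h - c2 * (h $ e) + A * tsq e h)"
  have x0: "x0 $ e = 0" using 1(1) unfolding Tflat_def by simp
  have b0: "bump a e x0 = 0" unfolding bump_def using x0 by simp
  have bh: "\<eta> * \<bar>h $ e\<bar> \<le> \<eta> * bump a e (x0 + h)" for h
    using \<eta> x0 unfolding bump_def by (intro mult_left_mono) auto
  have "g x0 \<le> (c1 - \<eta>) + (c2 - \<eta>)"
  proof (rule u[unfolded jump_sub_def, rule_format, of x0 r q _ A], intro conjI 1 allI impI)
    fix h :: "real^'a" assume nh: "norm h < r"
    { assume "0 \<le> h $ e"
      then show "u (x0 + h) \<le> u x0 + q \<bullet> h + (c1 - \<eta>) * (h $ e) + A * tsq e h"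
        using h[rule_format, OF nh] bh[of h] b0 by (simp add: algebra_simps) }
    { assume "h $ e \<le> 0"
      then show "u (x0 + h) \<le> u x0 + q \<bullet> h - (c2 - \<eta>) * (h $ e) + A * tsq e h"
        using h[rule_format, OF nh] bh[of h] b0 by (simp add: algebra_simps) }
  qed
  then show "g x0 + 2 * \<eta> \<le> c1 + c2" by simp
qed

lemma ball_side:
  fixes x0 :: "real^'n"
  assumes s: "s\<^sup>2 = 1" and y: "y \<in> ball x0 \<delta>" and \<delta>: "\<delta> \<le> s * x0 $ e"
  shows "0 < s * y $ e"
proof -
  have s1: "\<bar>s\<bar> = 1" using s by (metis abs_square_eq_1)
  have "\<bar>s * (x0 - y) $ e\<bar> = \<bar>(x0 - y) $ e\<bar>" using s1 by (simp add: abs_mult)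
  also have "\<dots> \<le> norm (x0 - y)" by (rule component_le_norm_cart)
  also have "\<dots> < \<delta>" using y by (simp add: dist_norm)
  finally have "s * (x0 - y) $ e < \<delta>" by linarith
  then show ?thesis using \<delta> by (simp add: algebra_simps)
qed

lemma powr_mult_powr_minus: "0 < (t::real) \<Longrightarrow> t powr a * t powr (- a) = 1"
  by (simp flip: powr_add)

lemma weight_pos: "x $ e \<noteq> 0 \<Longrightarrow> 0 < weight a e x"
  unfolding weight_def by simp

lemma abs_side:
  assumes "s\<^sup>2 = 1" "0 < s * (t::real)" shows "\<bar>t\<bar> = s * t"
  using assms by (metis abs_mult abs_of_pos abs_square_eq_1 mult_1)

text \<open>Off the interface \<open>\<eta> * bump a e\<close> is minus a barrier with A = 0, so it
  can be moved into the test function on a ball shrunk to one side. Removing the normal curvature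
  \<open>\<kappa>\<close> lowers F by at least \<open>lam * \<kappa>\<close>, and the weight cancels
  the singular power in \<open>\<kappa>\<close>.\<close>

lemma side_sub_bump:
  fixes e :: "'n::finite"
  assumes u: "side_sub e s a F f u" and F: "uniformly_elliptic lam Lam F" "0 \<le> lam" and s: "s\<^sup>2 = 1"
    and a: "a < 1" and \<eta>: "0 \<le> \<eta>"
  shows "side_sub e s a F (\<lambda>x. f x + lam * (\<eta> * ((2 - a) * (1 - a)))) (\<lambda>x. u x + \<eta> * bump a e x)"
  unfolding side_sub_def
proof (intro allI impI; elim conjE)
  fix x0 \<delta> \<phi> and H :: "real^'n \<Rightarrow> real^'n^'n"
  assume 1: "x0 \<in> ball 0 1" "0 < s * x0 $ e" "0 < \<delta>" "ball x0 \<delta> \<subseteq> ball 0 1"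
    and 2: "\<phi> x0 = u x0 + \<eta> * bump a e x0" "\<forall>y\<in>ball x0 \<delta>. u y + \<eta> * bump a e y \<le> \<phi> y"
    and 3: "C2_with_hessian \<phi> H (ball x0 \<delta>)" "symmetric_mat (H x0)"
  define \<delta>' where "\<delta>' = min \<delta> (s * x0 $ e)"
  have d: "0 < \<delta>'" "ball x0 \<delta>' \<subseteq> ball x0 \<delta>" unfolding \<delta>'_def using 1 by auto
  have side: "0 < s * y $ e" if "y \<in> ball x0 \<delta>'" for y
    by (rule ball_side[OF s that]) (simp add: \<delta>'_def)
  have bb: "barrier e s a 0 \<eta> (- \<eta>) 0 y = - (\<eta> * bump a e y)" if "0 < s * y $ e" for y
    using abs_side[OF s that] unfolding barrier_def bump_def by (simp add: algebra_simps)
  define \<kappa> where "\<kappa> = \<eta> * (2 - a) * (1 - a) * (s * x0 $ e) powr (- a)"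
  have \<kappa>: "0 \<le> \<kappa>" unfolding \<kappa>_def using \<eta> a by simp
  have "C2_with_hessian (\<lambda>y. \<phi> y + barrier e s a 0 \<eta> (- \<eta>) 0 y)
     (\<lambda>y. H y + ((2 * 0) *\<^sub>R (mat 1 - ecoord e) - (2 * 0 * 0 + \<eta> * (2 - a) * (1 - a) * (s * y $ e) powr (- a)) *\<^sub>R ecoord e)) (ball x0 \<delta>')"
    using side by (intro C2_with_hessian_add C2_with_hessian_subset[OF 3(1) d(2)] C2_with_hessian_subset[OF C2_barrier[OF s]]) auto
  moreover have "\<phi> x0 + barrier e s a 0 \<eta> (- \<eta>) 0 x0 = u x0" using 2(1) bb[OF 1(2)] by simp
  moreover have "\<forall>y\<in>ball x0 \<delta>'. u y \<le> \<phi> y + barrier e s a 0 \<eta> (- \<eta>) 0 y"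
    using 2(2) bb side d(2) by fastforce
  moreover have "symmetric_mat (H x0 - \<kappa> *\<^sub>R ecoord e)"
    by (intro symmetric_mat_simps 3(2) symmetric_ecoord)
  ultimately have f: "f x0 \<le> weight a e x0 * F (H x0 - \<kappa> *\<^sub>R ecoord e)"
    using u[unfolded side_sub_def, rule_format, of x0 \<delta>' "\<lambda>y. \<phi> y + barrier e s a 0 \<eta> (- \<eta>) 0 y"
       "\<lambda>y. H y + ((2 * 0) *\<^sub>R (mat 1 - ecoord e) - (2 * 0 * 0 + \<eta> * (2 - a) * (1 - a) * (s * y $ e) powr (- a)) *\<^sub>R ecoord e)"]
      1 d unfolding \<kappa>_def by auto
  have "lam * mat_norm (\<kappa> *\<^sub>R ecoord e) \<le> F (H x0 - \<kappa> *\<^sub>R ecoord e + \<kappa> *\<^sub>R ecoord e) - F (H x0 - \<kappa> *\<^sub>R ecoord e)"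
    using F(1) \<open>symmetric_mat (H x0 - \<kappa> *\<^sub>R ecoord e)\<close> psd_scaled_ecoord[OF \<kappa>]
    unfolding uniformly_elliptic_def by blast
  moreover have "lam * \<kappa> \<le> lam * mat_norm (\<kappa> *\<^sub>R ecoord e)"
    using F(2) by (intro mult_left_mono mat_norm_scaled_ecoord_ge \<kappa>)
  ultimately have "F (H x0 - \<kappa> *\<^sub>R ecoord e) + lam * \<kappa> \<le> F (H x0)" by simp
  then have "weight a e x0 * (F (H x0 - \<kappa> *\<^sub>R ecoord e) + lam * \<kappa>) \<le> weight a e x0 * F (H x0)"
    by (intro mult_left_mono) (auto simp: weight_def)
  moreover have "weight a e x0 * (lam * \<kappa>) = lam * (\<eta> * ((2 - a) * (1 - a)))"
  proof -
    have "(s * x0 $ e) powr a * (s * x0 $ e) powr (- a) = 1"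
      by (rule powr_mult_powr_minus[OF 1(2)])
    moreover have "w * (lam * (\<eta> * (2 - a) * (1 - a) * p)) = (w * p) * (lam * (\<eta> * ((2 - a) * (1 - a))))" for w p
      by (simp only: mult_ac)
    ultimately show ?thesis unfolding weight_def \<kappa>_def abs_side[OF s 1(2)] by simp
  qed
  ultimately show "f x0 + lam * (\<eta> * ((2 - a) * (1 - a))) \<le> weight a e x0 * F (H x0)"
    using f by (simp add: distrib_left)
qed

text \<open>From -Q, adding P raises F by at most Lam|P|, while adding Q raises it to F 0 by at
  least lam|Q|. Division by the weight produces t^(-a), which also absorbs F 0 because t \<le> 1 in
  the ball.\<close>

lemma pucci_sub_of_side_sub:
  fixes e :: "'n::finite"
  assumes u: "side_sub e s a F f u" and F: "uniformly_elliptic lam Lam F" and s: "s\<^sup>2 = 1"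
    and a: "0 < a" and f: "\<And>x. x \<in> ball 0 1 \<Longrightarrow> 0 < s * x $ e \<Longrightarrow> \<bar>f x\<bar> \<le> C"
    and C': "\<bar>F 0\<bar> + C \<le> C'"
  shows "pucci_sub e s a lam Lam C' u"
  unfolding pucci_sub_def
proof (intro allI impI; elim conjE)
  fix x0 \<delta> \<phi> P Q and H :: "real^'n \<Rightarrow> real^'n^'n"
  assume 1: "x0 \<in> ball 0 1" "0 < s * x0 $ e" "0 < \<delta>" "ball x0 \<delta> \<subseteq> ball 0 1"
    and 2: "\<phi> x0 = u x0" "\<forall>y\<in>ball x0 \<delta>. u y \<le> \<phi> y"
    and 3: "C2_with_hessian \<phi> H (ball x0 \<delta>)" and PQ: "psd_mat P" "psd_mat Q" "H x0 = P - Q"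
  have sP: "symmetric_mat P" "symmetric_mat Q" using PQ unfolding psd_mat_def by auto
  have sQ: "symmetric_mat (- Q)" "symmetric_mat (P - Q)" using sP by (auto intro: symmetric_mat_simps)
  define t where "t = s * x0 $ e"
  have t: "0 < t" using 1(2) unfolding t_def .
  have "t = \<bar>x0 $ e\<bar>" unfolding t_def using abs_side[OF s 1(2)] by simp
  then have t1: "t \<le> 1" using component_le_norm_cart[of x0 e] 1(1) by simp
  have w: "weight a e x0 = t powr a" unfolding weight_def abs_side[OF s 1(2)] t_def ..
  have pp: "t powr a * t powr (- a) = 1" by (rule powr_mult_powr_minus[OF t])
  have "f x0 \<le> t powr a * F (P - Q)"
    using u[unfolded side_sub_def, rule_format, of x0 \<delta> \<phi> H] 1 2 3 PQ(3) sQ(2) w by metis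
  then have "f x0 * t powr (- a) \<le> (t powr a * F (P - Q)) * t powr (- a)" by (intro mult_right_mono) auto
  also have "\<dots> = F (P - Q)" using pp by (metis mult.assoc mult.commute mult.left_neutral)
  finally have lo: "f x0 * t powr (- a) \<le> F (P - Q)" .
  have "(- C) * t powr (- a) \<le> f x0 * t powr (- a)"
    using f[OF 1(1,2)] by (intro mult_right_mono) auto
  moreover have "F (- Q + P) - F (- Q) \<le> Lam * mat_norm P"
    using F PQ(1) sQ(1) unfolding uniformly_elliptic_def by blast
  moreover have "lam * mat_norm Q \<le> F (- Q + Q) - F (- Q)"
    using F PQ(2) sQ(1) unfolding uniformly_elliptic_def by blast
  moreover have "\<bar>F 0\<bar> * 1 \<le> \<bar>F 0\<bar> * t powr (- a)"
  proof (rule mult_left_mono)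
    have "1 \<le> inverse (t powr a)" using t t1 a by (intro one_le_inverse) (auto intro: powr_le1)
    then show "1 \<le> t powr (- a)" by (simp add: powr_minus)
  qed simp
  moreover have "(\<bar>F 0\<bar> + C) * t powr (- a) \<le> C' * t powr (- a)" using C' by (intro mult_right_mono) auto
  ultimately show "lam * mat_norm Q \<le> Lam * mat_norm P + C' * t powr (- a)"
    using lo by (simp add: algebra_simps)
qed

lemma side_sub_superjet:
  fixes e :: "'n::finite"
  assumes u: "side_sub e s a F f u" and x: "x \<in> ball 0 1" "0 < s * x $ e" and j: "superjet u x X"
  shows "f x \<le> weight a e x * F X"
proof -
  obtain \<delta> b where X: "symmetric_mat X" and \<delta>: "0 < \<delta>"
      "\<And>h. norm h < \<delta> \<Longrightarrow> u (x + h) \<le> u x + b \<bullet> h + (1/2) * (h \<bullet> (X *v h))"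
    using j unfolding superjet_def by blast
  define \<delta>' where "\<delta>' = min \<delta> (1 - norm x)"
  have d: "0 < \<delta>'" unfolding \<delta>'_def using \<delta>(1) x(1) by simp
  have sub: "ball x \<delta>' \<subseteq> ball 0 1"
  proof
    fix y assume "y \<in> ball x \<delta>'"
    then have "norm (y - x) < 1 - norm x" unfolding \<delta>'_def by (simp add: dist_norm norm_minus_commute)
    then show "y \<in> ball 0 1" using norm_triangle_ineq[of x "y - x"] by simp
  qed
  define \<phi> where "\<phi> y = (u x - b \<bullet> x) + b \<bullet> y + (1/2) * ((y - x) \<bullet> (X *v (y - x)))" for y
  have "C2_with_hessian \<phi> (\<lambda>_. X) (ball x \<delta>')"
    unfolding \<phi>_def using C2_with_hessian_translate[OF C2_quadratic[OF X, of UNIV], of "ball x \<delta>'" x "u x - b \<bullet> x" b] by simp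
  moreover have "\<phi> x = u x" unfolding \<phi>_def by simp
  moreover have "u y \<le> \<phi> y" if "y \<in> ball x \<delta>'" for y
    using \<delta>(2)[of "y - x"] that unfolding \<phi>_def \<delta>'_def by (simp add: dist_norm norm_minus_commute inner_diff_right)
  ultimately show ?thesis
    using u[unfolded side_sub_def, rule_format, of x \<delta>' \<phi> "\<lambda>_. X"] x d sub X by blast
qed

lemma superjet_translate:
  "superjet (\<lambda>h. u (z + h)) x X \<longleftrightarrow> superjet u (z + x) X"
  unfolding superjet_def by (simp add: add.assoc)

section \<open>Comparison\<close>

text \<open>The translates h \<mapsto> u(x+h) and h \<mapsto> v(y+h) have a contact at 0 and carry
  the same weight at every h, so dividing by it reduces the claim to an equation without
  weight.\<close>

lemma no_contact_off_interface:
  fixes e :: "'n::finite"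
  assumes F: "uniformly_elliptic lam Lam F" "0 \<le> lam" "0 \<le> Lam" and s: "s\<^sup>2 = 1"
    and u: "side_sub e s a F f u" and v: "side_sub e s a (dual_op F) (\<lambda>x. - f' x) v"
    and cont: "continuous_on (cball 0 1) u" "continuous_on (cball 0 1) v"
    and fc: "continuous_on {x \<in> ball 0 1. 0 < s * x $ e} f" "continuous_on {x \<in> ball 0 1. 0 < s * x $ e} f'"
    and x: "x \<in> ball 0 1" "y \<in> ball 0 1" "x $ e = y $ e" "0 < s * x $ e"
    and max: "\<And>h. x + h \<in> cball 0 1 \<Longrightarrow> y + h \<in> cball 0 1 \<Longrightarrow> u (x + h) + v (y + h) \<le> u x + v y"
  shows "f x \<le> f' y"
proof (rule ccontr)
  assume "\<not> ?thesis"
  define O' where "O' = {x \<in> ball 0 1. 0 < s * x $ e}"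
  have "O' = ball 0 1 \<inter> {x. 0 < s * x $ e}" unfolding O'_def by auto
  then have oO: "open O'" by (auto intro!: open_Int open_Collect_less continuous_intros)
  have xyO: "x \<in> O'" "y \<in> O'" unfolding O'_def using x by auto
  define w where "w h = weight a e (x + h)" for h
  have wy: "w h = weight a e (y + h)" for h unfolding w_def weight_def using x(3) by simp
  have w0: "0 < w 0" unfolding w_def using x(4) by (auto intro!: weight_pos)
  have wl: "w \<midarrow>0\<rightarrow> w 0"
    unfolding w_def weight_def using x(4) by (intro tendsto_intros) auto
  have fl: "(\<lambda>h. f (x + h)) \<midarrow>0\<rightarrow> f x" "(\<lambda>h. f' (y + h)) \<midarrow>0\<rightarrow> f' y"
    using fc xyO oO unfolding O'_def[symmetric]
    by (auto intro!: LIM_offset_zero simp: continuous_on_eq_continuous_at isCont_def)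
  \<comment> \<open>\<open>interior_no_contact\<close> needs constant bounds: m lies midway between
    the weighted data, and \<open>\<gamma>\<close> is a quarter of the gap, which continuity
    preserves on a small ball.\<close>
  define m where "m = (f x / w 0 + f' y / w 0) / 2"
  define \<gamma> where "\<gamma> = (f x / w 0 - f' y / w 0) / 4"
  have \<gamma>: "0 < \<gamma>" unfolding \<gamma>_def using \<open>\<not> f x \<le> f' y\<close> w0 by (simp add: divide_strict_right_mono)
  have mm: "f' y / w 0 < m - \<gamma>" "m + \<gamma> < f x / w 0"
  proof -
    have "B < (A + B) / 2 - (A - B) / 4 \<and> (A + B) / 2 + (A - B) / 4 < A" if "0 < (A - B) / 4" for A B :: real
      using that by (simp add: field_simps)
    then show "f' y / w 0 < m - \<gamma>" "m + \<gamma> < f x / w 0" using \<gamma> unfolding m_def \<gamma>_def by blast+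
  qed
  have "\<forall>\<^sub>F h in at 0. m + \<gamma> < f (x + h) / w h"
    by (rule order_tendstoD(1)[OF tendsto_divide[OF fl(1) wl]]) (use w0 mm in auto)
  moreover have "\<forall>\<^sub>F h in at 0. f' (y + h) / w h < m - \<gamma>"
    by (rule order_tendstoD(2)[OF tendsto_divide[OF fl(2) wl]]) (use w0 mm in auto)
  ultimately have "\<forall>\<^sub>F h in at 0. m + \<gamma> < f (x + h) / w h \<and> f' (y + h) / w h < m - \<gamma>"
    by (rule eventually_conj)
  then obtain d where d: "0 < d" "\<And>h. h \<noteq> 0 \<Longrightarrow> norm h < d \<Longrightarrow> m + \<gamma> < f (x + h) / w h \<and> f' (y + h) / w h < m - \<gamma>"
    unfolding eventually_at by auto
  obtain d1 where d1: "0 < d1" "ball x d1 \<subseteq> O'" using oO xyO(1) openE by blast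
  obtain d2 where d2: "0 < d2" "ball y d2 \<subseteq> O'" using oO xyO(2) openE by blast
  define R where "R = min d (min d1 d2) / 2"
  have R: "0 < R" "R < d" "R < d1" "R < d2" unfolding R_def using d(1) d1(1) d2(1) by auto
  have xh: "x + h \<in> O'" "y + h \<in> O'" if "norm h \<le> R" for h
    using d1(2) d2(2) R that by (auto simp: subset_iff dist_norm)
  have OB: "z \<in> cball 0 1" "z \<in> ball 0 1" "0 < s * z $ e" if "z \<in> O'" for z using that unfolding O'_def by auto
  have bounds: "m + \<gamma> \<le> f (x + h) / w h" "f' (y + h) / w h \<le> m - \<gamma>" if "norm h < R" for h
    using d(2)[of h] that R mm by (cases "h = 0"; force)+
  have wp: "0 < w h" if "norm h < R" for h
    unfolding w_def using OB(3)[OF xh(1), of h] that by (auto intro!: weight_pos)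
  have "m + \<gamma> \<le> m - \<gamma>"
  proof (rule interior_no_contact[OF F R(1), of "\<lambda>h. u (x + h)" "\<lambda>h. v (y + h)"])
    show "continuous_on (cball 0 R) (\<lambda>h. u (x + h))" "continuous_on (cball 0 R) (\<lambda>h. v (y + h))"
      using xh OB(1) by (auto intro!: continuous_intros continuous_on_compose2[OF cont(1)] continuous_on_compose2[OF cont(2)])
    show "u (x + h) + v (y + h) \<le> u (x + 0) + v (y + 0)" if "norm h \<le> R" for h
      using max[OF OB(1)[OF xh(1)[OF that]] OB(1)[OF xh(2)[OF that]]] by simp
    fix h :: "real^'n" and X :: "real^'n^'n" assume h: "norm h < R"
    then have xy: "x + h \<in> O'" "y + h \<in> O'" using xh by auto
    { assume "superjet (\<lambda>h. u (x + h)) h X"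
      then have "f (x + h) \<le> w h * F X"
        unfolding superjet_translate w_def using side_sub_superjet[OF u] OB xy(1) by blast
      then have "f (x + h) / w h \<le> F X" using wp[OF h] by (simp add: pos_divide_le_eq mult.commute)
      then show "m + \<gamma> \<le> F X" using bounds(1)[OF h] by linarith }
    { assume "superjet (\<lambda>h. v (y + h)) h X"
      then have "- f' (y + h) \<le> w h * dual_op F X"
        unfolding superjet_translate wy using side_sub_superjet[OF v] OB xy(2) by blast
      then have "F (- X) \<le> f' (y + h) / w h"
        using wp[OF h] by (simp add: dual_op_def pos_le_divide_eq mult.commute)
      then show "F (- X) \<le> m - \<gamma>" using bounds(2)[OF h] by linarith }
  qed
  then show False using \<gamma> by simp
qed

text \<open>k|x'-w|^2 + k|y'-w|^2 is least at the midpoint w, with value (k/2)|x'-y'|^2. Hence the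
  penalty k/2 fits sup-convolutions with parameter k: their sum never exceeds the doubled maximum
  and attains it at the midpoint z of x and y.\<close>

lemma no_contact_on_interface:
  fixes u v :: "real^'n \<Rightarrow> real"
  assumes cont: "continuous_on (cball 0 1) u" "continuous_on (cball 0 1) v"
    and B: "\<And>x. x \<in> cball 0 1 \<Longrightarrow> \<bar>u x\<bar> \<le> B" "\<And>x. x \<in> cball 0 1 \<Longrightarrow> \<bar>v x\<bar> \<le> B"
    and k: "0 < k" and d: "2 * B \<le> k * d\<^sup>2" "0 \<le> d" and r0: "0 < r0" and a: "a < 1"
    and lam: "0 < lam" "0 < Lam" and C: "0 \<le> C"
    and pu: "pucci_sub e 1 a lam Lam C u" "pucci_sub e (- 1) a lam Lam C u"
    and pv: "pucci_sub e 1 a lam Lam C v" "pucci_sub e (- 1) a lam Lam C v"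
    and ju: "jump_sub e g u" and jv: "jump_sub e g' v"
    and x: "x \<in> ball 0 1" "x $ e = 0" and y: "y \<in> ball 0 1" "y $ e = 0"
    and room: "norm ((1/2) *\<^sub>R (x + y)) + r0 + d < 1"
    and max: "\<And>x' y'. \<lbrakk>x' \<in> cball 0 1; y' \<in> cball 0 1; x' $ e = y' $ e\<rbrakk> \<Longrightarrow>
       u x' + v y' - k / 2 * ((x' - y') \<bullet> (x' - y')) \<le> u x + v y - k / 2 * ((x - y) \<bullet> (x - y))"
  shows "g x + g' y \<le> 0"
proof -
  define z where "z = (1/2) *\<^sub>R (x + y)"
  define p where "p = k *\<^sub>R (x - y)"
  define Mx where "Mx = u x + v y - k / 2 * ((x - y) \<bullet> (x - y))"
  have ze: "z $ e = 0" unfolding z_def using x y by simp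
  have zc: "z \<in> cball 0 1" using room d(2) r0 unfolding z_def[symmetric] by simp
  have zd: "norm z + r0 + d < 1" using room unfolding z_def .
  have xc: "x \<in> cball 0 1" "y \<in> cball 0 1" using x y by auto
  have half: "x - z = (1/2) *\<^sub>R (x - y)" "y - z = - ((1/2) *\<^sub>R (x - y))"
  proof -
    have "(1/2) *\<^sub>R w + (1/2) *\<^sub>R w = w" for w :: "real^'n" by (simp flip: scaleR_add_left)
    from this[of x] this[of y] show "x - z = (1/2) *\<^sub>R (x - y)" "y - z = - ((1/2) *\<^sub>R (x - y))"
      unfolding z_def by (simp_all add: algebra_simps)
  qed
  have sq: "k * ((x - z) \<bullet> (x - z)) = k / 4 * ((x - y) \<bullet> (x - y))" "k * ((y - z) \<bullet> (y - z)) = k / 4 * ((x - y) \<bullet> (x - y))"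
    unfolding half by simp_all
  have par: "(x' - y') \<bullet> (x' - y') / 2 \<le> (x' - w) \<bullet> (x' - w) + (y' - w) \<bullet> (y' - w)" for x' y' w :: "real^'n"
  proof -
    define \<alpha> \<beta> where "\<alpha> = x' - w" and "\<beta> = y' - w"
    have "x' - y' = \<alpha> - \<beta>" unfolding \<alpha>_def \<beta>_def by simp
    moreover have "0 \<le> (\<alpha> + \<beta>) \<bullet> (\<alpha> + \<beta>)" by simp
    then have "(\<alpha> - \<beta>) \<bullet> (\<alpha> - \<beta>) / 2 \<le> \<alpha> \<bullet> \<alpha> + \<beta> \<bullet> \<beta>" by (simp add: inner_simps inner_commute)
    ultimately show ?thesis unfolding \<alpha>_def \<beta>_def by simp
  qed
  have sum_le: "tsup e k u w + tsup e k v w \<le> Mx" if w: "w \<in> cball 0 1" for w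
  proof -
    obtain x' where x': "x' \<in> cball 0 1" "x' $ e = w $ e" "tsup e k u w = u x' - k * ((x' - w) \<bullet> (x' - w))"
      using tsup_attained[OF cont(1) B(1) w] by metis
    obtain y' where y': "y' \<in> cball 0 1" "y' $ e = w $ e" "tsup e k v w = v y' - k * ((y' - w) \<bullet> (y' - w))"
      using tsup_attained[OF cont(2) B(2) w] by metis
    have "k * ((x' - y') \<bullet> (x' - y') / 2) \<le> k * ((x' - w) \<bullet> (x' - w) + (y' - w) \<bullet> (y' - w))"
      using k by (intro mult_left_mono par) auto
    then show ?thesis
      using max[OF x'(1) y'(1)] x' y' unfolding Mx_def by (simp add: distrib_left)
  qed
  have geu: "u x - k / 4 * ((x - y) \<bullet> (x - y)) \<le> tsup e k u z"
    using tsup_ge[OF cont(1) xc(1), where z=z and e=e and k=k] x(2) ze sq(1) by simp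
  have gev: "v y - k / 4 * ((x - y) \<bullet> (x - y)) \<le> tsup e k v z"
    using tsup_ge[OF cont(2) xc(2), where z=z and e=e and k=k] y(2) ze sq(2) by simp
  have tz: "tsup e k u z = u x - k / 4 * ((x - y) \<bullet> (x - y))" "tsup e k v z = v y - k / 4 * ((x - y) \<bullet> (x - y))"
    "tsup e k u z + tsup e k v z = Mx"
    using geu gev sum_le[OF zc] unfolding Mx_def by argo+
  have expand: "k * ((c - w) \<bullet> (c - w)) = k * ((c - z) \<bullet> (c - z)) - 2 * k * ((c - z) \<bullet> (w - z)) + k * ((w - z) \<bullet> (w - z))" for c w
  proof -
    have "(c - w) \<bullet> (c - w) = (c - z) \<bullet> (c - z) - 2 * ((c - z) \<bullet> (w - z)) + (w - z) \<bullet> (w - z)"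
      by (simp add: inner_simps inner_commute)
    then show ?thesis by (simp only: right_diff_distrib distrib_left mult.assoc mult.left_commute)
  qed
  \<comment> \<open>The sum is maximal at z, and the competitor y bounds the second sup-convolution
    below by a paraboloid, which bounds the first one above; \<open>flatv\<close> exchanges the
    roles and gets the opposite slope.\<close>
  have flatu: "tsup e k u w \<le> tsup e k u z + p \<bullet> (w - z) + k * ((w - z) \<bullet> (w - z))" if w: "w \<in> cball 0 1" "w $ e = 0" for w
  proof -
    have "v y - k * ((y - w) \<bullet> (y - w)) \<le> tsup e k v w"
      by (rule tsup_ge[OF cont(2) xc(2)]) (use y w in simp)
    moreover have "2 * k * ((y - z) \<bullet> (w - z)) = - (p \<bullet> (w - z))" unfolding half p_def by simp
    ultimately show ?thesis using sum_le[OF w(1)] expand[of y w] tz(2,3) sq(2) by linarith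
  qed
  have flatv: "tsup e k v w \<le> tsup e k v z + (- p) \<bullet> (w - z) + k * ((w - z) \<bullet> (w - z))" if w: "w \<in> cball 0 1" "w $ e = 0" for w
  proof -
    have "u x - k * ((x - w) \<bullet> (x - w)) \<le> tsup e k u w"
      by (rule tsup_ge[OF cont(1) xc(1)]) (use x w in simp)
    moreover have "2 * k * ((x - z) \<bullet> (w - z)) = p \<bullet> (w - z)" unfolding half p_def by simp
    ultimately show ?thesis using sum_le[OF w(1)] expand[of x w] tz(1,3) sq(1) by (simp add: inner_minus_left)
  qed
  define K where "K = (C + 1) / (lam * (2 - a) * (1 - a))"
  have K: "0 \<le> K" "C < lam * (K * (2 - a) * (1 - a))"
    unfolding K_def using C lam a by simp_all
  define U W where "U h = tsup e k u (z + h) - tsup e k u z - p \<bullet> h"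
    and "W h = tsup e k v (z + h) - tsup e k v z - (- p) \<bullet> h" for h
  define M where "M = 2 * B + norm p * r0"
  have B0: "0 \<le> B" using B(1)[OF zc] by simp
  have M: "0 \<le> M" unfolding M_def using B0 r0 by simp
  have oU: "one_sided e s a (Lam / lam) K k r0 M U" and oW: "one_sided e s a (Lam / lam) K k r0 M W"
    if s: "s = 1 \<or> s = - 1" for s
  proof -
    have s2: "s\<^sup>2 = 1" using s by auto
    have su: "pucci_sub e s a lam Lam C u" and sv: "pucci_sub e s a lam Lam C v" using s pu pv by auto
    show "one_sided e s a (Lam / lam) K k r0 M U"
      unfolding U_def M_def
      by (rule tsup_one_sided[OF cont(1) B(1) k d su s2 a lam(1) _ K ze _ zd flatu]) (use lam r0 in auto)
    have "one_sided e s a (Lam / lam) K k r0 (2 * B + norm (- p) * r0) W"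
      unfolding W_def
      by (rule tsup_one_sided[OF cont(2) B(2) k d sv s2 a lam(1) _ K ze _ zd flatv]) (use lam r0 in auto)
    then show "one_sided e s a (Lam / lam) K k r0 M W" unfolding M_def by simp
  qed
  have inb: "z + h \<in> cball 0 1" if "norm h \<le> r0" for h
    using that zd d(2) norm_triangle_ineq[of z h] by simp
  have UW: "U h + W h \<le> 0" if "norm h \<le> r0" for h
    using sum_le[OF inb[OF that]] tz(3) unfolding U_def W_def by (simp add: inner_minus_left)
  have N: "0 < Lam / lam" using lam by simp
  \<comment> \<open>On each side the slopes for u and v are opposite up to \<open>\<delta>\<close>;
    in the sum of the two jump inequalities b1 and b2 cancel and four errors remain.\<close>
  have main: "g x + g' y \<le> 4 * \<delta>" if \<delta>: "0 < \<delta>" for \<delta>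
  proof -
    have k0: "0 \<le> k" using k by simp
    obtain b1 A1 r1 where 1: "0 \<le> A1" "0 < r1" "\<And>h. norm h \<le> r1 \<Longrightarrow> 0 \<le> h $ e \<Longrightarrow>
        U h \<le> (b1 + \<delta>) * (h $ e) + A1 * tsq e h \<and> W h \<le> (- b1 + \<delta>) * (h $ e) + A1 * tsq e h"
      using matching_slopes[OF oU oW _ a N K(1) k0 r0 M \<delta> UW, of 1] by auto
    obtain b2 A2 r2 where 2: "0 \<le> A2" "0 < r2" "\<And>h. norm h \<le> r2 \<Longrightarrow> h $ e \<le> 0 \<Longrightarrow>
        U h \<le> (b2 + \<delta>) * - (h $ e) + A2 * tsq e h \<and> W h \<le> (- b2 + \<delta>) * - (h $ e) + A2 * tsq e h"
      using matching_slopes[OF oU oW _ a N K(1) k0 r0 M \<delta> UW, of "- 1"] by auto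
    define A where "A = A1 + A2"
    have A: "A1 * tsq e h \<le> A * tsq e h" "A2 * tsq e h \<le> A * tsq e h" for h
      unfolding A_def using 1(1) 2(1) tsq_nonneg[of e h] by (auto intro: mult_right_mono)
    define r where "r = min (min r1 r2) (min r0 (min (1 - norm x) (1 - norm y)))"
    have r: "0 < r" "r \<le> r1" "r \<le> r2" "r \<le> r0" "r \<le> 1 - norm x" "r \<le> 1 - norm y"
      unfolding r_def using 1(2) 2(2) r0 x(1) y(1) by auto
    have ball: "ball w r \<subseteq> ball 0 1" if "r \<le> 1 - norm w" for w :: "real^'n"
    proof
      fix y assume "y \<in> ball w r"
      then have "norm (y - w) < 1 - norm w" using that by (simp add: dist_norm norm_minus_commute)
      then show "y \<in> ball 0 1" using norm_triangle_ineq[of w "y - w"] by simp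
    qed
    \<comment> \<open>x + h competes at z + h with the same penalty as x at z, so bounds on U and W
      give test functions for u at x and v at y.\<close>
    have uU: "u (x + h) \<le> u x + p \<bullet> h + U h" and vW: "v (y + h) \<le> v y + (- p) \<bullet> h + W h" if h: "norm h < r" for h
    proof -
      have xb: "x + h \<in> cball 0 1" "y + h \<in> cball 0 1"
        using h r(5,6) norm_triangle_ineq[of x h] norm_triangle_ineq[of y h] by auto
      show "u (x + h) \<le> u x + p \<bullet> h + U h"
        using tsup_ge[OF cont(1) xb(1), where z="z + h" and e=e and k=k] x(2) ze sq(1) tz(1) unfolding U_def by simp
      show "v (y + h) \<le> v y + (- p) \<bullet> h + W h"
        using tsup_ge[OF cont(2) xb(2), where z="z + h" and e=e and k=k] y(2) ze sq(2) tz(2) unfolding W_def by simp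
    qed
    have "g x \<le> (b1 + \<delta>) + (b2 + \<delta>)"
    proof (rule ju[unfolded jump_sub_def, rule_format, of x r p _ A], intro conjI allI impI)
      show "x \<in> Tflat e" unfolding Tflat_def using x by simp
      show "0 < r" by (rule r(1))
      show "ball x r \<subseteq> ball 0 1" by (rule ball[OF r(5)])
      fix h :: "real^'n" assume h: "norm h < r"
      then have h12: "norm h \<le> r1" "norm h \<le> r2" using r by auto
      show "u (x + h) \<le> u x + p \<bullet> h + (b1 + \<delta>) * (h $ e) + A * tsq e h" if "0 \<le> h $ e"
        using uU[OF h] 1(3)[OF h12(1) that] A(1)[of h] by linarith
      show "u (x + h) \<le> u x + p \<bullet> h - (b2 + \<delta>) * (h $ e) + A * tsq e h" if "h $ e \<le> 0"
        using uU[OF h] 2(3)[OF h12(2) that] A(2)[of h] unfolding mult_minus_right by linarith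
    qed
    moreover have "g' y \<le> (- b1 + \<delta>) + (- b2 + \<delta>)"
    proof (rule jv[unfolded jump_sub_def, rule_format, of y r "- p" _ A], intro conjI allI impI)
      show "y \<in> Tflat e" unfolding Tflat_def using y by simp
      show "0 < r" by (rule r(1))
      show "ball y r \<subseteq> ball 0 1" by (rule ball[OF r(6)])
      fix h :: "real^'n" assume h: "norm h < r"
      then have h12: "norm h \<le> r1" "norm h \<le> r2" using r by auto
      show "v (y + h) \<le> v y + (- p) \<bullet> h + (- b1 + \<delta>) * (h $ e) + A * tsq e h" if "0 \<le> h $ e"
        using vW[OF h] 1(3)[OF h12(1) that] A(1)[of h] by linarith
      show "v (y + h) \<le> v y + (- p) \<bullet> h - (- b2 + \<delta>) * (h $ e) + A * tsq e h" if "h $ e \<le> 0"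
        using vW[OF h] 2(3)[OF h12(2) that] A(2)[of h] unfolding mult_minus_right by linarith
    qed
    ultimately show ?thesis by linarith
  qed
  show ?thesis
  proof (rule field_le_epsilon)
    fix \<epsilon> :: real assume "0 < \<epsilon>"
    then show "g x + g' y \<le> 0 + \<epsilon>" using main[of "\<epsilon> / 4"] by simp
  qed
qed

theorem mainTheorem12:
  fixes e :: "'n::finite"
    and a lam Lam :: real
    and Fp Fm :: "real^'n^'n \<Rightarrow> real"
    and fp fm g u v :: "real^'n \<Rightarrow> real"
  assumes "0 < a" "a < 1"
    and "0 < lam" "lam \<le> Lam"
    and "uniformly_elliptic lam Lam Fp" "uniformly_elliptic lam Lam Fm"
    and "continuous_on (Bplus e \<union> Tflat e) fp" "bounded (fp ` (Bplus e \<union> Tflat e))"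
    and "continuous_on (Bminus e \<union> Tflat e) fm" "bounded (fm ` (Bminus e \<union> Tflat e))"
    and "continuous_on (Tflat e) g"
    and "continuous_on (cball 0 1) u" "bounded (u ` cball 0 1)"
    and "continuous_on (cball 0 1) v" "bounded (v ` cball 0 1)"
    and "viscosity_subsolution a e Fp Fm fp fm g u"
    and "viscosity_supersolution a e Fp Fm fp fm g v"
    and "\<forall>x\<in>sphere 0 1. u x \<le> v x"
  shows "\<forall>x\<in>ball 0 1. u x \<le> v x"
proof (rule ccontr)
  note a = assms(1,2) and lam = assms(3,4) and F = assms(5,6)
  note uc = assms(12) and vc = assms(14)
  assume "\<not> ?thesis"
  then obtain x0 where x0: "x0 \<in> ball 0 1" "v x0 < u x0" by force
  define \<gamma> where "\<gamma> = u x0 - v x0"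
  have \<gamma>: "0 < \<gamma>" unfolding \<gamma>_def using x0 by simp
  \<comment> \<open>The bump is at most 2 on the ball, so U + V is at most
    \<open>\<gamma> / 4\<close> on the sphere and still at least \<open>\<gamma>\<close> at
    x0.\<close>
  define \<eta> where "\<eta> = \<gamma> / 8"
  have \<eta>: "0 < \<eta>" unfolding \<eta>_def using \<gamma> by simp
  define c where "c = lam * (\<eta> * ((2 - a) * (1 - a)))"
  have c: "0 < c" unfolding c_def using lam \<eta> a by simp
  define U where "U x = u x + \<eta> * bump a e x" for x
  define V where "V x = - v x" for x
  have Uc: "continuous_on (cball 0 1) U"
    unfolding U_def bump_def by (intro continuous_intros uc continuous_on_powr') (use a in auto)
  have Vc: "continuous_on (cball 0 1) V" unfolding V_def by (intro continuous_intros vc)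
  have bump: "0 \<le> bump a e x" "bump a e x \<le> 2" if "x \<in> cball 0 1" for x
  proof -
    have "\<bar>x $ e\<bar> \<le> 1" using component_le_norm_cart[of x e] that by simp
    moreover then have "\<bar>x $ e\<bar> powr (2 - a) \<le> 1" using a by (intro powr_le1) auto
    ultimately show "0 \<le> bump a e x" "bump a e x \<le> 2" unfolding bump_def by auto
  qed
  obtain BU where BU: "\<And>x. x \<in> cball 0 1 \<Longrightarrow> \<bar>U x\<bar> \<le> BU"
    using compact_imp_bounded[OF compact_continuous_image[OF Uc compact_cball]] unfolding bounded_iff by (metis image_eqI real_norm_def)
  obtain BV where BV: "\<And>x. x \<in> cball 0 1 \<Longrightarrow> \<bar>V x\<bar> \<le> BV"
    using compact_imp_bounded[OF compact_continuous_image[OF Vc compact_cball]] unfolding bounded_iff by (metis image_eqI real_norm_def)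
  define B where "B = max BU BV"
  have B: "\<bar>U x\<bar> \<le> B" "\<bar>V x\<bar> \<le> B" if "x \<in> cball 0 1" for x
    using BU[OF that] BV[OF that] unfolding B_def by auto
  have B0: "0 \<le> B" using B(1)[of 0] by simp

  have elliptic: "side_sub e 1 a Fp (\<lambda>x. fp x + c) U" "side_sub e (- 1) a Fm (\<lambda>x. fm x + c) U"
    "side_sub e 1 a (dual_op Fp) (\<lambda>x. - fp x) V" "side_sub e (- 1) a (dual_op Fm) (\<lambda>x. - fm x) V"
    unfolding U_def V_def c_def
    using side_sub_bump[OF side_sub_of_subsolution(1)[OF assms(16)] F(1) _ _ a(2)]
      side_sub_bump[OF side_sub_of_subsolution(2)[OF assms(16)] F(2) _ _ a(2)]
      side_sub_of_supersolution[OF assms(17)] lam \<eta> by auto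
  have jump: "jump_sub e (\<lambda>x. g x + 2 * \<eta>) U" "jump_sub e (\<lambda>x. - g x) V"
    unfolding U_def V_def
    using jump_sub_bump[OF jump_sub_of_subsolution[OF assms(16)]] jump_sub_of_supersolution[OF assms(17)] \<eta> by auto
  have sets: "Bplus e \<union> Tflat e = {x \<in> ball 0 1. 0 \<le> x $ e}" "Bminus e \<union> Tflat e = {x \<in> ball 0 1. x $ e \<le> 0}"
    unfolding Bplus_def Bminus_def Tflat_def by auto
  note fpc = assms(7)[unfolded sets] and fmc = assms(9)[unfolded sets]
  obtain Cp where Cp: "\<And>x. x \<in> ball 0 1 \<Longrightarrow> 0 \<le> x $ e \<Longrightarrow> \<bar>fp x\<bar> \<le> Cp"
    using assms(8) unfolding sets bounded_iff by auto
  obtain Cm where Cm: "\<And>x. x \<in> ball 0 1 \<Longrightarrow> x $ e \<le> 0 \<Longrightarrow> \<bar>fm x\<bar> \<le> Cm"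
    using assms(10) unfolding sets bounded_iff by auto
  define C where "C = \<bar>Cp\<bar> + \<bar>Cm\<bar> + c + (\<bar>Fp 0\<bar> + \<bar>Fm 0\<bar>)"
  have C: "0 \<le> C" unfolding C_def using c by simp
  have pucci: "pucci_sub e 1 a lam Lam C U" "pucci_sub e (- 1) a lam Lam C U"
    "pucci_sub e 1 a lam Lam C V" "pucci_sub e (- 1) a lam Lam C V"
  proof -
    have d0: "\<bar>dual_op F 0\<bar> = \<bar>F 0\<bar>" for F :: "real^'n^'n \<Rightarrow> real" unfolding dual_op_def by simp
    show "pucci_sub e 1 a lam Lam C U"
    proof (rule pucci_sub_of_side_sub[OF elliptic(1) F(1) _ a(1)])
      show "\<bar>fp x + c\<bar> \<le> \<bar>Cp\<bar> + c" if "x \<in> ball 0 1" "0 < 1 * x $ e" for x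
        using Cp[OF that(1)] that(2) c by simp
    qed (auto simp: C_def)
    show "pucci_sub e (- 1) a lam Lam C U"
    proof (rule pucci_sub_of_side_sub[OF elliptic(2) F(2) _ a(1)])
      show "\<bar>fm x + c\<bar> \<le> \<bar>Cm\<bar> + c" if "x \<in> ball 0 1" "0 < - 1 * x $ e" for x
        using Cm[OF that(1)] that(2) c by simp
    qed (auto simp: C_def)
    show "pucci_sub e 1 a lam Lam C V"
    proof (rule pucci_sub_of_side_sub[OF elliptic(3) uniformly_elliptic_dual[OF F(1)] _ a(1)])
      show "\<bar>- fp x\<bar> \<le> \<bar>Cp\<bar>" if "x \<in> ball 0 1" "0 < 1 * x $ e" for x
        using Cp[OF that(1)] that(2) by simp
    qed (use c in \<open>auto simp: C_def d0\<close>)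
    show "pucci_sub e (- 1) a lam Lam C V"
    proof (rule pucci_sub_of_side_sub[OF elliptic(4) uniformly_elliptic_dual[OF F(2)] _ a(1)])
      show "\<bar>- fm x\<bar> \<le> \<bar>Cm\<bar>" if "x \<in> ball 0 1" "0 < - 1 * x $ e" for x
        using Cm[OF that(1)] that(2) by simp
    qed (use c in \<open>auto simp: C_def d0\<close>)
  qed

  have UVu: "uniformly_continuous_on (cball 0 1) (\<lambda>x. U x + V x)" "uniformly_continuous_on (cball 0 1) V"
    by (rule compact_uniformly_continuous; intro continuous_intros Uc Vc compact_cball)+
  have "0 < \<gamma> / 4" using \<gamma> by simp
  then obtain d1 where d1: "0 < d1" "\<And>x y. x \<in> cball 0 1 \<Longrightarrow> y \<in> cball 0 1 \<Longrightarrow> dist y x < d1 \<Longrightarrow> dist (U y + V y) (U x + V x) < \<gamma> / 4"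
    using UVu(1) unfolding uniformly_continuous_on_def by meson
  have "0 < \<gamma> / 2" using \<gamma> by simp
  then obtain d2 where d2: "0 < d2" "\<And>x y. x \<in> cball 0 1 \<Longrightarrow> y \<in> cball 0 1 \<Longrightarrow> dist y x < d2 \<Longrightarrow> dist (V y) (V x) < \<gamma> / 2"
    using UVu(2) unfolding uniformly_continuous_on_def by meson
  define \<tau> where "\<tau> = min (1/2) (d1 / 2)"
  have \<tau>: "0 < \<tau>" "\<tau> < 1" "\<tau> < d1" unfolding \<tau>_def using d1(1) by auto
  \<comment> \<open>Radial projection to the sphere moves a point within \<open>\<tau>\<close> of it
    by less than \<open>d1\<close>, so there U + V stays below \<open>\<gamma> / 2\<close>.\<close>
  have inner: "norm x < 1 - \<tau>" if x: "x \<in> cball 0 1" and big: "\<gamma> / 2 < U x + V x" for x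
  proof (rule ccontr)
    assume "\<not> norm x < 1 - \<tau>"
    then have nx: "1 - \<tau> \<le> norm x" by simp
    then have nx0: "0 < norm x" using \<tau>(2) by linarith
    define y where "y = (1 / norm x) *\<^sub>R x"
    have y: "norm y = 1" unfolding y_def using nx0 by simp
    have "y - x = (1 / norm x - 1) *\<^sub>R x" unfolding y_def by (simp add: algebra_simps)
    then have "norm (y - x) = \<bar>1 / norm x - 1\<bar> * norm x" by simp
    also have "\<dots> = \<bar>(1 / norm x - 1) * norm x\<bar>" by (simp add: abs_mult)
    also have "\<dots> = 1 - norm x" using nx0 x by (simp add: left_diff_distrib)
    finally have "dist y x < d1" using nx \<tau>(3) by (simp add: dist_norm)
    moreover have yc: "y \<in> cball 0 1" using y by simp
    ultimately have "dist (U y + V y) (U x + V x) < \<gamma> / 4" using d1(2)[OF x] by simp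
    moreover have "U y + V y \<le> \<gamma> / 4"
    proof -
      have "u y \<le> v y" using assms(18) y by simp
      moreover have "\<eta> * bump a e y \<le> \<eta> * 2" using bump(2)[OF yc] \<eta> by (intro mult_left_mono) auto
      ultimately show ?thesis unfolding U_def V_def \<eta>_def by simp
    qed
    ultimately show False using big unfolding dist_real_def by linarith
  qed

  \<comment> \<open>The data are continuous only inside the open ball, so uniform continuity is
    taken on a smaller closed ball, which will contain both contact points.\<close>
  define \<rho> where "\<rho> = 1 - \<tau> / 2"
  have modulus: "\<exists>d>0. \<forall>x\<in>S \<inter> cball 0 \<rho>. \<forall>y\<in>S \<inter> cball 0 \<rho>. dist y x < d \<longrightarrow> dist (f y) (f x) < \<epsilon>"
    if f: "continuous_on {x \<in> ball 0 1. x \<in> S} f" and S: "closed S" and \<epsilon>: "0 < \<epsilon>"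
    for f :: "real^'n \<Rightarrow> real" and S \<epsilon>
  proof -
    have "S \<inter> cball 0 \<rho> \<subseteq> {x \<in> ball 0 1. x \<in> S}" unfolding \<rho>_def using \<tau> by auto
    then have "uniformly_continuous_on (S \<inter> cball 0 \<rho>) f"
      by (intro compact_uniformly_continuous continuous_on_subset[OF f] closed_Int_compact S compact_cball)
    then show ?thesis using \<epsilon> unfolding uniformly_continuous_on_def by meson
  qed
  have closed: "closed {x::real^'n. 0 \<le> x $ e}" "closed {x::real^'n. x $ e \<le> 0}" "closed {x::real^'n. x $ e = 0}"
    by (intro closed_Collect_le closed_Collect_eq continuous_intros)+
  obtain d3 where d3: "0 < d3" "\<forall>x\<in>{x. 0 \<le> x $ e} \<inter> cball 0 \<rho>. \<forall>y\<in>{x. 0 \<le> x $ e} \<inter> cball 0 \<rho>. dist y x < d3 \<longrightarrow> dist (fp y) (fp x) < c"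
    using modulus[of "{x. 0 \<le> x $ e}" fp c] fpc closed(1) c by auto
  obtain d4 where d4: "0 < d4" "\<forall>x\<in>{x. x $ e \<le> 0} \<inter> cball 0 \<rho>. \<forall>y\<in>{x. x $ e \<le> 0} \<inter> cball 0 \<rho>. dist y x < d4 \<longrightarrow> dist (fm y) (fm x) < c"
    using modulus[of "{x. x $ e \<le> 0}" fm c] fmc closed(2) c by auto
  obtain d5 where d5: "0 < d5" "\<forall>x\<in>{x. x $ e = 0} \<inter> cball 0 \<rho>. \<forall>y\<in>{x. x $ e = 0} \<inter> cball 0 \<rho>. dist y x < d5 \<longrightarrow> dist (g y) (g x) < 2 * \<eta>"
    using modulus[of "{x. x $ e = 0}" g "2 * \<eta>"] assms(11)[unfolded Tflat_def] closed(3) \<eta> by auto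
  define d where "d = min (min d2 (\<tau> / 4)) (min d3 (min d4 d5)) / 2"
  have d: "0 < d" "d < d2" "d < \<tau> / 4" "d < d3" "d < d4" "d < d5"
    unfolding d_def using d2(1) d3(1) d4(1) d5(1) \<tau>(1) by auto
  \<comment> \<open>This value serves twice: it gives |x - y| \<le> d at the maximum, and it bounds
    by d the displacement of maximisers in the sup-convolutions at the interface.\<close>
  define k where "k = (4 * B + 1) / d\<^sup>2"
  have k: "0 < k" "k * d\<^sup>2 = 4 * B + 1" unfolding k_def using B0 d(1) by auto

  text \<open>The penalty involves only tangential displacements, so both points lie at the same height and the
    singular weight is the same for both.\<close>
  define Z where "Z = (cball 0 1 \<times> cball 0 1) \<inter> {w::(real^'n) \<times> (real^'n). fst w $ e = snd w $ e}"
  define \<Phi> where "\<Phi> w = U (fst w) + V (snd w) - k / 2 * ((fst w - snd w) \<bullet> (fst w - snd w))" for w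
  have Zc: "compact Z"
    unfolding Z_def by (intro compact_Int_closed compact_Times compact_cball closed_Collect_eq continuous_intros)
  have "continuous_on Z \<Phi>"
    unfolding \<Phi>_def
    by (intro continuous_intros continuous_on_compose2[OF Uc] continuous_on_compose2[OF Vc]) (auto simp: Z_def)
  moreover have x0Z: "(x0, x0) \<in> Z" unfolding Z_def using x0(1) by auto
  then have "Z \<noteq> {}" by auto
  ultimately obtain w where w: "w \<in> Z" "\<And>w'. w' \<in> Z \<Longrightarrow> \<Phi> w' \<le> \<Phi> w"
    using continuous_attains_sup[OF Zc] by blast
  define x y where "x = fst w" and "y = snd w"
  have xy: "x \<in> cball 0 1" "y \<in> cball 0 1" "x $ e = y $ e"
    using w(1) unfolding Z_def x_def y_def by auto
  have max: "U x' + V y' - k / 2 * ((x' - y') \<bullet> (x' - y')) \<le> U x + V y - k / 2 * ((x - y) \<bullet> (x - y))"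
    if "x' \<in> cball 0 1" "y' \<in> cball 0 1" "x' $ e = y' $ e" for x' y'
    using w(2)[of "(x', y')"] that unfolding Z_def \<Phi>_def x_def y_def by simp
  have "\<gamma> \<le> U x0 + V x0"
    unfolding U_def V_def \<gamma>_def using bump(1)[of x0] x0(1) \<eta> by simp
  then have val: "\<gamma> \<le> U x + V y - k / 2 * ((x - y) \<bullet> (x - y))"
    using max[of x0 x0] x0(1) by simp
  have "k * ((x - y) \<bullet> (x - y)) \<le> k * d\<^sup>2"
    unfolding k(2) using val \<gamma> B(1)[OF xy(1)] B(2)[OF xy(2)] by simp
  then have nd: "norm (x - y) \<le> d" using k(1) d(1) by (simp add: power2_norm_eq_inner[symmetric])
  have "0 \<le> k / 2 * ((x - y) \<bullet> (x - y))" using k(1) by simp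
  then have UV: "\<gamma> \<le> U x + V y" using val by linarith
  \<comment> \<open>\<open>inner\<close> speaks of U + V at a single point; the modulus of V moves V
    y to V x at a cost below \<open>\<gamma> / 2\<close>.\<close>
  have "dist (V y) (V x) < \<gamma> / 2" using d2(2)[OF xy(1,2)] nd d(2) by (simp add: dist_norm norm_minus_commute)
  then have nx: "norm x < 1 - \<tau>" using UV inner[OF xy(1)] unfolding dist_real_def by linarith
  have ny: "norm y < 1 - \<tau> / 2"
    using nx nd d(3) \<tau>(1) norm_triangle_ineq[of x "y - x"] by (simp add: norm_minus_commute)
  have xyr: "x \<in> cball 0 \<rho>" "y \<in> cball 0 \<rho>" "x \<in> ball 0 1" "y \<in> ball 0 1"
    using nx ny \<tau> unfolding \<rho>_def by auto
  have dxy: "dist y x \<le> d" using nd by (simp add: dist_norm norm_minus_commute)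
  have shift: "U (x + h) + V (y + h) \<le> U x + V y" if "x + h \<in> cball 0 1" "y + h \<in> cball 0 1" for h
    using max[OF that] xy(3) by simp
  have lam0: "0 \<le> lam" "0 \<le> Lam" "0 < Lam" using lam by auto
  \<comment> \<open>In each case the strictness, c or \<open>2 * \<eta>\<close>, exceeds the
    oscillation of the data between x and y.\<close>
  consider "0 < x $ e" | "x $ e < 0" | "x $ e = 0" by linarith
  then show False
  proof cases
    case 1
    have "fp x + c \<le> fp y"
    proof (rule no_contact_off_interface[OF F(1) lam0(1,2) _ elliptic(1,3) Uc Vc _ _ xyr(3,4) xy(3) _ shift])
      show "continuous_on {x \<in> ball 0 1. 0 < 1 * x $ e} (\<lambda>x. fp x + c)" "continuous_on {x \<in> ball 0 1. 0 < 1 * x $ e} fp"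
        by (intro continuous_intros continuous_on_subset[OF fpc]; auto)+
    qed (use 1 in auto)
    moreover have "dist (fp y) (fp x) < c"
      using d3(2)[rule_format, of x y] xyr xy(3) 1 dxy d(4) by auto
    ultimately show False unfolding dist_real_def by linarith
  next
    case 2
    have "fm x + c \<le> fm y"
    proof (rule no_contact_off_interface[OF F(2) lam0(1,2) _ elliptic(2,4) Uc Vc _ _ xyr(3,4) xy(3) _ shift])
      show "continuous_on {x \<in> ball 0 1. 0 < - 1 * x $ e} (\<lambda>x. fm x + c)" "continuous_on {x \<in> ball 0 1. 0 < - 1 * x $ e} fm"
        by (intro continuous_intros continuous_on_subset[OF fmc]; auto)+
    qed (use 2 in auto)
    moreover have "dist (fm y) (fm x) < c"
      using d4(2)[rule_format, of x y] xyr xy(3) 2 dxy d(5) by auto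
    ultimately show False unfolding dist_real_def by linarith
  next
    case 3
    have "(g x + 2 * \<eta>) + (- g y) \<le> 0"
    proof (rule no_contact_on_interface[OF Uc Vc B k(1) _ _ _ a(2) lam(1) lam0(3) C pucci jump xyr(3) 3 xyr(4) _ _ max])
      show "2 * B \<le> k * d\<^sup>2" unfolding k(2) using B0 by simp
      \<comment> \<open>The midpoint has norm below \<open>1 - 3 * \<tau> / 4\<close> and d is below
        \<open>\<tau> / 4\<close>, which leaves room for the radius
        \<open>\<tau> / 8\<close>.\<close>
      show "0 \<le> d" "0 < \<tau> / 8" using d(1) \<tau>(1) by auto
      show "y $ e = 0" using 3 xy(3) by simp
      have "norm ((1/2) *\<^sub>R (x + y)) \<le> norm x / 2 + norm y / 2" using norm_triangle_ineq[of x y] by simp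
      then show "norm ((1/2) *\<^sub>R (x + y)) + \<tau> / 8 + d < 1" using nx ny d(3) \<tau>(1) by argo
    qed
    moreover have "dist (g y) (g x) < 2 * \<eta>"
      using d5(2)[rule_format, of x y] xyr xy(3) 3 dxy d(6) by auto
    ultimately show False unfolding dist_real_def by linarith
  qed
qed

end
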